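(* Let $Q$ be a smooth manifold of dimension $n$, let $k\ge 1$, let $L:T^{(k)}Q\to\mathbb{R}$ be a smooth Lagrangian, and let $\mathcal{M}\subset T^{(k)}Q$ be a submanifold locally given by the vanishing of smooth functions $\Phi^\alpha:T^{(k)}Q\to\mathbb{R}$, $1\le\alpha\le m$, such that the $m\times n$ matrix $\left(\frac{\partial \Phi^\alpha}{\partial q^{(k)i}}\right)$ has rank $m$ at every point of $\mathcal{M}$. Let $W_0=T^*(T^{(k-1)}Q)\times_{T^{(k-1)}Q}\mathcal{M}$, let $\Omega_{W_0}$ and $H_{W_0}$ be the presymplectic form and Hamiltonian on $W_0$ defined in the context, let $W_1\subset W_0$ be the primary constraint submanifold and $\Omega_{W_1}$ the pullback of $\Omega_{W_0}$ to $W_1$. Put $\mathcal{L}=L-\lambda_\alpha\Phi^\alpha$. Then $(W_1,\Omega_{W_1})$ is a symplectic manifold if and only if, for any choice of local coordinates $(q^{(0)i},\dots,q^{(k-1)i};p^{(0)}_i,\dots,p^{(k-1)}_i,q^{(k)i})$ in $T^*(T^{(k-1)}Q)\oplus T^{(k)}Q$ (induced by local coordinates $(q^i)$ of $Q$), $$ \det\begin{pmatrix} \dfrac{\partial^2 \mathcal{L}}{\partial q^{(k)i}\partial q^{(k)j}} & -\dfrac{\partial\Phi^\alpha}{\partial q^{(k)i}}\\[2mm] \dfrac{\partial\Phi^\beta}{\partial q^{(k)j}} & \mathbf{0} \end{pmatrix} =\det\begin{pmatrix} \dfrac{\partial^2 L}{\partial q^{(k)i}\partial q^{(k)j}}-\lambda_\alpha\dfrac{\partial^2\Phi^\alpha}{\partial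 q^{(k)i}\partial q^{(k)j}} & -\dfrac{\partial\Phi^\alpha}{\partial q^{(k)i}}\\[2mm] \dfrac{\partial\Phi^\beta}{\partial q^{(k)j}} & \mathbf{0} \end{pmatrix}\neq 0 $$ at all points of $W_1$, where $(\lambda_\alpha)$ is the multiplier associated with the point of $W_1$ (see context).
   Context: Summation over repeated indices is used; $i,j=1,\dots,n$ and $\alpha,\beta=1,\dots,m$. $T^{(k)}Q$ is the $k$-th order tangent bundle ($k$-jets at $0$ of curves in $Q$), with coordinates $(q^{(0)i},q^{(1)i},\dots,q^{(k)i})$ induced by coordinates $(q^i)$ on $Q$, where $q^{(s)i}$ is the $s$-th time derivative of $q^i$ along the curve. The canonical immersion $j_k:T^{(k)}Q\to T(T^{(k-1)}Q)$ is, in coordinates, $j_k(q^{(0)},\dots,q^{(k)})=(q^{(0)},\dots,q^{(k-1)};q^{(1)},\dots,q^{(k)})$. $T^*(T^{(k-1)}Q)\oplus T^{(k)}Q$ denotes the fibre product over $T^{(k-1)}Q$, with coordinates $(q^{(0)i},\dots,q^{(k-1)i};p^{(0)}_i,\dots,p^{(k-1)}_i,q^{(k)i})$, where $p^{(r)}_i$ is the momentum conjugate to $q^{(r)i}$; $W_0$ is the preimage of $\mathcal{M}$ under its projection to $T^{(k)}Q$. Functions on $T^{(k)}Q$ (such as $L$, $\Phi^\alpha$) are regarded as functions on this fibre product by pullback. $\Omega_{W_0}=\pi_1^*\omega$, where $\pi_1:W_0\to T^*(T^{(k-1)}Q)$ is the projection and $\omega=\sum_{r=0}^{k-1}dq^{(r)i}\wedge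 dp^{(r)}_i$ is the canonical symplectic form. $H_{W_0}:W_0\to\mathbb{R}$ is $H_{W_0}(\alpha,p)=\langle\alpha,j_k(p)\rangle-L|_{\mathcal{M}}(p)$; in coordinates it is the restriction to $W_0$ of $\sum_{r=0}^{k-1}q^{(r+1)i}p^{(r)}_i-L(q^{(0)},\dots,q^{(k)})$. The primary constraint set is $W_1=\{x\in W_0 : dH_{W_0}(x)(Z)=0 \text{ for all } Z\in\ker\Omega_{W_0}(x)\}$ (assumed to be a submanifold). In coordinates, $W_1$ consists of the points of $W_0$ for which there exist real numbers $\lambda_\alpha$ with $$p^{(k-1)}_i-\frac{\partial L}{\partial q^{(k)i}}+\lambda_\alpha\frac{\partial\Phi^\alpha}{\partial q^{(k)i}}=0,\qquad i=1,\dots,n.$$ By the rank condition such $\lambda_\alpha$ are unique at each point of $W_1$; these are the multipliers at which the matrices are evaluated. *)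

theory Defs
  imports "HOL-Analysis.Analysis"
begin

section \<open>Smooth maps between Euclidean spaces\<close>

text \<open>For open S in a finite-dimensional space this is the usual class of r times continuously
  differentiable maps: the derivative is continuous as soon as each directional derivative is.\<close>

fun C_on :: "nat \<Rightarrow> 'a::euclidean_space set \<Rightarrow> ('a \<Rightarrow> 'b::real_normed_vector) \<Rightarrow> bool" where
  "C_on 0 S f \<longleftrightarrow> continuous_on S f"
| "C_on (Suc r) S f \<longleftrightarrow>
     (\<forall>x\<in>S. f differentiable (at x)) \<and> (\<forall>v. C_on r S (\<lambda>x. frechet_derivative f (at x) v))"

definition smooth_on :: "'a::euclidean_space set \<Rightarrow> ('a \<Rightarrow> 'b::real_normed_vector) \<Rightarrow> bool" where
  "smooth_on S f \<longleftrightarrow> (\<forall>r. C_on r S f)"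


section \<open>Manifolds given by charts\<close>

text \<open>A chart is a pair of its domain and its coordinate map; the values of the map outside the
  domain are irrelevant.\<close>

type_synonym ('x, 'e) chart = "'x set \<times> ('x \<Rightarrow> 'e)"

definition points :: "('x, 'e) chart set \<Rightarrow> 'x set" where
  "points \<A> = \<Union> (fst ` \<A>)"

definition local_rep :: "('x, 'e) chart \<Rightarrow> ('x \<Rightarrow> 'b) \<Rightarrow> 'e \<Rightarrow> 'b" where
  "local_rep c f = f \<circ> inv_into (fst c) (snd c)"

definition topological_chart :: "'x topology \<Rightarrow> ('x, 'e::euclidean_space) chart \<Rightarrow> bool" where
  "topological_chart X = (\<lambda>(U, \<phi>). openin X U \<and> open (\<phi> ` U) \<and>
     homeomorphic_map (subtopology X U) (top_of_set (\<phi> ` U)) \<phi>)"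

definition smooth_transition ::
    "('x, 'e::euclidean_space) chart \<Rightarrow> ('x, 'e) chart \<Rightarrow> bool" where
  "smooth_transition c d \<longleftrightarrow> smooth_on (snd c ` (fst c \<inter> fst d)) (local_rep c (snd d))"

text \<open>The set of charts is a maximal smooth atlas, so that its elements are all the local
  coordinate systems of the manifold.\<close>

definition smooth_manifold :: "'x topology \<Rightarrow> ('x, 'e::euclidean_space) chart set \<Rightarrow> bool" where
  "smooth_manifold X \<A> \<longleftrightarrow>
     Hausdorff_space X \<and> second_countable X \<and> points \<A> = topspace X \<and>
     (\<forall>c\<in>\<A>. topological_chart X c) \<and>
     (\<forall>c\<in>\<A>. \<forall>d\<in>\<A>. smooth_transition c d) \<and>
     (\<forall>c. topological_chart X c \<and> (\<forall>d\<in>\<A>. smooth_transition c d \<and> smooth_transition d c)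
        \<longrightarrow> c \<in> \<A>)"

text \<open>The notions below only use an atlas, which need not be maximal. The atlases of the bundles
  over a manifold consist of the charts induced by the charts of the base; the topology of the
  total space is the one determined by the atlas.\<close>

definition atlas_open :: "('x, 'e::euclidean_space) chart set \<Rightarrow> 'x set \<Rightarrow> bool" where
  "atlas_open \<A> V \<longleftrightarrow> V \<subseteq> points \<A> \<and> (\<forall>(U, \<phi>)\<in>\<A>. open (\<phi> ` (V \<inter> U)))"

definition smooth_fun ::
    "('x, 'e::euclidean_space) chart set \<Rightarrow> 'x set \<Rightarrow> ('x \<Rightarrow> 'b::real_normed_vector) \<Rightarrow> bool" where
  "smooth_fun \<A> V f \<longleftrightarrow> (\<forall>c\<in>\<A>. smooth_on (snd c ` (V \<inter> fst c)) (local_rep c f))"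


section \<open>Jets of curves, tangent and cotangent vectors\<close>

text \<open>Curves are total functions on the reals of which only the germ at 0 matters.\<close>

definition near0 :: "(real \<Rightarrow> 'x) \<Rightarrow> 'x set \<Rightarrow> bool" where
  "near0 c S \<longleftrightarrow> (\<exists>e>0. \<forall>t\<in>{-e<..<e}. c t \<in> S)"

definition smooth_curve :: "('x, 'e::euclidean_space) chart set \<Rightarrow> (real \<Rightarrow> 'x) \<Rightarrow> bool" where
  "smooth_curve \<A> c \<longleftrightarrow>
     (\<exists>(U, \<phi>)\<in>\<A>. \<exists>e>0. (\<forall>t\<in>{-e<..<e}. c t \<in> U) \<and> smooth_on {-e<..<e} (\<phi> \<circ> c))"

definition curve_deriv :: "nat \<Rightarrow> (real \<Rightarrow> 'e::real_normed_vector) \<Rightarrow> real \<Rightarrow> 'e" where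
  "curve_deriv s f = ((\<lambda>g t. vector_derivative g (at t)) ^^ s) f"

definition contact ::
    "('x, 'e::euclidean_space) chart set \<Rightarrow> nat \<Rightarrow> (real \<Rightarrow> 'x) \<Rightarrow> (real \<Rightarrow> 'x) \<Rightarrow> bool" where
  "contact \<A> r c d \<longleftrightarrow> c 0 = d 0 \<and>
     (\<forall>(U, \<phi>)\<in>\<A>. c 0 \<in> U \<longrightarrow> (\<forall>s\<le>r. curve_deriv s (\<phi> \<circ> c) 0 = curve_deriv s (\<phi> \<circ> d) 0))"

text \<open>An r-jet at 0 is an equivalence class of curves.\<close>

type_synonym 'x jet = "(real \<Rightarrow> 'x) set"

definition jet :: "('x, 'e::euclidean_space) chart set \<Rightarrow> nat \<Rightarrow> (real \<Rightarrow> 'x) \<Rightarrow> 'x jet" where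
  "jet \<A> r c = {d. smooth_curve \<A> d \<and> contact \<A> r c d}"

definition jet_space :: "('x, 'e::euclidean_space) chart set \<Rightarrow> nat \<Rightarrow> 'x jet set" where
  "jet_space \<A> r = jet \<A> r ` {c. smooth_curve \<A> c}"

definition jet_curve :: "'x jet \<Rightarrow> real \<Rightarrow> 'x" where
  "jet_curve j = (SOME c. c \<in> j)"

definition jet_base :: "'x jet \<Rightarrow> 'x" where
  "jet_base j = jet_curve j 0"

text \<open>The coordinate q^(s) of a jet in the chart with coordinate map \<open>\<phi>\<close>.\<close>

definition jet_coord :: "('x \<Rightarrow> 'e::euclidean_space) \<Rightarrow> nat \<Rightarrow> 'x jet \<Rightarrow> 'e" where
  "jet_coord \<phi> s j = curve_deriv s (\<phi> \<circ> jet_curve j) 0"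

text \<open>Tangent vectors are 1-jets; those tangent to a submanifold S are represented by curves
  in S.\<close>

definition tangent_space ::
    "('x, 'e::euclidean_space) chart set \<Rightarrow> 'x set \<Rightarrow> 'x \<Rightarrow> 'x jet set" where
  "tangent_space \<A> S x = {jet \<A> 1 c |c. smooth_curve \<A> c \<and> near0 c S \<and> c 0 = x}"

abbreviation velocity :: "('x \<Rightarrow> 'e::euclidean_space) \<Rightarrow> 'x jet \<Rightarrow> 'e" where
  "velocity \<phi> \<equiv> jet_coord \<phi> 1"

definition curve_in :: "'x set \<Rightarrow> 'x jet \<Rightarrow> real \<Rightarrow> 'x" where
  "curve_in S Z = (SOME c. c \<in> Z \<and> near0 c S)"

text \<open>The differential of a function given on S, applied to a vector tangent to S.\<close>

definition differential :: "'x set \<Rightarrow> ('x \<Rightarrow> real) \<Rightarrow> 'x jet \<Rightarrow> real" where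
  "differential S f Z = deriv (f \<circ> curve_in S Z) 0"

text \<open>Pullback of a 2-form under a map given on S with values in the manifold with atlas
  \<open>\<B>\<close>.\<close>

definition pullback ::
    "('y, 'e::euclidean_space) chart set \<Rightarrow> 'x set \<Rightarrow> ('x \<Rightarrow> 'y) \<Rightarrow>
     ('y jet \<Rightarrow> 'y jet \<Rightarrow> real) \<Rightarrow> 'x jet \<Rightarrow> 'x jet \<Rightarrow> real" where
  "pullback \<B> S f \<omega> Z Y =
     \<omega> (jet \<B> 1 (f \<circ> curve_in S Z)) (jet \<B> 1 (f \<circ> curve_in S Y))"

text \<open>Covectors are the linear functionals on the tangent space, the linear structure of the
  latter being the one transported from the model space by any chart.\<close>

type_synonym 'x covector = "'x jet \<Rightarrow> real"

definition cotangent_space ::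
    "('x, 'e::euclidean_space) chart set \<Rightarrow> 'x \<Rightarrow> 'x covector set" where
  "cotangent_space \<A> x =
     {\<alpha> \<in> extensional (tangent_space \<A> (points \<A>) x).
        \<forall>(U, \<phi>)\<in>\<A>. x \<in> U \<longrightarrow>
          (\<exists>l. linear l \<and> (\<forall>v\<in>tangent_space \<A> (points \<A>) x. \<alpha> v = l (velocity \<phi> v)))}"

definition momentum ::
    "('x, 'e::euclidean_space) chart set \<Rightarrow> ('x \<Rightarrow> 'e) \<Rightarrow> 'x \<times> 'x covector \<Rightarrow> 'e" where
  "momentum \<A> \<phi> = (\<lambda>(x, \<alpha>).
     THE p. \<forall>v\<in>tangent_space \<A> (points \<A>) x. \<alpha> v = p \<bullet> velocity \<phi> v)"

definition cotangent_chart ::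
    "('x, 'e::euclidean_space) chart set \<Rightarrow> ('x, 'e) chart \<Rightarrow> ('x \<times> 'x covector, 'e \<times> 'e) chart"
  where
  "cotangent_chart \<A> = (\<lambda>(U, \<phi>).
     ({(x, \<alpha>). x \<in> U \<and> \<alpha> \<in> cotangent_space \<A> x}, \<lambda>a. (\<phi> (fst a), momentum \<A> \<phi> a)))"

definition cotangent_atlas ::
    "('x, 'e::euclidean_space) chart set \<Rightarrow> ('x \<times> 'x covector, 'e \<times> 'e) chart set" where
  "cotangent_atlas \<A> = cotangent_chart \<A> ` \<A>"

text \<open>The form that reads dq \<open>\<and>\<close> dp in every induced chart.\<close>

definition canonical_form ::
    "('x, 'e::euclidean_space) chart set \<Rightarrow>
     ('x \<times> 'x covector) jet \<Rightarrow> ('x \<times> 'x covector) jet \<Rightarrow> real" where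
  "canonical_form \<A> Z Y =
     (THE r. \<forall>(D, \<xi>)\<in>cotangent_atlas \<A>. jet_base Z \<in> D \<longrightarrow>
        r = fst (velocity \<xi> Z) \<bullet> snd (velocity \<xi> Y) - fst (velocity \<xi> Y) \<bullet> snd (velocity \<xi> Z))"


section \<open>Submanifolds and symplectic manifolds\<close>

text \<open>\<open>\<Psi>\<close> is a diffeomorphism between open sets that flattens S to the linear subspace P.\<close>

definition slice ::
    "'e::euclidean_space set \<Rightarrow> 'e set \<Rightarrow> ('e \<Rightarrow> 'e) \<Rightarrow> 'e set \<Rightarrow> bool" where
  "slice S D \<Psi> P \<longleftrightarrow>
     open D \<and> open (\<Psi> ` D) \<and> inj_on \<Psi> D \<and> smooth_on D \<Psi> \<and> smooth_on (\<Psi> ` D) (inv_into D \<Psi>) \<and>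
     subspace P \<and> \<Psi> ` (S \<inter> D) = P \<inter> \<Psi> ` D"

definition slice_in ::
    "('x, 'e::euclidean_space) chart \<Rightarrow> 'x set \<Rightarrow> 'e set \<Rightarrow> ('e \<Rightarrow> 'e) \<Rightarrow> 'e set \<Rightarrow> bool" where
  "slice_in c S D \<Psi> P \<longleftrightarrow> D \<subseteq> snd c ` fst c \<and> slice (snd c ` (S \<inter> fst c)) D \<Psi> P"

definition submanifold :: "('x, 'e::euclidean_space) chart set \<Rightarrow> 'x set \<Rightarrow> bool" where
  "submanifold \<A> S \<longleftrightarrow> S \<subseteq> points \<A> \<and>
     (\<forall>c\<in>\<A>. \<forall>y\<in>snd c ` (S \<inter> fst c). \<exists>D \<Psi> P. y \<in> D \<and> slice_in c S D \<Psi> P)"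

text \<open>The coefficient at y in directions a and b of a 2-form in the coordinates \<open>\<Psi>\<close> o c; with
  y, a and b in P these are coordinates of the submanifold.\<close>

definition form_coeff ::
    "('x, 'e::euclidean_space) chart set \<Rightarrow> ('x jet \<Rightarrow> 'x jet \<Rightarrow> real) \<Rightarrow> ('x, 'e) chart \<Rightarrow>
     'e set \<Rightarrow> ('e \<Rightarrow> 'e) \<Rightarrow> 'e \<Rightarrow> 'e \<Rightarrow> 'e \<Rightarrow> real" where
  "form_coeff \<A> \<Omega> c D \<Psi> y a b =
     (let \<psi> = inv_into (fst c) (snd c) \<circ> inv_into D \<Psi>
      in \<Omega> (jet \<A> 1 (\<lambda>t. \<psi> (y + t *\<^sub>R a))) (jet \<A> 1 (\<lambda>t. \<psi> (y + t *\<^sub>R b))))"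

definition two_form ::
    "('x, 'e::euclidean_space) chart set \<Rightarrow> 'x set \<Rightarrow> ('x jet \<Rightarrow> 'x jet \<Rightarrow> real) \<Rightarrow> bool" where
  "two_form \<A> S \<Omega> \<longleftrightarrow>
     (\<forall>c\<in>\<A>. \<forall>D \<Psi> P. slice_in c S D \<Psi> P \<longrightarrow>
        (\<forall>y\<in>P \<inter> \<Psi> ` D. \<forall>a\<in>P. \<forall>b\<in>P. \<forall>b'\<in>P. \<forall>s.
           form_coeff \<A> \<Omega> c D \<Psi> y a b = - form_coeff \<A> \<Omega> c D \<Psi> y b a \<and>
           form_coeff \<A> \<Omega> c D \<Psi> y a (s *\<^sub>R b + b') =
             s * form_coeff \<A> \<Omega> c D \<Psi> y a b + form_coeff \<A> \<Omega> c D \<Psi> y a b') \<and>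
        (\<forall>a\<in>P. \<forall>b\<in>P. \<exists>h. smooth_on (\<Psi> ` D) h \<and>
           (\<forall>y\<in>P \<inter> \<Psi> ` D. form_coeff \<A> \<Omega> c D \<Psi> y a b = h y)))"

definition closed_form ::
    "('x, 'e::euclidean_space) chart set \<Rightarrow> 'x set \<Rightarrow> ('x jet \<Rightarrow> 'x jet \<Rightarrow> real) \<Rightarrow> bool" where
  "closed_form \<A> S \<Omega> \<longleftrightarrow>
     (\<forall>c\<in>\<A>. \<forall>D \<Psi> P. slice_in c S D \<Psi> P \<longrightarrow>
        (\<forall>y\<in>P \<inter> \<Psi> ` D. \<forall>a1\<in>P. \<forall>a2\<in>P. \<forall>a3\<in>P.
           deriv (\<lambda>t. form_coeff \<A> \<Omega> c D \<Psi> (y + t *\<^sub>R a1) a2 a3) 0 +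
           deriv (\<lambda>t. form_coeff \<A> \<Omega> c D \<Psi> (y + t *\<^sub>R a2) a3 a1) 0 +
           deriv (\<lambda>t. form_coeff \<A> \<Omega> c D \<Psi> (y + t *\<^sub>R a3) a1 a2) 0 = 0))"

definition form_kernel ::
    "('x, 'e::euclidean_space) chart set \<Rightarrow> 'x set \<Rightarrow> ('x jet \<Rightarrow> 'x jet \<Rightarrow> real) \<Rightarrow> 'x \<Rightarrow> 'x jet set"
  where
  "form_kernel \<A> S \<Omega> x =
     {Z \<in> tangent_space \<A> S x. \<forall>Y\<in>tangent_space \<A> S x. \<Omega> Z Y = 0}"

definition symplectic_manifold ::
    "('x, 'e::euclidean_space) chart set \<Rightarrow> 'x set \<Rightarrow> ('x jet \<Rightarrow> 'x jet \<Rightarrow> real) \<Rightarrow> bool" where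
  "symplectic_manifold \<A> S \<Omega> \<longleftrightarrow>
     submanifold \<A> S \<and> two_form \<A> S \<Omega> \<and> closed_form \<A> S \<Omega> \<and>
     (\<forall>x\<in>S. form_kernel \<A> S \<Omega> x = {jet \<A> 1 (\<lambda>_. x)})"


section \<open>Higher order tangent bundles\<close>

text \<open>The order k is the cardinality of the index type \<open>'k\<close>, whose elements stand, in increasing
  order, for 0, ..., k - 1.\<close>

type_synonym ('n, 'k) lower = "((real, 'n) vec, 'k) vec"
type_synonym ('n, 'k) jet_coords = "('n, 'k) lower \<times> (real, 'n) vec"
type_synonym ('n, 'k) fibre_coords = "('n, 'k) lower \<times> ('n, 'k) lower \<times> (real, 'n) vec"

definition pos :: "'k::{finite, linorder} \<Rightarrow> nat" where
  "pos r = card {s. s < r}"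

text \<open>Induced charts of the tangent bundles of order k and k - 1, with coordinates
  ((q^(0), ..., q^(k-1)), q^(k)) and (q^(0), ..., q^(k-1)) respectively.\<close>

definition Tk_chart ::
    "('q, real^'n) chart set \<Rightarrow> ('q, real^'n) chart \<Rightarrow>
     ('q jet, ('n, 'k::{finite, linorder}) jet_coords) chart" where
  "Tk_chart \<A> c =
     ({j \<in> jet_space \<A> CARD('k). jet_base j \<in> fst c},
      \<lambda>j. (\<chi> r. jet_coord (snd c) (pos r) j, jet_coord (snd c) CARD('k) j))"

definition Tk_atlas ::
    "('q, real^'n) chart set \<Rightarrow>
     ('q jet, ('n, 'k::{finite, linorder}) jet_coords) chart set" where
  "Tk_atlas \<A> = Tk_chart \<A> ` \<A>"

definition Tk1_chart ::
    "('q, real^'n) chart set \<Rightarrow> ('q, real^'n) chart \<Rightarrow>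
     ('q jet, ('n, 'k::{finite, linorder}) lower) chart" where
  "Tk1_chart \<A> c =
     ({j \<in> jet_space \<A> (CARD('k) - 1). jet_base j \<in> fst c},
      \<lambda>j. \<chi> r. jet_coord (snd c) (pos r) j)"

definition Tk1_atlas ::
    "('q, real^'n) chart set \<Rightarrow> ('q jet, ('n, 'k::{finite, linorder}) lower) chart set" where
  "Tk1_atlas \<A> = Tk1_chart \<A> ` \<A>"

definition jet_proj :: "'k::{finite, linorder} itself \<Rightarrow> ('q, real^'n) chart set \<Rightarrow>
    'q jet \<Rightarrow> 'q jet" where
  "jet_proj k \<A> p = jet \<A> (CARD('k) - 1) (jet_curve p)"

definition canonical_immersion :: "'k::{finite, linorder} itself \<Rightarrow> ('q, real^'n) chart set \<Rightarrow>
    'q jet \<Rightarrow> 'q jet jet" where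
  "canonical_immersion k \<A> p =
     jet (Tk1_atlas \<A> :: ('q jet, ('n, 'k) lower) chart set) 1
       (\<lambda>t. jet \<A> (CARD('k) - 1) (\<lambda>s. jet_curve p (t + s)))"

text \<open>The fibre product of the cotangent bundle of the (k-1)-st order tangent bundle and the k-th
  order tangent bundle, with coordinates ((q^(0), ..., q^(k-1)), (p^(0), ..., p^(k-1)), q^(k)).\<close>

type_synonym 'q fibre_point = "('q jet \<times> 'q jet covector) \<times> 'q jet"

definition fibre_chart ::
    "('q, real^'n) chart set \<Rightarrow> ('q, real^'n) chart \<Rightarrow>
     ('q fibre_point, ('n, 'k::{finite, linorder}) fibre_coords) chart" where
  "fibre_chart \<A> c =
     (let (D, \<xi>) = cotangent_chart (Tk1_atlas \<A>) (Tk1_chart \<A> c :: ('q jet, ('n, 'k) lower) chart);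
          (E, \<eta>) = (Tk_chart \<A> c :: ('q jet, ('n, 'k) jet_coords) chart)
      in ({(a, p). a \<in> D \<and> p \<in> E \<and> fst a = jet_proj TYPE('k) \<A> p},
          \<lambda>(a, p). (fst (\<xi> a), snd (\<xi> a), snd (\<eta> p))))"

definition fibre_atlas ::
    "('q, real^'n) chart set \<Rightarrow>
     ('q fibre_point, ('n, 'k::{finite, linorder}) fibre_coords) chart set" where
  "fibre_atlas \<A> = fibre_chart \<A> ` \<A>"


section \<open>The presymplectic system and its primary constraint set\<close>

definition W0 ::
    "'k::{finite, linorder} itself \<Rightarrow> ('q, real^'n) chart set \<Rightarrow> 'q jet set \<Rightarrow> 'q fibre_point set"
  where
  "W0 k \<A> M = {x \<in> points (fibre_atlas \<A> ::
       ('q fibre_point, ('n, 'k) fibre_coords) chart set). snd x \<in> M}"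

definition Omega_W0 ::
    "'k::{finite, linorder} itself \<Rightarrow> ('q, real^'n) chart set \<Rightarrow> 'q jet set \<Rightarrow>
     'q fibre_point jet \<Rightarrow> 'q fibre_point jet \<Rightarrow> real" where
  "Omega_W0 k \<A> M =
     (let \<N> = (Tk1_atlas \<A> :: ('q jet, ('n, 'k) lower) chart set)
      in pullback (cotangent_atlas \<N>) (W0 k \<A> M) fst (canonical_form \<N>))"

text \<open>The formula makes sense on the whole fibre product; only the values on W0 are used.\<close>

definition H_W0 ::
    "'k::{finite, linorder} itself \<Rightarrow> ('q, real^'n) chart set \<Rightarrow> ('q jet \<Rightarrow> real) \<Rightarrow>
     'q fibre_point \<Rightarrow> real" where
  "H_W0 k \<A> L = (\<lambda>((y, \<alpha>), p). \<alpha> (canonical_immersion k \<A> p) - L p)"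

definition W1 ::
    "'k::{finite, linorder} itself \<Rightarrow> ('q, real^'n) chart set \<Rightarrow> ('q jet \<Rightarrow> real) \<Rightarrow> 'q jet set \<Rightarrow>
     'q fibre_point set" where
  "W1 k \<A> L M =
     (let \<F> = (fibre_atlas \<A> ::
            ('q fibre_point, ('n, 'k) fibre_coords) chart set)
      in {x \<in> W0 k \<A> M. \<forall>Z\<in>form_kernel \<F> (W0 k \<A> M) (Omega_W0 k \<A> M) x.
            differential (W0 k \<A> M) (H_W0 k \<A> L) Z = 0})"

definition Omega_W1 ::
    "'k::{finite, linorder} itself \<Rightarrow> ('q, real^'n) chart set \<Rightarrow> ('q jet \<Rightarrow> real) \<Rightarrow> 'q jet set \<Rightarrow>
     'q fibre_point jet \<Rightarrow> 'q fibre_point jet \<Rightarrow> real" where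
  "Omega_W1 k \<A> L M =
     pullback (fibre_atlas \<A> ::
         ('q fibre_point, ('n, 'k) fibre_coords) chart set)
       (W1 k \<A> L M) (\<lambda>x. x) (Omega_W0 k \<A> M)"


section \<open>Constraint functions, multipliers and the determinant\<close>

text \<open>The derivative with respect to q^(k)i of a coordinate expression.\<close>

definition top_partial ::
    "'n \<Rightarrow> ('e::real_normed_vector \<times> (real^'n) \<Rightarrow> real) \<Rightarrow> 'e \<times> (real^'n) \<Rightarrow> real" where
  "top_partial i f z = frechet_derivative f (at z) (0, axis i 1)"

text \<open>\<open>\<Phi>\<close> is a system of smooth functions on the open set V cutting out M in V and satisfying the
  rank condition.\<close>

definition defining_functions ::
    "'k::{finite, linorder} itself \<Rightarrow> ('q, real^'n) chart set \<Rightarrow> 'q jet set \<Rightarrow> 'q jet set \<Rightarrow>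
     ('q jet \<Rightarrow> real^'m) \<Rightarrow> bool" where
  "defining_functions k \<A> M V \<Phi> \<longleftrightarrow>
     atlas_open (Tk_atlas \<A> :: ('q jet, ('n, 'k) jet_coords) chart set) V \<and>
     smooth_fun (Tk_atlas \<A> :: ('q jet, ('n, 'k) jet_coords) chart set) V \<Phi> \<and>
     M \<inter> V = {p \<in> V. \<Phi> p = 0} \<and>
     (\<forall>c\<in>(Tk_atlas \<A> :: ('q jet, ('n, 'k) jet_coords) chart set). \<forall>p\<in>M \<inter> V \<inter> fst c.
        rank (\<chi> \<alpha> i. top_partial i (local_rep c (\<lambda>p. \<Phi> p $ \<alpha>)) (snd c p) :: real^'n^'m)
          = CARD('m))"

text \<open>The component of P at the greatest index is the momentum p^(k-1).\<close>

definition multiplier ::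
    "'k::{finite, linorder} itself \<Rightarrow> ('q, real^'n) chart set \<Rightarrow> ('q jet \<Rightarrow> real) \<Rightarrow>
     ('q jet \<Rightarrow> real^'m) \<Rightarrow> ('q, real^'n) chart \<Rightarrow> 'q fibre_point \<Rightarrow> real^'m" where
  "multiplier k \<A> L \<Phi> c x =
     (let (u :: ('n, 'k) lower, P, v) = snd (fibre_chart \<A> c) x;
          d = Tk_chart \<A> c
      in THE l. \<forall>i. P $ Max UNIV $ i - top_partial i (local_rep d L) (u, v) +
           (\<Sum>\<alpha>\<in>UNIV. l $ \<alpha> * top_partial i (local_rep d (\<lambda>p. \<Phi> p $ \<alpha>)) (u, v)) = 0)"

definition bordered_matrix ::
    "('n \<Rightarrow> 'n \<Rightarrow> real) \<Rightarrow> ('m \<Rightarrow> 'n \<Rightarrow> real) \<Rightarrow> real^('n::finite + 'm::finite)^('n + 'm)" where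
  "bordered_matrix A B = (\<chi> a b.
     case a of
       Inl i \<Rightarrow> (case b of Inl j \<Rightarrow> A i j | Inr \<alpha> \<Rightarrow> - B \<alpha> i)
     | Inr \<beta> \<Rightarrow> (case b of Inl j \<Rightarrow> B \<beta> j | Inr \<alpha> \<Rightarrow> 0))"

end

theory Submission
  imports Defs
begin

text \<open>In induced coordinates (u, P, v) the kernel of the form on W0 consists of the vectors
  (0, 0, w) with w annihilated by all differentials of the constraints, so that W1 is given by
  the multiplier equation. A vector is tangent to W1 iff it satisfies the linearized constraints
  and the linearized multiplier equation; on vectors (0, 0, w) these equations form, with the
  variation of the multipliers as additional unknown, the homogeneous system of the bordered matrix.
  If the determinant vanishes, a solution yields a non-zero tangent vector (0, 0, w), which
  lies in the kernel of the form. If it does not vanish, the inhomogeneous bordered system extends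
  every (du, dP) to a vector tangent to W1; hence a kernel vector has the form (0, 0, w) and w
  solves the homogeneous system, so it is zero.\<close>

section \<open>Calculus of smooth maps\<close>

text \<open>Tangent vectors are 1-jets of smooth curves, so whenever a solution of the linearized
  equations is claimed to be tangent, an actual smooth curve in the set is required. For M it arises
  in two stages: the inverse function theorem gives a curve of zeros of the constraints with a
  derivative at 0, and a flattening of the submanifold M replaces it by a smooth curve with the same
  velocity. For W1 the point is that the multiplier equation contains p^(k-1) with coefficient one:
  a curve in W0 is moved into W1 by changing that momentum alone. Conversely, along a curve in W1
  the multipliers are known only pointwise. Freezing them at their value at 0 makes the residual of
  the multiplier equation a combination of constraint gradients with unknown coefficients, and this
  can be differentiated modulo the span of the gradients. The pullback of dq ^ dp to W1 is always a
  closed 2-form, so being symplectic is a pointwise question about kernels. The multiplier is held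
  constant while L - \<lambda>\<Phi> is differentiated; hence the two determinants agree
  identically.\<close>

lemma frechet_derivative_eqI:
  "(f has_derivative f') (at x) \<Longrightarrow> frechet_derivative f (at x) = f'"
  by (rule frechet_derivative_at[symmetric])

text \<open>Differentiability is not assumed: \<open>frechet_derivative\<close> is chosen among all
  derivatives at x, and maps that agree near x have the same ones.\<close>

lemma frechet_derivative_cong_open:
  assumes "open S" "x \<in> S" "\<And>y. y \<in> S \<Longrightarrow> f y = g y"
  shows "frechet_derivative f (at x) = frechet_derivative g (at x)"
proof -
  have "(f has_derivative D) (at x) \<longleftrightarrow> (g has_derivative D) (at x)" for D
    by (metis assms has_derivative_transform_within_open)
  then show ?thesis
    by (simp add: frechet_derivative_def)
qed

lemma differentiable_cong_open:
  assumes "open S" "x \<in> S" "\<And>y. y \<in> S \<Longrightarrow> f y = g y" "f differentiable (at x)"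
  shows "g differentiable (at x)"
  by (metis assms differentiable_def has_derivative_transform_within_open)

section \<open>Closure properties of the classes \<open>C_on r\<close>\<close>

lemma C_on_cong:
  assumes "open S" "\<And>x. x \<in> S \<Longrightarrow> f x = g x" "C_on r S f"
  shows "C_on r S g"
  using assms(2,3)
proof (induction r arbitrary: f g)
  case 0
  then show ?case by (simp cong: continuous_on_cong)
next
  case (Suc r)
  have "C_on r S (\<lambda>x. frechet_derivative g (at x) v)" for v
  proof (rule Suc.IH)
    show "C_on r S (\<lambda>x. frechet_derivative f (at x) v)" using Suc.prems by simp
    show "\<And>x. x \<in> S \<Longrightarrow> frechet_derivative f (at x) v = frechet_derivative g (at x) v"
      using frechet_derivative_cong_open[OF assms(1)] Suc.prems(1) by metis
  qed
  moreover have "g differentiable (at x)" if "x \<in> S" for x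
    using differentiable_cong_open[OF assms(1) that Suc.prems(1)] Suc.prems(2) that by auto
  ultimately show ?case by auto
qed

lemma C_on_subset: "C_on r S f \<Longrightarrow> T \<subseteq> S \<Longrightarrow> C_on r T f"
  by (induction r arbitrary: f) (auto intro: continuous_on_subset)

lemma C_on_SucD: "C_on (Suc r) S f \<Longrightarrow> C_on r S f"
proof (induction r arbitrary: f)
  case 0
  then show ?case
    by (simp add: continuous_at_imp_continuous_on differentiable_imp_continuous_within)
next
  case (Suc r)
  then have "C_on r S (\<lambda>x. frechet_derivative f (at x) v)" for v
    by (intro Suc.IH) simp
  with Suc.prems show ?case
    by simp
qed

text \<open>The pattern of the closure proofs for \<open>C_on\<close>: the formula for the
  derivative holds only at points of S, so the induction hypothesis is applied to the formula and
  the result is carried over by \<open>C_on_cong\<close>. This is where S has to be open.\<close>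

lemma C_on_linear_compose:
  assumes "open S" "bounded_linear l" "C_on r S f"
  shows "C_on r S (\<lambda>x. l (f x))"
  using assms(3)
proof (induction r arbitrary: f)
  case 0
  then show ?case
    using bounded_linear.continuous_on[OF assms(2)] by auto
next
  case (Suc r)
  have der: "((\<lambda>x. l (f x)) has_derivative (\<lambda>v. l (frechet_derivative f (at x) v))) (at x)"
    if "x \<in> S" for x
    using Suc.prems that
    by (auto intro!: bounded_linear.has_derivative[OF assms(2)] simp: frechet_derivative_works)
  have "C_on r S (\<lambda>x. frechet_derivative (\<lambda>x. l (f x)) (at x) v)" for v
  proof (rule C_on_cong[OF assms(1)])
    show "C_on r S (\<lambda>x. l (frechet_derivative f (at x) v))"
      using Suc by auto
  qed (simp add: frechet_derivative_eqI[OF der])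
  then show ?case
    using der by (auto simp: differentiable_def)
qed

lemma C_on_const: "C_on r S (\<lambda>x. c)"
  by (induction r arbitrary: c) auto

lemma C_on_linear:
  assumes "bounded_linear l"
  shows "C_on r S l"
proof (cases r)
  case 0
  then show ?thesis
    using assms linear_continuous_on by auto
next
  case (Suc q)
  have "(l has_derivative l) (at x)" for x
    by (rule bounded_linear_imp_has_derivative[OF assms])
  then show ?thesis
    unfolding Suc by (auto simp: differentiable_def frechet_derivative_eqI[OF \<open>\<And>x. (l has_derivative l) (at x)\<close>] C_on_const)
qed

lemma C_on_add:
  assumes "open S" "C_on r S f" "C_on r S g"
  shows "C_on r S (\<lambda>x. f x + g x)"
  using assms(2,3)
proof (induction r arbitrary: f g)
  case 0
  then show ?case by (auto intro: continuous_on_add)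
next
  case (Suc r)
  have der: "((\<lambda>x. f x + g x) has_derivative
      (\<lambda>v. frechet_derivative f (at x) v + frechet_derivative g (at x) v)) (at x)"
    if "x \<in> S" for x
    using Suc.prems that
    by (auto intro!: has_derivative_add simp: frechet_derivative_works)
  have "C_on r S (\<lambda>x. frechet_derivative (\<lambda>x. f x + g x) (at x) v)" for v
  proof (rule C_on_cong[OF assms(1)])
    show "C_on r S (\<lambda>x. frechet_derivative f (at x) v + frechet_derivative g (at x) v)"
      using Suc by auto
  qed (simp add: frechet_derivative_eqI[OF der])
  then show ?case
    using der by (auto simp: differentiable_def)
qed

lemma C_on_sum:
  assumes "open S" "\<And>i. i \<in> I \<Longrightarrow> C_on r S (f i)"
  shows "C_on r S (\<lambda>x. \<Sum>i\<in>I. f i x)"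
  using assms(2)
  by (induction I rule: infinite_finite_induct) (auto intro!: C_on_const C_on_add[OF assms(1)])

lemma C_on_bilinear:
  assumes "open S" "bounded_bilinear h" "C_on r S f" "C_on r S g"
  shows "C_on r S (\<lambda>x. h (f x) (g x))"
  using assms(3,4)
proof (induction r arbitrary: f g)
  case 0
  then show ?case by (auto intro: bounded_bilinear.continuous_on[OF assms(2)])
next
  case (Suc r)
  have der: "((\<lambda>x. h (f x) (g x)) has_derivative
      (\<lambda>v. h (f x) (frechet_derivative g (at x) v) + h (frechet_derivative f (at x) v) (g x))) (at x)"
    if "x \<in> S" for x
    using Suc.prems that
    by (auto intro!: bounded_bilinear.FDERIV[OF assms(2)] simp: frechet_derivative_works)
  have "C_on r S (\<lambda>x. frechet_derivative (\<lambda>x. h (f x) (g x)) (at x) v)" for v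
  proof (rule C_on_cong[OF assms(1)])
    show "C_on r S (\<lambda>x. h (f x) (frechet_derivative g (at x) v) + h (frechet_derivative f (at x) v) (g x))"
      \<comment> \<open>In the product rule one factor stays undifferentiated; it has class
        \<open>Suc r\<close> and must be lowered to class r before the induction hypothesis
        applies.\<close>
      using Suc.prems C_on_SucD[OF Suc.prems(1)] C_on_SucD[OF Suc.prems(2)]
      by (intro C_on_add[OF assms(1)] Suc.IH) simp_all
  qed (simp add: frechet_derivative_eqI[OF der])
  then show ?case
    using der by (auto simp: differentiable_def)
qed

lemma linear_Basis_expand:
  fixes l :: "'a::euclidean_space \<Rightarrow> 'b::real_vector"
  assumes "linear l"
  shows "l v = (\<Sum>b\<in>Basis. (v \<bullet> b) *\<^sub>R l b)"
proof -
  have "l v = l (\<Sum>b\<in>Basis. (v \<bullet> b) *\<^sub>R b)"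
    by (simp add: euclidean_representation)
  then show ?thesis
    by (simp add: linear_sum[OF assms] linear_cmul[OF assms])
qed

lemma C_on_compose:
  fixes f :: "'a::euclidean_space \<Rightarrow> 'b::euclidean_space" and g :: "'b \<Rightarrow> 'c::real_normed_vector"
  assumes "open S" "C_on r S f" "C_on r T g" "f ` S \<subseteq> T"
  shows "C_on r S (\<lambda>x. g (f x))"
  using assms(2,3)
proof (induction r arbitrary: g)
  case 0
  then show ?case
    using assms(4) by (auto intro: continuous_on_compose2)
next
  case (Suc r)
  have df: "(f has_derivative frechet_derivative f (at x)) (at x)" if "x \<in> S" for x
    using Suc.prems that by (auto simp: frechet_derivative_works)
  have dg: "(g has_derivative frechet_derivative g (at (f x))) (at (f x))" if "x \<in> S" for x
    using Suc.prems that assms(4) by (auto simp: frechet_derivative_works)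
  have der: "((\<lambda>x. g (f x)) has_derivative
      (\<lambda>v. frechet_derivative g (at (f x)) (frechet_derivative f (at x) v))) (at x)"
    if "x \<in> S" for x
    using diff_chain_at[OF df dg, OF that that] by (simp add: o_def)
  have "C_on r S (\<lambda>x. frechet_derivative (\<lambda>x. g (f x)) (at x) v)" for v
  proof (rule C_on_cong[OF assms(1)])
    \<comment> \<open>The chain rule evaluates the derivative of g in a direction that moves with x,
      while \<open>C_on\<close> controls fixed directions only. Expanding in \<open>Basis\<close>
      leaves the fixed directions b with scalar coefficients coming from f.\<close>
    show "C_on r S (\<lambda>x. \<Sum>b\<in>Basis. (frechet_derivative f (at x) v \<bullet> b) *\<^sub>R frechet_derivative g (at (f x)) b)"
    proof (intro C_on_sum[OF assms(1)] C_on_bilinear[OF assms(1) bounded_bilinear_scaleR])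
      fix b :: 'b
      show "C_on r S (\<lambda>x. frechet_derivative f (at x) v \<bullet> b)"
        using Suc.prems
        by (auto intro!: C_on_linear_compose[OF assms(1) bounded_linear_inner_left])
      show "C_on r S (\<lambda>x. frechet_derivative g (at (f x)) b)"
        using Suc.prems C_on_SucD[OF Suc.prems(1)] by (intro Suc.IH) simp_all
    qed
    fix x assume "x \<in> S"
    then show "(\<Sum>b\<in>Basis. (frechet_derivative f (at x) v \<bullet> b) *\<^sub>R frechet_derivative g (at (f x)) b)
        = frechet_derivative (\<lambda>x. g (f x)) (at x) v"
      using linear_Basis_expand[OF has_derivative_linear[OF dg], of x "frechet_derivative f (at x) v"]
      by (simp add: frechet_derivative_eqI[OF der])
  qed
  then show ?case
    using der by (auto simp: differentiable_def)
qed

section \<open>Closure properties of smooth maps\<close>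

lemma smooth_on_cong:
  "open S \<Longrightarrow> smooth_on S f \<Longrightarrow> (\<And>x. x \<in> S \<Longrightarrow> f x = g x) \<Longrightarrow> smooth_on S g"
  unfolding smooth_on_def by (auto intro: C_on_cong)

lemma smooth_on_subset: "smooth_on S f \<Longrightarrow> T \<subseteq> S \<Longrightarrow> smooth_on T f"
  unfolding smooth_on_def by (metis C_on_subset)

lemma smooth_on_linear_compose:
  "open S \<Longrightarrow> bounded_linear l \<Longrightarrow> smooth_on S f \<Longrightarrow> smooth_on S (\<lambda>x. l (f x))"
  unfolding smooth_on_def by (auto intro: C_on_linear_compose)

lemma smooth_on_const: "smooth_on S (\<lambda>x. c)"
  unfolding smooth_on_def by (metis C_on_const)

lemma smooth_on_linear: "bounded_linear l \<Longrightarrow> smooth_on S l"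
  unfolding smooth_on_def by (metis C_on_linear)

lemma smooth_on_id: "smooth_on S (\<lambda>x. x)"
  by (rule smooth_on_linear) (rule bounded_linear_ident)

lemma smooth_on_add:
  "open S \<Longrightarrow> smooth_on S f \<Longrightarrow> smooth_on S g \<Longrightarrow> smooth_on S (\<lambda>x. f x + g x)"
  unfolding smooth_on_def by (auto intro: C_on_add)

lemma smooth_on_sum:
  "open S \<Longrightarrow> (\<And>i. i \<in> I \<Longrightarrow> smooth_on S (f i)) \<Longrightarrow> smooth_on S (\<lambda>x. \<Sum>i\<in>I. f i x)"
  unfolding smooth_on_def by (auto intro: C_on_sum)

lemma smooth_on_bilinear:
  "open S \<Longrightarrow> bounded_bilinear h \<Longrightarrow> smooth_on S f \<Longrightarrow> smooth_on S g \<Longrightarrow>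
   smooth_on S (\<lambda>x. h (f x) (g x))"
  unfolding smooth_on_def by (auto intro: C_on_bilinear)

lemmas smooth_on_scaleR = smooth_on_bilinear[OF _ bounded_bilinear_scaleR]
lemmas smooth_on_mult = smooth_on_bilinear[OF _ bounded_bilinear_mult]
lemmas smooth_on_inner = smooth_on_bilinear[OF _ bounded_bilinear_inner]

lemma smooth_on_minus: "open S \<Longrightarrow> smooth_on S f \<Longrightarrow> smooth_on S (\<lambda>x. - f x)"
  by (rule smooth_on_linear_compose[OF _ bounded_linear_minus[OF bounded_linear_ident]])

lemma smooth_on_diff:
  "open S \<Longrightarrow> smooth_on S f \<Longrightarrow> smooth_on S g \<Longrightarrow> smooth_on S (\<lambda>x. f x - g x)"
  using smooth_on_add[of S f "\<lambda>x. - g x"] smooth_on_minus[of S g] by simp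

lemma smooth_on_compose:
  fixes f :: "'a::euclidean_space \<Rightarrow> 'b::euclidean_space" and g :: "'b \<Rightarrow> 'c::real_normed_vector"
  shows "open S \<Longrightarrow> smooth_on S f \<Longrightarrow> smooth_on T g \<Longrightarrow> (\<And>x. x \<in> S \<Longrightarrow> f x \<in> T) \<Longrightarrow>
   smooth_on S (\<lambda>x. g (f x))"
  unfolding smooth_on_def by (auto intro!: C_on_compose[of S _ f T g])

lemma smooth_on_fst: "open S \<Longrightarrow> smooth_on S f \<Longrightarrow> smooth_on S (\<lambda>x. fst (f x))"
  by (rule smooth_on_linear_compose[OF _ bounded_linear_fst])

lemma smooth_on_snd: "open S \<Longrightarrow> smooth_on S f \<Longrightarrow> smooth_on S (\<lambda>x. snd (f x))"
  by (rule smooth_on_linear_compose[OF _ bounded_linear_snd])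

lemma smooth_on_nth: "open S \<Longrightarrow> smooth_on S f \<Longrightarrow> smooth_on S (\<lambda>x. f x $ i)"
  by (rule smooth_on_linear_compose[OF _ bounded_linear_vec_nth])

lemma smooth_on_Pair:
  assumes "open S" "smooth_on S f" "smooth_on S g"
  shows "smooth_on S (\<lambda>x. (f x, g x))"
proof -
  have "smooth_on S (\<lambda>x. (f x, 0) + (0, g x))"
    using assms
    by (intro smooth_on_add smooth_on_linear_compose[of S "\<lambda>y. (y, 0)" f]
        smooth_on_linear_compose[of S "\<lambda>y. (0, y)" g] bounded_linear_Pair
        bounded_linear_ident bounded_linear_zero)
  then show ?thesis by simp
qed

lemma bounded_linear_axis: "bounded_linear (axis i :: 'a::euclidean_space \<Rightarrow> 'a^'n)"
proof -
  have "linear (axis i :: 'a \<Rightarrow> 'a^'n)"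
    by (rule linearI) (auto simp: vec_eq_iff axis_def)
  then show ?thesis by (simp add: linear_conv_bounded_linear)
qed

lemma vec_axis_sum: "(\<Sum>i\<in>UNIV. axis i (x $ i)) = (x :: 'a::euclidean_space^'n)"
  by (simp add: vec_eq_iff axis_def sum.delta if_distrib cong: if_cong)

lemma smooth_on_vec_lambda:
  fixes f :: "'n::finite \<Rightarrow> 'b::euclidean_space \<Rightarrow> 'a::euclidean_space"
  assumes "open S" "\<And>i. smooth_on S (f i)"
  shows "smooth_on S (\<lambda>x. \<chi> i. f i x)"
proof -
  have "smooth_on S (\<lambda>x. \<Sum>i\<in>UNIV. axis i (f i x))"
    using assms by (intro smooth_on_sum smooth_on_linear_compose[OF _ bounded_linear_axis])
  moreover have "(\<Sum>i\<in>UNIV. axis i (f i x)) = (\<chi> i. f i x)" for x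
    using vec_axis_sum[of "\<chi> i. f i x"] by simp
  ultimately show ?thesis by simp
qed

lemma smooth_on_differentiable: "smooth_on S f \<Longrightarrow> x \<in> S \<Longrightarrow> f differentiable (at x)"
  unfolding smooth_on_def by (metis C_on.simps(2))

lemma smooth_on_has_derivative:
  "smooth_on S f \<Longrightarrow> x \<in> S \<Longrightarrow> (f has_derivative frechet_derivative f (at x)) (at x)"
  using smooth_on_differentiable frechet_derivative_works by blast

lemma smooth_on_derivative_linear:
  "smooth_on S f \<Longrightarrow> x \<in> S \<Longrightarrow> linear (frechet_derivative f (at x))"
  using smooth_on_differentiable linear_frechet_derivative by blast

lemma smooth_on_continuous_on: "smooth_on S f \<Longrightarrow> continuous_on S f"
  unfolding smooth_on_def by (metis C_on.simps(1))

lemma smooth_on_derivative: "smooth_on S f \<Longrightarrow> smooth_on S (\<lambda>x. frechet_derivative f (at x) v)"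
  unfolding smooth_on_def by (metis C_on.simps(2))

lemma smooth_on_has_vector_derivative:
  fixes f :: "real \<Rightarrow> 'b::real_normed_vector"
  assumes "smooth_on S f" "t \<in> S"
  shows "(f has_vector_derivative vector_derivative f (at t)) (at t)"
  using smooth_on_differentiable[OF assms] vector_derivative_works by blast

lemma smooth_on_vector_derivative:
  fixes f :: "real \<Rightarrow> 'b::real_normed_vector"
  assumes "open S" "smooth_on S f"
  shows "smooth_on S (\<lambda>t. vector_derivative f (at t))"
proof (rule smooth_on_cong[OF assms(1) smooth_on_derivative[OF assms(2), of 1]])
  fix t assume "t \<in> S"
  then show "frechet_derivative f (at t) 1 = vector_derivative f (at t)"
    using frechet_derivative_eq_vector_derivative[OF smooth_on_differentiable[OF assms(2)]]
    by simp
qed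

lemma vector_derivative_cong_open:
  assumes "open S" "x \<in> S" "\<And>y. y \<in> S \<Longrightarrow> f y = g y"
  shows "vector_derivative f (at x) = vector_derivative g (at x)"
proof -
  have "(f has_vector_derivative D) (at x) \<longleftrightarrow> (g has_vector_derivative D) (at x)" for D
    by (metis assms has_vector_derivative_transform_within_open)
  then show ?thesis
    by (simp add: vector_derivative_def)
qed

section \<open>Symmetry of second derivatives\<close>

text \<open>The second difference is symmetric in v and w, so computing its limit in one order
  yields the symmetry of second derivatives. The mean value theorem is applied in the direction v,
  and the derivative G of f along v is then expanded to first order at x.\<close>

lemma second_difference_limit:
  fixes f :: "'a::euclidean_space \<Rightarrow> real"
  assumes "open S" "smooth_on S f" "x \<in> S"
  shows "((\<lambda>h. (f (x + h *\<^sub>R v + h *\<^sub>R w) - f (x + h *\<^sub>R v) - f (x + h *\<^sub>R w) + f x) / h\<^sup>2) \<longlongrightarrow>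
    frechet_derivative (\<lambda>y. frechet_derivative f (at y) v) (at x) w) (at_right 0)"
proof -
  define G where "G = (\<lambda>y. frechet_derivative f (at y) v)"
  define G' where "G' = frechet_derivative G (at x)"
  have G': "(G has_derivative G') (at x)"
    using smooth_on_has_derivative[OF smooth_on_derivative[OF assms(2)] assms(3)]
    by (simp add: G_def G'_def)
  have lin: "linear G'" by (rule has_derivative_linear[OF G'])
  obtain r where r: "r > 0" "ball x r \<subseteq> S"
    using assms(1,3) open_contains_ball by blast
  \<comment> \<open>The two points at which G is expanded lie within h (norm v + norm w) and h norm
    v of x; K bounds the sum of these distances divided by h, and the summand 1 makes it
    positive.\<close>
  define K where "K = 2 * norm v + norm w + 1"
  have K: "K > 0" by (simp add: K_def add_nonneg_pos)
  define \<Delta> where "\<Delta> = (\<lambda>h::real. f (x + h *\<^sub>R v + h *\<^sub>R w) - f (x + h *\<^sub>R v) - f (x + h *\<^sub>R w) + f x)"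
  have est: "eventually (\<lambda>h. \<bar>\<Delta> h / h\<^sup>2 - G' w\<bar> < e) (at_right 0)" if e: "e > 0" for e
  proof -
    \<comment> \<open>The factor 2 leaves h e / 2 at the end of the estimate, which makes the
      inequality strict.\<close>
    define \<epsilon> where "\<epsilon> = e / (2 * K)"
    have \<epsilon>: "\<epsilon> > 0" using e K by (simp add: \<epsilon>_def)
    obtain d where d: "d > 0" "\<And>y. norm (y - x) < d \<Longrightarrow> norm (G y - G x - G' (y - x)) \<le> \<epsilon> * norm (y - x)"
      using G' \<epsilon> unfolding has_derivative_at_alt by blast
    \<comment> \<open>For h below m the parallelogram spanned by h v and h w at x stays in the ball
      inside S and within the range of the first-order expansion of G.\<close>
    define m where "m = min d r / K"
    have m: "m > 0" using d(1) r(1) K by (simp add: m_def)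
    have "\<bar>\<Delta> h / h\<^sup>2 - G' w\<bar> < e" if h: "0 < h" "h < m" for h
    proof -
      have hK: "h * K < min d r"
        using h(2) K by (simp add: m_def pos_less_divide_eq)
      have small: "norm (s *\<^sub>R v + u *\<^sub>R w) < min d r" if "0 \<le> s" "s \<le> h" "0 \<le> u" "u \<le> h" for s u
      proof -
        have "norm (s *\<^sub>R v + u *\<^sub>R w) \<le> s * norm v + u * norm w"
          using that by (metis abs_of_nonneg norm_scaleR norm_triangle_ineq)
        also have "\<dots> \<le> h * norm v + h * norm w"
          using that by (intro add_mono mult_right_mono) auto
        also have "\<dots> \<le> h * K"
          using h(1) by (simp add: K_def distrib_left)
        finally show ?thesis using hK by simp
      qed
      have inS: "x + s *\<^sub>R v + u *\<^sub>R w \<in> S" if "0 \<le> s" "s \<le> h" "0 \<le> u" "u \<le> h" for s u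
      proof -
        have "x + s *\<^sub>R v + u *\<^sub>R w \<in> ball x r"
          using small[OF that] by (simp add: dist_norm add.assoc norm_minus_commute add.commute[of "u *\<^sub>R w"])
        then show ?thesis using r(2) by auto
      qed
      have der: "((\<lambda>s. f (x + s *\<^sub>R v + u *\<^sub>R w)) has_real_derivative G (x + s *\<^sub>R v + u *\<^sub>R w)) (at s)"
        if "0 \<le> s" "s \<le> h" "0 \<le> u" "u \<le> h" for s u
      proof -
        note fd = smooth_on_has_derivative[OF assms(2) inS[OF that]]
        have "((\<lambda>s. x + s *\<^sub>R v + u *\<^sub>R w) has_derivative (\<lambda>a. a *\<^sub>R v)) (at s)"
          by (auto intro!: derivative_eq_intros)
        from diff_chain_at[OF this fd]
        have "((\<lambda>s. f (x + s *\<^sub>R v + u *\<^sub>R w)) has_derivative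
           (\<lambda>a. frechet_derivative f (at (x + s *\<^sub>R v + u *\<^sub>R w)) (a *\<^sub>R v))) (at s)"
          by (simp add: o_def)
        moreover have "frechet_derivative f (at (x + s *\<^sub>R v + u *\<^sub>R w)) (a *\<^sub>R v)
           = G (x + s *\<^sub>R v + u *\<^sub>R w) * a" for a
          using linear_cmul[OF has_derivative_linear[OF fd]] by (simp add: G_def mult.commute)
        ultimately show ?thesis
          by (simp add: has_field_derivative_def)
      qed
      \<comment> \<open>The term \<open>0 *\<^sub>R w\<close> is kept so that both summands are
        instances of \<open>der\<close>, with u = h and with u = 0.\<close>
      define \<phi> where "\<phi> = (\<lambda>s. f (x + s *\<^sub>R v + h *\<^sub>R w) - f (x + s *\<^sub>R v + 0 *\<^sub>R w))"
      have "\<exists>\<xi>. 0 < \<xi> \<and> \<xi> < h \<and> \<phi> h - \<phi> 0 = (h - 0) * (G (x + \<xi> *\<^sub>R v + h *\<^sub>R w) - G (x + \<xi> *\<^sub>R v + 0 *\<^sub>R w))"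
        unfolding \<phi>_def using h(1)
        by (intro MVT2 DERIV_diff der) auto
      then obtain \<xi> where \<xi>: "0 < \<xi>" "\<xi> < h"
        and eq: "\<Delta> h = h * (G (x + \<xi> *\<^sub>R v + h *\<^sub>R w) - G (x + \<xi> *\<^sub>R v))"
        by (auto simp: \<phi>_def \<Delta>_def algebra_simps)
      define y1 where "y1 = \<xi> *\<^sub>R v + h *\<^sub>R w"
      define y2 where "y2 = \<xi> *\<^sub>R v + 0 *\<^sub>R w"
      have n1: "norm y1 \<le> h * (norm v + norm w)"
        using \<xi> h(1) norm_triangle_ineq[of "\<xi> *\<^sub>R v" "h *\<^sub>R w"] mult_right_mono[of \<xi> h "norm v"]
        by (simp add: y1_def distrib_left)
      have n2: "norm y2 \<le> h * norm v"
        using \<xi> mult_right_mono[of \<xi> h "norm v"] by (simp add: y2_def)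
      have a1: "norm (G (x + y1) - G x - G' y1) \<le> \<epsilon> * norm y1"
        using d(2)[of "x + y1"] small[of \<xi> h] \<xi> h by (simp add: y1_def)
      have a2: "norm (G (x + y2) - G x - G' y2) \<le> \<epsilon> * norm y2"
        using d(2)[of "x + y2"] small[of \<xi> 0] \<xi> h by (simp add: y2_def)
      have "G' (y1 - y2) = h * G' w"
        using linear_cmul[OF lin, of h w] by (simp add: y1_def y2_def)
      then have "G' y1 - G' y2 = h * G' w"
        by (simp add: linear_diff[OF lin])
      then have "\<bar>(G (x + y1) - G (x + y2)) - h * G' w\<bar> \<le> \<epsilon> * norm y1 + \<epsilon> * norm y2"
        using a1 a2 by (simp add: abs_le_iff)
      also have "\<dots> \<le> \<epsilon> * (h * (norm v + norm w)) + \<epsilon> * (h * norm v)"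
        using n1 n2 \<epsilon> by (intro add_mono mult_left_mono) auto
      also have "\<dots> \<le> \<epsilon> * (h * K)"
        using \<epsilon> h(1) by (simp add: K_def algebra_simps)
      also have "\<dots> = h * e / 2"
        using K by (simp add: \<epsilon>_def)
      also have "\<dots> < h * e" using h(1) e by simp
      finally have "\<bar>(G (x + y1) - G (x + y2)) - h * G' w\<bar> < h * e" .
      moreover have "\<Delta> h = h * (G (x + y1) - G (x + y2))"
        using eq by (simp add: y1_def y2_def add.assoc)
      then have "\<Delta> h / h\<^sup>2 - G' w = ((G (x + y1) - G (x + y2)) - h * G' w) / h"
        using h(1) by (simp add: field_simps power2_eq_square)
      ultimately show ?thesis
        using h(1) by (simp add: abs_divide pos_divide_less_eq mult.commute)
    qed
    then show ?thesis
      using m eventually_at_right_field by blast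
  qed
  have "((\<lambda>h. \<Delta> h / h\<^sup>2) \<longlongrightarrow> G' w) (at_right 0)"
    by (rule tendstoI) (use est in \<open>simp add: dist_real_def\<close>)
  then show ?thesis
    by (simp add: \<Delta>_def G'_def G_def)
qed

lemma second_derivative_symmetric_real:
  fixes f :: "'a::euclidean_space \<Rightarrow> real"
  assumes "open S" "smooth_on S f" "x \<in> S"
  shows "frechet_derivative (\<lambda>y. frechet_derivative f (at y) v) (at x) w
    = frechet_derivative (\<lambda>y. frechet_derivative f (at y) w) (at x) v"
proof (rule tendsto_unique[OF _ second_difference_limit[OF assms]])
  show "at_right (0::real) \<noteq> bot" by simp
  show "((\<lambda>h. (f (x + h *\<^sub>R v + h *\<^sub>R w) - f (x + h *\<^sub>R v) - f (x + h *\<^sub>R w) + f x) / h\<^sup>2) \<longlongrightarrow>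
    frechet_derivative (\<lambda>y. frechet_derivative f (at y) w) (at x) v) (at_right 0)"
    using second_difference_limit[OF assms, of w v] by (simp add: algebra_simps)
qed

lemma second_derivative_symmetric:
  fixes f :: "'a::euclidean_space \<Rightarrow> 'b::euclidean_space"
  assumes "open S" "smooth_on S f" "x \<in> S"
  shows "frechet_derivative (\<lambda>y. frechet_derivative f (at y) v) (at x) w
    = frechet_derivative (\<lambda>y. frechet_derivative f (at y) w) (at x) v"
proof (rule euclidean_eqI)
  fix b :: 'b
  have *: "frechet_derivative (\<lambda>y. frechet_derivative (\<lambda>y. f y \<bullet> b) (at y) v) (at x) w
     = frechet_derivative (\<lambda>y. frechet_derivative f (at y) v) (at x) w \<bullet> b" for v w
  proof -
    have "frechet_derivative (\<lambda>y. frechet_derivative (\<lambda>y. f y \<bullet> b) (at y) v) (at x)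
       = frechet_derivative (\<lambda>y. frechet_derivative f (at y) v \<bullet> b) (at x)"
      using bounded_linear.has_derivative[OF bounded_linear_inner_left
          smooth_on_has_derivative[OF assms(2)], of _ b, THEN frechet_derivative_eqI]
      by (intro frechet_derivative_cong_open[OF assms(1,3)]) simp
    also have "\<dots> = (\<lambda>w. frechet_derivative (\<lambda>y. frechet_derivative f (at y) v) (at x) w \<bullet> b)"
      by (intro frechet_derivative_eqI bounded_linear.has_derivative[OF bounded_linear_inner_left]
          smooth_on_has_derivative[OF smooth_on_derivative[OF assms(2)] assms(3)])
    finally show ?thesis by simp
  qed
  have "smooth_on S (\<lambda>y. f y \<bullet> b)"
    using assms by (intro smooth_on_inner smooth_on_const)
  from second_derivative_symmetric_real[OF assms(1) this assms(3), of v w]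
  show "frechet_derivative (\<lambda>y. frechet_derivative f (at y) v) (at x) w \<bullet> b
    = frechet_derivative (\<lambda>y. frechet_derivative f (at y) w) (at x) v \<bullet> b"
    by (simp add: *)
qed

section \<open>Jets of curves in Euclidean space\<close>

lemma curve_deriv_0 [simp]: "curve_deriv 0 f = f"
  by (simp add: curve_deriv_def)

lemma curve_deriv_Suc: "curve_deriv (Suc s) f = curve_deriv s (\<lambda>t. vector_derivative f (at t))"
  unfolding curve_deriv_def by (subst funpow_Suc_right) (simp add: o_def)

lemma curve_deriv_Suc_left: "curve_deriv (Suc s) f = (\<lambda>t. vector_derivative (curve_deriv s f) (at t))"
  by (simp add: curve_deriv_def)

lemma smooth_on_curve_deriv: "open I \<Longrightarrow> smooth_on I f \<Longrightarrow> smooth_on I (curve_deriv s f)"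
  by (induction s arbitrary: f) (auto simp: curve_deriv_Suc smooth_on_vector_derivative)

lemma curve_deriv_cong:
  assumes "open I" "\<And>t. t \<in> I \<Longrightarrow> f t = g t"
  shows "t \<in> I \<Longrightarrow> curve_deriv s f t = curve_deriv s g t"
  using assms(2)
proof (induction s arbitrary: f g)
  case (Suc s)
  then show ?case
    unfolding curve_deriv_Suc
    by (intro Suc.IH vector_derivative_cong_open[OF assms(1)]) auto
qed auto

text \<open>An equivalence, so that the values chosen by \<open>vector_derivative\<close> agree even
  where no derivative exists; \<open>curve_deriv_shift\<close> can then be stated for arbitrary
  f.\<close>

lemma has_vector_derivative_shift:
  "((\<lambda>s. f (t + s)) has_vector_derivative D) (at a) \<longleftrightarrow> (f has_vector_derivative D) (at (t + a))"
proof
  assume "((\<lambda>s. f (t + s)) has_vector_derivative D) (at a)"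
  then have *: "((\<lambda>s. f (t + s)) has_vector_derivative D) (at ((t + a) - t))" by simp
  have "((\<lambda>s. s - t) has_vector_derivative 1) (at (t + a))"
    by (auto intro!: derivative_eq_intros)
  from vector_diff_chain_at[OF this *] show "(f has_vector_derivative D) (at (t + a))"
    by (simp add: o_def)
next
  assume *: "(f has_vector_derivative D) (at (t + a))"
  have "((\<lambda>s. t + s) has_vector_derivative 1) (at a)"
    by (auto intro!: derivative_eq_intros)
  from vector_diff_chain_at[OF this *] show "((\<lambda>s. f (t + s)) has_vector_derivative D) (at a)"
    by (simp add: o_def)
qed

lemma curve_deriv_shift: "curve_deriv r (\<lambda>s. f (t + s)) a = curve_deriv r f (t + a)"
proof (induction r arbitrary: f)
  case (Suc r)
  have "(\<lambda>s. vector_derivative (\<lambda>s. f (t + s)) (at s)) = (\<lambda>s. vector_derivative f (at (t + s)))"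
    by (simp add: vector_derivative_def has_vector_derivative_shift)
  then show ?case
    unfolding curve_deriv_Suc using Suc[of "\<lambda>s. vector_derivative f (at s)"] by simp
qed simp

section \<open>Agreement of derivatives at 0 up to a given order\<close>

definition same_jet :: "nat \<Rightarrow> (real \<Rightarrow> 'a::real_normed_vector) \<Rightarrow> (real \<Rightarrow> 'a) \<Rightarrow> bool" where
  "same_jet r f g \<longleftrightarrow> (\<forall>s\<le>r. curve_deriv s f 0 = curve_deriv s g 0)"

lemma same_jet_0 [simp]: "same_jet 0 f g \<longleftrightarrow> f 0 = g 0"
  by (simp add: same_jet_def)

text \<open>This recursion takes the place of higher Leibniz and chain rules: the inductions on r
  differentiate once and apply the hypothesis to the resulting derivatives.\<close>

lemma same_jet_Suc: "same_jet (Suc r) f g \<longleftrightarrow> f 0 = g 0 \<and>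
   same_jet r (\<lambda>t. vector_derivative f (at t)) (\<lambda>t. vector_derivative g (at t))"
proof -
  have "(\<forall>s\<le>Suc r. P s) \<longleftrightarrow> P 0 \<and> (\<forall>s\<le>r. P (Suc s))" for P :: "nat \<Rightarrow> bool"
    by (metis Suc_le_mono le0 not0_implies_Suc)
  from this[of "\<lambda>s. curve_deriv s f 0 = curve_deriv s g 0"] show ?thesis
    unfolding same_jet_def by (simp add: curve_deriv_Suc)
qed

lemma same_jet_mono: "same_jet r f g \<Longrightarrow> q \<le> r \<Longrightarrow> same_jet q f g"
  by (auto simp: same_jet_def)

lemma same_jet_cong:
  assumes "open I" "0 \<in> I" "\<And>t. t \<in> I \<Longrightarrow> f t = f' t" "\<And>t. t \<in> I \<Longrightarrow> g t = g' t"
  shows "same_jet r f g \<longleftrightarrow> same_jet r f' g'"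
  unfolding same_jet_def
  using curve_deriv_cong[OF assms(1,3,2)] curve_deriv_cong[OF assms(1,4,2)] by simp

context
  fixes I :: "real set"
  assumes I: "open I" "0 \<in> I"
begin

lemma same_jet_add:
  assumes "smooth_on I f" "smooth_on I g" "smooth_on I f2" "smooth_on I g2"
    and "same_jet r f g" "same_jet r f2 g2"
  shows "same_jet r (\<lambda>t. f t + f2 t) (\<lambda>t. g t + g2 t)"
  using assms
proof (induction r arbitrary: f g f2 g2)
  case (Suc r)
  have *: "vector_derivative (\<lambda>t. a t + b t) (at t) = vector_derivative a (at t) + vector_derivative b (at t)"
    if "smooth_on I a" "smooth_on I b" "t \<in> I" for a b :: "real \<Rightarrow> 'a" and t
    using that
    by (intro vector_derivative_at has_vector_derivative_add smooth_on_has_vector_derivative)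
  have "same_jet r (\<lambda>t. vector_derivative f (at t) + vector_derivative f2 (at t))
      (\<lambda>t. vector_derivative g (at t) + vector_derivative g2 (at t))"
    using Suc.prems
    by (intro Suc.IH smooth_on_vector_derivative I(1)) (simp_all add: same_jet_Suc)
  then have "same_jet r (\<lambda>t. vector_derivative (\<lambda>t. f t + f2 t) (at t))
      (\<lambda>t. vector_derivative (\<lambda>t. g t + g2 t) (at t))"
    using Suc.prems by (subst same_jet_cong[OF I]) (auto simp: *)
  then show ?case
    using Suc.prems by (simp add: same_jet_Suc)
qed simp

lemma same_jet_sum:
  fixes f g :: "'i \<Rightarrow> real \<Rightarrow> 'a::real_normed_vector"
  assumes "\<And>i. i \<in> J \<Longrightarrow> smooth_on I (f i)" "\<And>i. i \<in> J \<Longrightarrow> smooth_on I (g i)"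
    "\<And>i. i \<in> J \<Longrightarrow> same_jet r (f i) (g i)"
  shows "same_jet r (\<lambda>t. \<Sum>i\<in>J. f i t) (\<lambda>t. \<Sum>i\<in>J. g i t)"
  using assms
proof (induction J rule: infinite_finite_induct)
  case (insert x F)
  then show ?case
    by (auto intro!: same_jet_add smooth_on_sum I(1))
qed (auto simp: same_jet_def)

lemma same_jet_bilinear:
  assumes h: "bounded_bilinear h"
    and "smooth_on I f" "smooth_on I g" "smooth_on I f2" "smooth_on I g2"
    and "same_jet r f g" "same_jet r f2 g2"
  shows "same_jet r (\<lambda>t. h (f t) (f2 t)) (\<lambda>t. h (g t) (g2 t))"
  using assms(2-)
proof (induction r arbitrary: f g f2 g2)
  case (Suc r)
  have *: "vector_derivative (\<lambda>t. h (a t) (b t)) (at t)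
      = h (a t) (vector_derivative b (at t)) + h (vector_derivative a (at t)) (b t)"
    if "smooth_on I a" "smooth_on I b" "t \<in> I" for a b t
    using that
    by (intro vector_derivative_at bounded_bilinear.has_vector_derivative[OF h]
        smooth_on_has_vector_derivative)
  note mono = same_jet_mono[OF Suc.prems(5), of r] same_jet_mono[OF Suc.prems(6), of r]
  have "same_jet r (\<lambda>t. h (f t) (vector_derivative f2 (at t)) + h (vector_derivative f (at t)) (f2 t))
      (\<lambda>t. h (g t) (vector_derivative g2 (at t)) + h (vector_derivative g (at t)) (g2 t))"
    using Suc.prems mono
    by (intro same_jet_add Suc.IH smooth_on_vector_derivative smooth_on_bilinear[OF _ h] I(1))
      (simp_all add: same_jet_Suc)
  then have "same_jet r (\<lambda>t. vector_derivative (\<lambda>t. h (f t) (f2 t)) (at t))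
      (\<lambda>t. vector_derivative (\<lambda>t. h (g t) (g2 t)) (at t))"
    using Suc.prems by (subst same_jet_cong[OF I]) (auto simp: *)
  then show ?case
    using Suc.prems by (simp add: same_jet_Suc)
qed simp

lemma same_jet_const: "same_jet r (\<lambda>t. c) (\<lambda>t. c)"
  by (simp add: same_jet_def)

lemma vector_derivative_compose:
  fixes f :: "real \<Rightarrow> 'a::euclidean_space" and F :: "'a \<Rightarrow> 'b::real_normed_vector"
  assumes "smooth_on I f" "smooth_on T F" "t \<in> I" "f t \<in> T"
  shows "vector_derivative (\<lambda>t. F (f t)) (at t) = frechet_derivative F (at (f t)) (vector_derivative f (at t))"
  using vector_derivative_diff_chain_within[OF smooth_on_has_vector_derivative[OF assms(1,3)],
      of F "frechet_derivative F (at (f t))"] smooth_on_has_derivative[OF assms(2,4)]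
  by (intro vector_derivative_at) (simp add: o_def has_derivative_at_withinI)

text \<open>After one differentiation and an expansion in \<open>Basis\<close>, the composite is a
  sum of products of components of the velocity with directional derivatives of F along the curve.
  The latter are again composites with smooth maps, so F varies in the induction while the curves
  stay fixed.\<close>

lemma same_jet_compose:
  fixes f g :: "real \<Rightarrow> 'a::euclidean_space" and F :: "'a \<Rightarrow> 'b::real_normed_vector"
  assumes T: "\<And>t. t \<in> I \<Longrightarrow> f t \<in> T" "\<And>t. t \<in> I \<Longrightarrow> g t \<in> T"
    and f: "smooth_on I f" and g: "smooth_on I g"
    and "smooth_on T F" "same_jet r f g"
  shows "same_jet r (\<lambda>t. F (f t)) (\<lambda>t. F (g t))"
  using assms(5,6)
proof (induction r arbitrary: F)
  case (Suc r)
  let ?d = "\<lambda>a t. \<Sum>b\<in>Basis. (vector_derivative a (at t) \<bullet> b) *\<^sub>R frechet_derivative F (at (a t)) b"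
  have *: "vector_derivative (\<lambda>t. F (a t)) (at t) = ?d a t"
    if "smooth_on I a" "t \<in> I" "a t \<in> T" for a t
    using vector_derivative_compose[OF that(1) Suc.prems(1) that(2,3)]
      linear_Basis_expand[OF smooth_on_derivative_linear[OF Suc.prems(1) that(3)]] by metis
  have j: "same_jet r (\<lambda>t. vector_derivative f (at t)) (\<lambda>t. vector_derivative g (at t))"
    using Suc.prems(2) by (simp add: same_jet_Suc)
  have "same_jet r (?d f) (?d g)"
  proof (intro same_jet_sum same_jet_bilinear[OF bounded_bilinear_scaleR]
      same_jet_bilinear[OF bounded_bilinear_inner] smooth_on_scaleR smooth_on_inner I(1)
      smooth_on_vector_derivative f g same_jet_const smooth_on_const j)
    fix b :: 'a
    show "smooth_on I (\<lambda>t. frechet_derivative F (at (f t)) b)"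
      "smooth_on I (\<lambda>t. frechet_derivative F (at (g t)) b)"
      using T by (auto intro!: smooth_on_compose[OF I(1) f smooth_on_derivative[OF Suc.prems(1)]]
          smooth_on_compose[OF I(1) g smooth_on_derivative[OF Suc.prems(1)]])
    then show "smooth_on I (\<lambda>t. frechet_derivative F (at (f t)) b)"
      "smooth_on I (\<lambda>t. frechet_derivative F (at (g t)) b)" by auto
    show "same_jet r (\<lambda>t. frechet_derivative F (at (f t)) b) (\<lambda>t. frechet_derivative F (at (g t)) b)"
      using Suc.prems(2) same_jet_mono
      by (intro Suc.IH smooth_on_derivative[OF Suc.prems(1)]) (auto intro: same_jet_mono)
  qed
  then have "same_jet r (\<lambda>t. vector_derivative (\<lambda>t. F (f t)) (at t))
      (\<lambda>t. vector_derivative (\<lambda>t. F (g t)) (at t))"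
    using T f g by (subst same_jet_cong[OF I]) (auto simp: *)
  then show ?case
    using Suc.prems by (simp add: same_jet_Suc)
qed simp

end

section \<open>Atlases and jets in charts\<close>

text \<open>The part of the manifold structure that base and bundles share. The atlases induced on
  the bundles are not maximal and come without a prescribed topology, so neither appears
  here.\<close>

definition smooth_atlas :: "('x, 'e::euclidean_space) chart set \<Rightarrow> bool" where
  "smooth_atlas \<A> \<longleftrightarrow> (\<forall>c\<in>\<A>. inj_on (snd c) (fst c)) \<and>
     (\<forall>c\<in>\<A>. \<forall>d\<in>\<A>. open (snd c ` (fst c \<inter> fst d)) \<and> smooth_transition c d)"

lemma smooth_atlas_inj: "smooth_atlas \<A> \<Longrightarrow> c \<in> \<A> \<Longrightarrow> inj_on (snd c) (fst c)"
  by (simp add: smooth_atlas_def)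

lemma smooth_atlas_open: "smooth_atlas \<A> \<Longrightarrow> c \<in> \<A> \<Longrightarrow> open (snd c ` fst c)"
  unfolding smooth_atlas_def by (metis inf.idem)

lemma smooth_atlas_open_Int:
  "smooth_atlas \<A> \<Longrightarrow> c \<in> \<A> \<Longrightarrow> d \<in> \<A> \<Longrightarrow> open (snd c ` (fst c \<inter> fst d))"
  by (simp add: smooth_atlas_def)

lemma smooth_atlas_transition:
  "smooth_atlas \<A> \<Longrightarrow> c \<in> \<A> \<Longrightarrow> d \<in> \<A> \<Longrightarrow>
   smooth_on (snd c ` (fst c \<inter> fst d)) (local_rep c (snd d))"
  by (simp add: smooth_atlas_def smooth_transition_def)

lemma local_rep_apply:
  "inj_on (snd c) (fst c) \<Longrightarrow> x \<in> fst c \<Longrightarrow> local_rep c f (snd c x) = f x"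
  by (simp add: local_rep_def)

lemma smooth_manifold_atlas:
  assumes "smooth_manifold X \<A>"
  shows "smooth_atlas \<A>"
proof -
  have chart: "openin X U \<and> open (\<phi> ` U) \<and>
      homeomorphic_map (subtopology X U) (top_of_set (\<phi> ` U)) \<phi>" if "(U, \<phi>) \<in> \<A>" for U \<phi>
    using assms that by (auto simp: smooth_manifold_def topological_chart_def)
  have inj: "inj_on \<phi> U" if "(U, \<phi>) \<in> \<A>" for U \<phi>
  proof -
    have "topspace (subtopology X U) = U"
      using chart[OF that] openin_subset by fastforce
    then show ?thesis
      using homeomorphic_imp_injective_map chart[OF that] by metis
  qed
  have op: "open (\<phi> ` (U \<inter> V))" if "(U, \<phi>) \<in> \<A>" "(V, \<psi>) \<in> \<A>" for U \<phi> V \<psi>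
  proof -
    have "openin (subtopology X U) (U \<inter> V)"
      using chart[OF that(2)] by (simp add: openin_subtopology_Int2)
    then have "openin (top_of_set (\<phi> ` U)) (\<phi> ` (U \<inter> V))"
      using homeomorphic_imp_open_map[OF conjunct2[OF conjunct2[OF chart[OF that(1)]]]]
      by (simp add: open_map_def)
    then show ?thesis
      using chart[OF that(1)] openin_open_trans by blast
  qed
  have "smooth_transition c d" if "c \<in> \<A>" "d \<in> \<A>" for c d
    using assms that by (simp add: smooth_manifold_def)
  then show ?thesis
    using inj op by (auto simp: smooth_atlas_def)
qed

section \<open>Smooth curves in charts\<close>

lemma smooth_curveI:
  assumes "c \<in> \<A>" "e > 0" "\<And>t. t \<in> {-e<..<e} \<Longrightarrow> \<gamma> t \<in> fst c" "smooth_on {-e<..<e} (snd c \<circ> \<gamma>)"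
  shows "smooth_curve \<A> \<gamma>"
  unfolding smooth_curve_def using assms by (intro bexI[of _ c]) (auto simp: case_prod_beta)

lemma open_interval_subset:
  assumes "open (I :: real set)" "0 \<in> I"
  obtains e where "e > 0" "{-e<..<e} \<subseteq> I"
proof -
  obtain e where "e > 0" "ball 0 e \<subseteq> I"
    using assms open_contains_ball by blast
  moreover have "ball 0 e = {-e<..<e}"
    by (auto simp: dist_real_def)
  ultimately show ?thesis using that by metis
qed

text \<open>\<open>smooth_curve\<close> provides only some chart; the transition map carries
  smoothness to any chart around the initial point once the interval is so short that the curve
  stays in the overlap.\<close>

lemma smooth_curve_in_chart:
  assumes A: "smooth_atlas \<A>" and \<gamma>: "smooth_curve \<A> \<gamma>" and d: "d \<in> \<A>" "\<gamma> 0 \<in> fst d"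
  obtains e where "e > 0" "\<And>t. t \<in> {-e<..<e} \<Longrightarrow> \<gamma> t \<in> fst d" "smooth_on {-e<..<e} (snd d \<circ> \<gamma>)"
proof -
  obtain c e where c: "c \<in> \<A>" and e: "e > 0" "\<And>t. t \<in> {-e<..<e} \<Longrightarrow> \<gamma> t \<in> fst c"
    and sm: "smooth_on {-e<..<e} (snd c \<circ> \<gamma>)"
    using \<gamma> unfolding smooth_curve_def by fastforce
  let ?S = "snd c ` (fst c \<inter> fst d)"
  have inj: "inj_on (snd c) (fst c)" using A c smooth_atlas_inj by blast
  have "open ({-e<..<e} \<inter> (snd c \<circ> \<gamma>) -` ?S)"
    using smooth_on_continuous_on[OF sm] smooth_atlas_open_Int[OF A c d(1)]
    by (intro continuous_open_preimage) auto
  moreover have "0 \<in> {-e<..<e} \<inter> (snd c \<circ> \<gamma>) -` ?S"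
    using e d by auto
  ultimately obtain e' where e': "e' > 0" "{-e'<..<e'} \<subseteq> {-e<..<e} \<inter> (snd c \<circ> \<gamma>) -` ?S"
    by (rule open_interval_subset)
  have ind: "\<gamma> t \<in> fst c \<inter> fst d" if "t \<in> {-e'<..<e'}" for t
  proof -
    have "t \<in> {-e<..<e}" "snd c (\<gamma> t) \<in> ?S" using e' that by auto
    then show ?thesis using e(2) inj by (auto dest: inj_onD)
  qed
  have "smooth_on {-e'<..<e'} (\<lambda>t. local_rep c (snd d) ((snd c \<circ> \<gamma>) t))"
    using smooth_on_subset[OF sm, of "{-e'<..<e'}"] e' ind
    by (intro smooth_on_compose[OF _ _ smooth_atlas_transition[OF A c d(1)]]) (auto simp: o_def)
  then have "smooth_on {-e'<..<e'} (snd d \<circ> \<gamma>)"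
    by (rule smooth_on_cong[rotated]) (use ind inj in \<open>auto simp: local_rep_apply\<close>)
  then show ?thesis
    using that e'(1) ind by blast
qed

lemma smooth_curves_in_chart:
  assumes A: "smooth_atlas \<A>" and "smooth_curve \<A> \<gamma>" "smooth_curve \<A> \<delta>"
    and d: "d \<in> \<A>" "\<gamma> 0 \<in> fst d" "\<delta> 0 \<in> fst d"
  obtains e where "e > 0" "\<And>t. t \<in> {-e<..<e} \<Longrightarrow> \<gamma> t \<in> fst d" "\<And>t. t \<in> {-e<..<e} \<Longrightarrow> \<delta> t \<in> fst d"
    "smooth_on {-e<..<e} (snd d \<circ> \<gamma>)" "smooth_on {-e<..<e} (snd d \<circ> \<delta>)"
proof -
  obtain e1 where e1: "e1 > 0" "\<And>t. t \<in> {-e1<..<e1} \<Longrightarrow> \<gamma> t \<in> fst d" "smooth_on {-e1<..<e1} (snd d \<circ> \<gamma>)"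
    using smooth_curve_in_chart[OF A assms(2) d(1,2)] by blast
  obtain e2 where e2: "e2 > 0" "\<And>t. t \<in> {-e2<..<e2} \<Longrightarrow> \<delta> t \<in> fst d" "smooth_on {-e2<..<e2} (snd d \<circ> \<delta>)"
    using smooth_curve_in_chart[OF A assms(3) d(1,3)] by blast
  define e where "e = min e1 e2"
  have sub: "{-e<..<e} \<subseteq> {-e1<..<e1}" "{-e<..<e} \<subseteq> {-e2<..<e2}" by (auto simp: e_def)
  show ?thesis
  proof (rule that)
    show "e > 0" using e1 e2 by (simp add: e_def)
    show "smooth_on {-e<..<e} (snd d \<circ> \<gamma>)" "smooth_on {-e<..<e} (snd d \<circ> \<delta>)"
      using smooth_on_subset[OF e1(3) sub(1)] smooth_on_subset[OF e2(3) sub(2)] by auto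
  qed (use e1(2) e2(2) sub in blast)+
qed

section \<open>Contact of curves and jets\<close>

text \<open>Transition maps preserve agreement of jets by \<open>same_jet_compose\<close>, so
  contact, which is required in all charts, can be tested in one.\<close>

lemma contact_iff:
  assumes A: "smooth_atlas \<A>" and \<gamma>: "smooth_curve \<A> \<gamma>" and \<delta>: "smooth_curve \<A> \<delta>"
    and c: "c \<in> \<A>" "\<gamma> 0 \<in> fst c"
  shows "contact \<A> r \<gamma> \<delta> \<longleftrightarrow> \<gamma> 0 = \<delta> 0 \<and> same_jet r (snd c \<circ> \<gamma>) (snd c \<circ> \<delta>)"
proof
  assume "contact \<A> r \<gamma> \<delta>"
  then show "\<gamma> 0 = \<delta> 0 \<and> same_jet r (snd c \<circ> \<gamma>) (snd c \<circ> \<delta>)"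
    using c unfolding contact_def same_jet_def by (auto simp: case_prod_beta)
next
  assume *: "\<gamma> 0 = \<delta> 0 \<and> same_jet r (snd c \<circ> \<gamma>) (snd c \<circ> \<delta>)"
  have "same_jet r (snd d \<circ> \<gamma>) (snd d \<circ> \<delta>)" if d: "d \<in> \<A>" "\<gamma> 0 \<in> fst d" for d
  proof -
    obtain e1 where e1: "e1 > 0" "\<And>t. t \<in> {-e1<..<e1} \<Longrightarrow> \<gamma> t \<in> fst d" "\<And>t. t \<in> {-e1<..<e1} \<Longrightarrow> \<delta> t \<in> fst d"
      using smooth_curves_in_chart[OF A \<gamma> \<delta> d] d * by metis
    obtain e2 where e2: "e2 > 0" "\<And>t. t \<in> {-e2<..<e2} \<Longrightarrow> \<gamma> t \<in> fst c" "\<And>t. t \<in> {-e2<..<e2} \<Longrightarrow> \<delta> t \<in> fst c"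
      "smooth_on {-e2<..<e2} (snd c \<circ> \<gamma>)" "smooth_on {-e2<..<e2} (snd c \<circ> \<delta>)"
      using smooth_curves_in_chart[OF A \<gamma> \<delta> c] c * by metis
    define I where "I = {-min e1 e2<..<min e1 e2}"
    have I: "open I" "0 \<in> I" using e1 e2 by (auto simp: I_def)
    have in_c: "\<gamma> t \<in> fst c" "\<delta> t \<in> fst c" if "t \<in> I" for t
      using that e2 by (auto simp: I_def)
    have in_d: "\<gamma> t \<in> fst d" "\<delta> t \<in> fst d" if "t \<in> I" for t
      using that e1 by (auto simp: I_def)
    have inj: "inj_on (snd c) (fst c)" using A c smooth_atlas_inj by blast
    have "same_jet r (\<lambda>t. local_rep c (snd d) ((snd c \<circ> \<gamma>) t)) (\<lambda>t. local_rep c (snd d) ((snd c \<circ> \<delta>) t))"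
      using in_c in_d *
      by (intro same_jet_compose[OF I _ _ smooth_on_subset[OF e2(4)] smooth_on_subset[OF e2(5)]
            smooth_atlas_transition[OF A c(1) d(1)]])
        (auto simp: I_def)
    then show ?thesis
      by (rule same_jet_cong[OF I, THEN iffD1, rotated -1]) (use in_c in_d inj in \<open>auto simp: local_rep_apply\<close>)
  qed
  then show "contact \<A> r \<gamma> \<delta>"
    using * unfolding contact_def same_jet_def by (auto simp: case_prod_beta)
qed

lemma contact_refl: "contact \<A> r \<gamma> \<gamma>"
  by (auto simp: contact_def)

lemma contact_sym: "contact \<A> r \<gamma> \<delta> \<Longrightarrow> contact \<A> r \<delta> \<gamma>"
  unfolding contact_def by (auto split: prod.splits)

lemma contact_trans: "contact \<A> r \<gamma> \<delta> \<Longrightarrow> contact \<A> r \<delta> \<epsilon> \<Longrightarrow> contact \<A> r \<gamma> \<epsilon>"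
  unfolding contact_def by (auto split: prod.splits)

lemma contact_mono: "contact \<A> r \<gamma> \<delta> \<Longrightarrow> q \<le> r \<Longrightarrow> contact \<A> q \<gamma> \<delta>"
  unfolding contact_def by (auto split: prod.splits)

lemma jet_cong: "contact \<A> r \<gamma> \<delta> \<Longrightarrow> jet \<A> r \<gamma> = jet \<A> r \<delta>"
  unfolding jet_def using contact_sym contact_trans by blast

lemma in_jet: "\<delta> \<in> jet \<A> r \<gamma> \<longleftrightarrow> smooth_curve \<A> \<delta> \<and> contact \<A> r \<gamma> \<delta>"
  by (simp add: jet_def)

lemma jet_eqD:
  "smooth_curve \<A> \<delta> \<Longrightarrow> jet \<A> r \<gamma> = jet \<A> r \<delta> \<Longrightarrow> contact \<A> r \<gamma> \<delta>"
  using in_jet contact_refl by blast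

lemma jet_eqI:
  assumes "smooth_atlas \<A>" "smooth_curve \<A> \<gamma>" "smooth_curve \<A> \<delta>" "c \<in> \<A>" "\<gamma> 0 \<in> fst c"
    "\<gamma> 0 = \<delta> 0" "same_jet r (snd c \<circ> \<gamma>) (snd c \<circ> \<delta>)"
  shows "jet \<A> r \<gamma> = jet \<A> r \<delta>"
  using assms by (intro jet_cong) (simp add: contact_iff)

lemma jet_curve_jet:
  assumes "smooth_curve \<A> \<gamma>"
  shows "smooth_curve \<A> (jet_curve (jet \<A> r \<gamma>))" "contact \<A> r \<gamma> (jet_curve (jet \<A> r \<gamma>))"
proof -
  have "\<gamma> \<in> jet \<A> r \<gamma>" using assms contact_refl by (simp add: in_jet)
  then have "jet_curve (jet \<A> r \<gamma>) \<in> jet \<A> r \<gamma>"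
    unfolding jet_curve_def by (rule someI[of "\<lambda>c. c \<in> jet \<A> r \<gamma>"])
  then show "smooth_curve \<A> (jet_curve (jet \<A> r \<gamma>))" "contact \<A> r \<gamma> (jet_curve (jet \<A> r \<gamma>))"
    by (auto simp: in_jet)
qed

lemma jet_base_jet: "smooth_curve \<A> \<gamma> \<Longrightarrow> jet_base (jet \<A> r \<gamma>) = \<gamma> 0"
  using jet_curve_jet(2)[of \<A> \<gamma> r] by (simp add: jet_base_def contact_def)

lemma jet_coord_jet:
  assumes "smooth_curve \<A> \<gamma>" "c \<in> \<A>" "\<gamma> 0 \<in> fst c" "s \<le> r"
  shows "jet_coord (snd c) s (jet \<A> r \<gamma>) = curve_deriv s (snd c \<circ> \<gamma>) 0"
  using jet_curve_jet(2)[OF assms(1), of r] assms(2-)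
  unfolding contact_def jet_coord_def by (auto simp: case_prod_beta)

lemma jet_spaceE:
  assumes "j \<in> jet_space \<A> r"
  obtains \<gamma> where "smooth_curve \<A> \<gamma>" "j = jet \<A> r \<gamma>"
  using assms by (auto simp: jet_space_def)

lemma jet_jet_curve:
  assumes "j \<in> jet_space \<A> r"
  shows "smooth_curve \<A> (jet_curve j)" "jet \<A> r (jet_curve j) = j"
  using assms jet_curve_jet jet_cong by (metis jet_spaceE)+

text \<open>Lifts a curve given in coordinates to the manifold. It stays in the image of the chart
  only near 0, whence the smaller interval.\<close>

lemma curve_of_chart:
  assumes A: "smooth_atlas \<A>" and c: "c \<in> \<A>" and I: "open I" "0 \<in> I" and f: "smooth_on I f"
    and f0: "f 0 \<in> snd c ` fst c"
  obtains e where "e > 0" "{-e<..<e} \<subseteq> I"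
    "\<And>t. t \<in> {-e<..<e} \<Longrightarrow> inv_into (fst c) (snd c) (f t) \<in> fst c"
    "\<And>t. t \<in> {-e<..<e} \<Longrightarrow> snd c (inv_into (fst c) (snd c) (f t)) = f t"
    "smooth_curve \<A> (\<lambda>t. inv_into (fst c) (snd c) (f t))"
proof -
  have "open (I \<inter> f -` (snd c ` fst c))"
    using smooth_on_continuous_on[OF f] I smooth_atlas_open[OF A c]
    by (intro continuous_open_preimage) auto
  moreover have "0 \<in> I \<inter> f -` (snd c ` fst c)" using I f0 by auto
  ultimately obtain e where e: "e > 0" "{-e<..<e} \<subseteq> I \<inter> f -` (snd c ` fst c)"
    by (rule open_interval_subset)
  have 1: "inv_into (fst c) (snd c) (f t) \<in> fst c" if "t \<in> {-e<..<e}" for t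
    using e that by (intro inv_into_into) auto
  have 2: "snd c (inv_into (fst c) (snd c) (f t)) = f t" if "t \<in> {-e<..<e}" for t
    using e that by (intro f_inv_into_f) auto
  have "smooth_curve \<A> (\<lambda>t. inv_into (fst c) (snd c) (f t))"
  proof (rule smooth_curveI[OF c e(1) 1])
    have "smooth_on {-e<..<e} f" using f e by (auto intro: smooth_on_subset)
    then show "smooth_on {-e<..<e} (snd c \<circ> (\<lambda>t. inv_into (fst c) (snd c) (f t)))"
      by (rule smooth_on_cong[rotated]) (auto simp: 2)
  qed
  then show ?thesis
    using that e 1 2 by blast
qed

section \<open>Tangent vectors and their velocities\<close>

lemma velocity_jet:
  assumes "smooth_curve \<A> \<gamma>" "c \<in> \<A>" "\<gamma> 0 \<in> fst c"
  shows "velocity (snd c) (jet \<A> 1 \<gamma>) = vector_derivative (snd c \<circ> \<gamma>) (at 0)"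
  using jet_coord_jet[OF assms, of 1 1] curve_deriv_Suc[of 0 "snd c \<circ> \<gamma>"] by simp

lemma same_jet_1: "same_jet 1 f g \<longleftrightarrow> f 0 = g 0 \<and> vector_derivative f (at 0) = vector_derivative g (at 0)"
  using same_jet_Suc[of 0 f g] by simp

lemma velocity_transition:
  assumes A: "smooth_atlas \<A>" and \<gamma>: "smooth_curve \<A> \<gamma>" and c: "c \<in> \<A>" "\<gamma> 0 \<in> fst c"
    and d: "d \<in> \<A>" "\<gamma> 0 \<in> fst d"
  shows "vector_derivative (snd d \<circ> \<gamma>) (at 0)
    = frechet_derivative (local_rep c (snd d)) (at (snd c (\<gamma> 0))) (vector_derivative (snd c \<circ> \<gamma>) (at 0))"
proof -
  obtain e1 where e1: "e1 > 0" "\<And>t. t \<in> {-e1<..<e1} \<Longrightarrow> \<gamma> t \<in> fst d"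
    using smooth_curve_in_chart[OF A \<gamma> d] by metis
  obtain e2 where e2: "e2 > 0" "\<And>t. t \<in> {-e2<..<e2} \<Longrightarrow> \<gamma> t \<in> fst c"
    "smooth_on {-e2<..<e2} (snd c \<circ> \<gamma>)"
    using smooth_curve_in_chart[OF A \<gamma> c] by metis
  define I where "I = {-min e1 e2<..<min e1 e2}"
  have I: "open I" "0 \<in> I" using e1 e2 by (auto simp: I_def)
  have in_cd: "\<gamma> t \<in> fst c" "\<gamma> t \<in> fst d" if "t \<in> I" for t
    using that e1 e2 by (auto simp: I_def)
  have "vector_derivative (snd d \<circ> \<gamma>) (at 0)
      = vector_derivative (\<lambda>t. local_rep c (snd d) ((snd c \<circ> \<gamma>) t)) (at 0)"
    using in_cd smooth_atlas_inj[OF A c(1)]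
    by (intro vector_derivative_cong_open[OF I]) (auto simp: local_rep_apply)
  also have "\<dots> = frechet_derivative (local_rep c (snd d)) (at ((snd c \<circ> \<gamma>) 0))
      (vector_derivative (snd c \<circ> \<gamma>) (at 0))"
    using in_cd I
    by (intro vector_derivative_compose[OF I smooth_on_subset[OF e2(3)]
          smooth_atlas_transition[OF A c(1) d(1)]]) (auto simp: I_def)
  finally show ?thesis by simp
qed

lemma points_iff: "x \<in> points \<A> \<longleftrightarrow> (\<exists>c\<in>\<A>. x \<in> fst c)"
  by (auto simp: points_def)

lemma smooth_curve_near0_points:
  assumes "smooth_curve \<A> \<gamma>"
  shows "near0 \<gamma> (points \<A>)"
proof -
  obtain c e where "c \<in> \<A>" "e > 0" "\<And>t. t \<in> {-e<..<e} \<Longrightarrow> \<gamma> t \<in> fst c"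
    using assms unfolding smooth_curve_def by (auto simp: case_prod_beta)
  then show ?thesis
    unfolding near0_def points_iff by blast
qed

lemma tangent_space_points:
  "tangent_space \<A> (points \<A>) x = {jet \<A> 1 \<gamma> |\<gamma>. smooth_curve \<A> \<gamma> \<and> \<gamma> 0 = x}"
  using smooth_curve_near0_points unfolding tangent_space_def by blast

lemma tangent_vector_exists:
  assumes A: "smooth_atlas \<A>" and c: "c \<in> \<A>" "x \<in> fst c"
  obtains \<gamma> where "smooth_curve \<A> \<gamma>" "\<gamma> 0 = x" "vector_derivative (snd c \<circ> \<gamma>) (at 0) = v"
proof -
  let ?f = "\<lambda>t::real. snd c x + t *\<^sub>R v"
  have f: "smooth_on UNIV ?f"
    by (intro smooth_on_add smooth_on_const smooth_on_scaleR smooth_on_id) auto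
  obtain e where e: "e > 0" "{-e<..<e} \<subseteq> UNIV"
    "\<And>t. t \<in> {-e<..<e} \<Longrightarrow> inv_into (fst c) (snd c) (?f t) \<in> fst c"
    "\<And>t. t \<in> {-e<..<e} \<Longrightarrow> snd c (inv_into (fst c) (snd c) (?f t)) = ?f t"
    "smooth_curve \<A> (\<lambda>t. inv_into (fst c) (snd c) (?f t))"
    by (rule curve_of_chart[OF A c(1) open_UNIV UNIV_I f]) (use c in auto)
  have "vector_derivative (snd c \<circ> (\<lambda>t. inv_into (fst c) (snd c) (?f t))) (at 0)
      = vector_derivative ?f (at 0)"
    using e by (intro vector_derivative_cong_open[of "{-e<..<e}"]) auto
  also have "\<dots> = v"
    by (rule vector_derivative_at) (auto intro!: derivative_eq_intros)
  finally show ?thesis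
    using e(5) smooth_atlas_inj[OF A c(1)] c by (intro that) auto
qed

section \<open>Induced charts of jet spaces\<close>

text \<open>The functions a and \<open>\<iota>\<close> decompose the model space of the r-jets into the r + 1 copies of
  the model space of the base.\<close>

definition jet_frame ::
    "nat \<Rightarrow> (nat \<Rightarrow> 'e::euclidean_space \<Rightarrow> 'f::euclidean_space) \<Rightarrow> (nat \<Rightarrow> 'f \<Rightarrow> 'e) \<Rightarrow> bool" where
  "jet_frame r a \<iota> \<longleftrightarrow> (\<forall>s\<le>r. bounded_linear (a s) \<and> bounded_linear (\<iota> s)) \<and>
     (\<forall>s\<le>r. \<forall>u\<le>r. \<forall>v. a s (\<iota> u v) = (if s = u then v else 0)) \<and> (\<forall>z. (\<Sum>s\<le>r. \<iota> s (a s z)) = z)"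

definition jet_chart ::
    "('x, 'f::euclidean_space) chart set \<Rightarrow> nat \<Rightarrow> (nat \<Rightarrow> 'f \<Rightarrow> 'e::euclidean_space) \<Rightarrow>
     ('x, 'f) chart \<Rightarrow> ('x jet, 'e) chart" where
  "jet_chart \<A> r \<iota> c = ({j \<in> jet_space \<A> r. jet_base j \<in> fst c},
     \<lambda>j. \<Sum>s\<le>r. \<iota> s (jet_coord (snd c) s j))"

lemma jet_frame_a:
  assumes "jet_frame r a \<iota>" "s \<le> r"
  shows "a s (\<Sum>u\<le>r. \<iota> u (w u)) = w s"
proof -
  have "a s (\<Sum>u\<le>r. \<iota> u (w u)) = (\<Sum>u\<le>r. a s (\<iota> u (w u)))"
    using assms by (intro linear_sum) (simp add: jet_frame_def bounded_linear.linear)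
  also have "\<dots> = (\<Sum>u\<le>r. if s = u then w u else 0)"
    using assms by (intro sum.cong) (auto simp: jet_frame_def)
  finally show ?thesis using assms(2) by simp
qed

lemma jet_frame_eqI:
  assumes "jet_frame r a \<iota>" "\<And>s. s \<le> r \<Longrightarrow> a s z = a s z'"
  shows "z = z'"
proof -
  have "z = (\<Sum>s\<le>r. \<iota> s (a s z))" "z' = (\<Sum>s\<le>r. \<iota> s (a s z'))"
    using assms(1) by (auto simp: jet_frame_def)
  then show ?thesis using assms(2) by simp
qed

section \<open>Polynomial representatives of jets\<close>

text \<open>The polynomial with derivatives \<open>w 0\<close>, ..., \<open>w r\<close> at 0. It
  represents the jet with these coordinates and depends smoothly on time and coefficients together,
  which is what smoothness of the induced transition maps rests on.\<close>

definition taylor_curve :: "nat \<Rightarrow> (nat \<Rightarrow> 'f::real_normed_vector) \<Rightarrow> real \<Rightarrow> 'f" where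
  "taylor_curve r w t = (\<Sum>s\<le>r. (t ^ s / fact s) *\<^sub>R w s)"

lemma taylor_curve_0: "taylor_curve r w 0 = w 0"
proof -
  have "taylor_curve r w 0 = (\<Sum>s\<le>r. if s = 0 then w 0 else 0)"
    unfolding taylor_curve_def by (intro sum.cong) auto
  then show ?thesis by simp
qed

lemma taylor_curve_has_vector_derivative:
  "(taylor_curve (Suc r) w has_vector_derivative taylor_curve r (\<lambda>s. w (Suc s)) t) (at t)"
proof -
  have eq: "taylor_curve (Suc r) w = (\<lambda>t. w 0 + (\<Sum>s\<le>r. (t ^ Suc s / fact (Suc s)) *\<^sub>R w (Suc s)))"
    unfolding taylor_curve_def by (simp add: sum.atMost_Suc_shift del: fact_Suc power_Suc sum.atMost_Suc)
  have "((\<lambda>t. (t ^ Suc s / fact (Suc s)) *\<^sub>R v) has_vector_derivative (t ^ s / fact s) *\<^sub>R v) (at t)"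
    for s and v :: 'a
  proof -
    have "((\<lambda>t. t ^ Suc s / fact (Suc s)) has_real_derivative
        (real (Suc s) * t ^ s / fact (Suc s))) (at t)"
      by (rule derivative_eq_intros refl | simp del: fact_Suc)+
    moreover have "real (Suc s) * t ^ s / fact (Suc s) = t ^ s / fact s"
      by (simp add: fact_Suc)
    ultimately have "((\<lambda>t. t ^ Suc s / fact (Suc s)) has_real_derivative (t ^ s / fact s)) (at t)"
      by metis
    from has_vector_derivative_scaleR[OF this has_vector_derivative_const[of v]] show ?thesis
      by simp
  qed
  then have "((\<lambda>t. w 0 + (\<Sum>s\<le>r. (t ^ Suc s / fact (Suc s)) *\<^sub>R w (Suc s))) has_vector_derivative
     0 + (\<Sum>s\<le>r. (t ^ s / fact s) *\<^sub>R w (Suc s))) (at t)"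
    by (intro has_vector_derivative_add has_vector_derivative_const has_vector_derivative_sum)
  then show ?thesis
    unfolding eq taylor_curve_def by simp
qed

lemma curve_deriv_taylor_curve: "s \<le> r \<Longrightarrow> curve_deriv s (taylor_curve r w) 0 = w s"
proof (induction s arbitrary: r w)
  case (Suc s)
  then obtain q where q: "r = Suc q" by (cases r) auto
  have "(\<lambda>t. vector_derivative (taylor_curve (Suc q) w) (at t)) = taylor_curve q (\<lambda>s. w (Suc s))"
    using vector_derivative_at[OF taylor_curve_has_vector_derivative] by blast
  then show ?case
    using Suc by (simp add: q curve_deriv_Suc)
qed (simp add: taylor_curve_0)

lemma smooth_on_power:
  fixes f :: "'a::euclidean_space \<Rightarrow> real"
  shows "open S \<Longrightarrow> smooth_on S f \<Longrightarrow> smooth_on S (\<lambda>x. f x ^ n)"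
  by (induction n) (auto intro: smooth_on_const smooth_on_mult)

lemma smooth_on_taylor_curve:
  fixes f :: "'a::euclidean_space \<Rightarrow> real" and w :: "'a \<Rightarrow> nat \<Rightarrow> 'f::euclidean_space"
  assumes "open S" "smooth_on S f" "\<And>s. s \<le> r \<Longrightarrow> smooth_on S (\<lambda>x. w x s)"
  shows "smooth_on S (\<lambda>x. taylor_curve r (w x) (f x))"
  unfolding taylor_curve_def divide_inverse
  using assms
  by (intro smooth_on_sum smooth_on_scaleR smooth_on_mult smooth_on_power smooth_on_const) auto

text \<open>Time derivatives are iterated directional derivatives in the direction (0, 1), hence
  smooth in parameter and time jointly. Q is a general open subset of the product because the time
  for which a curve stays in a chart depends on the parameter.\<close>

lemma curve_deriv_parameter:
  fixes g :: "'a::euclidean_space \<times> real \<Rightarrow> 'b::real_normed_vector"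
  assumes "open Q" "smooth_on Q g"
  shows "\<exists>h. smooth_on Q h \<and> (\<forall>z t. (z, t) \<in> Q \<longrightarrow> curve_deriv s (\<lambda>t. g (z, t)) t = h (z, t))"
  using assms(2)
proof (induction s arbitrary: g)
  case 0
  then show ?case by auto
next
  case (Suc s)
  let ?g' = "\<lambda>x. frechet_derivative g (at x) (0, 1)"
  obtain h where h: "smooth_on Q h" "\<And>z t. (z, t) \<in> Q \<Longrightarrow> curve_deriv s (\<lambda>t. ?g' (z, t)) t = h (z, t)"
    using Suc.IH[OF smooth_on_derivative[OF Suc.prems]] by blast
  have "curve_deriv (Suc s) (\<lambda>t. g (z, t)) t = h (z, t)" if zt: "(z, t) \<in> Q" for z t
  proof -
    let ?I = "(\<lambda>t. (z, t)) -` Q"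
    have I: "open ?I"
      using assms(1) by (intro open_vimage) (auto intro!: continuous_intros)
    have "vector_derivative (\<lambda>t. g (z, t)) (at t) = ?g' (z, t)" if "t \<in> ?I" for t
    proof -
      have "((\<lambda>t. (z, t)) has_vector_derivative (0, 1)) (at t)"
        by (auto intro!: has_vector_derivative_Pair)
      from vector_derivative_diff_chain_within[OF this, of g "frechet_derivative g (at (z, t))"]
      show ?thesis
        using smooth_on_has_derivative[OF Suc.prems, of "(z, t)"] that
        by (intro vector_derivative_at) (simp add: o_def has_derivative_at_withinI)
    qed
    then have "curve_deriv s (\<lambda>t. vector_derivative (\<lambda>t. g (z, t)) (at t)) t = curve_deriv s (\<lambda>t. ?g' (z, t)) t"
      using zt by (intro curve_deriv_cong[OF I]) auto
    then show ?thesis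
      using h(2)[OF zt] by (simp add: curve_deriv_Suc)
  qed
  then show ?case using h(1) by blast
qed

section \<open>Charts of jet spaces and their transition maps\<close>

lemma jet_in_jet_chart:
  "smooth_curve \<A> \<gamma> \<Longrightarrow> jet \<A> r \<gamma> \<in> fst (jet_chart \<A> r \<iota> c) \<longleftrightarrow> \<gamma> 0 \<in> fst c"
  by (auto simp: jet_chart_def jet_base_jet jet_space_def)

lemma jet_chart_jet:
  assumes "smooth_curve \<A> \<gamma>" "c \<in> \<A>" "\<gamma> 0 \<in> fst c"
  shows "snd (jet_chart \<A> r \<iota> c) (jet \<A> r \<gamma>) = (\<Sum>s\<le>r. \<iota> s (curve_deriv s (snd c \<circ> \<gamma>) 0))"
  using assms by (simp add: jet_chart_def jet_coord_jet)

context
  fixes \<A> :: "('x, 'f::euclidean_space) chart set" and r :: nat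
    and a :: "nat \<Rightarrow> 'e::euclidean_space \<Rightarrow> 'f" and \<iota> :: "nat \<Rightarrow> 'f \<Rightarrow> 'e"
  assumes A: "smooth_atlas \<A>" and fr: "jet_frame r a \<iota>"
begin

lemma jet_chart_coord:
  assumes "smooth_curve \<A> \<gamma>" "c \<in> \<A>" "\<gamma> 0 \<in> fst c" "s \<le> r"
  shows "a s (snd (jet_chart \<A> r \<iota> c) (jet \<A> r \<gamma>)) = curve_deriv s (snd c \<circ> \<gamma>) 0"
  by (simp add: jet_chart_jet[OF assms(1-3)] jet_frame_a[OF fr assms(4)])

lemma inj_on_jet_chart:
  assumes c: "c \<in> \<A>"
  shows "inj_on (snd (jet_chart \<A> r \<iota> c)) (fst (jet_chart \<A> r \<iota> c))"
proof (rule inj_onI)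
  fix j1 j2
  assume j: "j1 \<in> fst (jet_chart \<A> r \<iota> c)" "j2 \<in> fst (jet_chart \<A> r \<iota> c)"
    and eq: "snd (jet_chart \<A> r \<iota> c) j1 = snd (jet_chart \<A> r \<iota> c) j2"
  obtain \<gamma> \<delta> where \<gamma>: "smooth_curve \<A> \<gamma>" "j1 = jet \<A> r \<gamma>" and \<delta>: "smooth_curve \<A> \<delta>" "j2 = jet \<A> r \<delta>"
    using j unfolding jet_chart_def by (auto elim!: jet_spaceE)
  have 0: "\<gamma> 0 \<in> fst c" "\<delta> 0 \<in> fst c"
    using j \<gamma> \<delta> by (auto simp: jet_in_jet_chart)
  have *: "same_jet r (snd c \<circ> \<gamma>) (snd c \<circ> \<delta>)"
    using eq jet_chart_coord[OF \<gamma>(1) c 0(1)] jet_chart_coord[OF \<delta>(1) c 0(2)]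
    by (simp add: same_jet_def \<gamma>(2) \<delta>(2))
  then have "snd c (\<gamma> 0) = snd c (\<delta> 0)"
    using same_jet_mono[of r _ _ 0] by fastforce
  then have "\<gamma> 0 = \<delta> 0"
    using smooth_atlas_inj[OF A c] 0 by (auto dest: inj_onD)
  then show "j1 = j2"
    using jet_eqI[OF A \<gamma>(1) \<delta>(1) c 0(1) _ *] \<gamma> \<delta> by simp
qed

lemma jet_chart_curve:
  assumes c: "c \<in> \<A>" and z: "a 0 z \<in> snd c ` fst c"
  obtains \<gamma> e where "e > 0" "smooth_curve \<A> \<gamma>" "\<gamma> 0 \<in> fst c" "snd c (\<gamma> 0) = a 0 z"
    "\<And>t. t \<in> {-e<..<e} \<Longrightarrow> \<gamma> t \<in> fst c"
    "\<And>t. t \<in> {-e<..<e} \<Longrightarrow> snd c (\<gamma> t) = taylor_curve r (\<lambda>s. a s z) t"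
    "snd (jet_chart \<A> r \<iota> c) (jet \<A> r \<gamma>) = z"
proof -
  let ?P = "taylor_curve r (\<lambda>s. a s z)"
  have P0: "?P 0 \<in> snd c ` fst c"
    using z by (simp add: taylor_curve_0)
  have P: "smooth_on UNIV ?P"
    by (intro smooth_on_taylor_curve smooth_on_const smooth_on_id) auto
  obtain e where e: "e > 0"
    "\<And>t. t \<in> {-e<..<e} \<Longrightarrow> inv_into (fst c) (snd c) (?P t) \<in> fst c"
    "\<And>t. t \<in> {-e<..<e} \<Longrightarrow> snd c (inv_into (fst c) (snd c) (?P t)) = ?P t"
    "smooth_curve \<A> (\<lambda>t. inv_into (fst c) (snd c) (?P t))"
    using curve_of_chart[OF A c open_UNIV UNIV_I P P0] by metis
  define \<gamma> where "\<gamma> = (\<lambda>t. inv_into (fst c) (snd c) (?P t))"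
  have 0: "\<gamma> 0 \<in> fst c" "snd c (\<gamma> 0) = a 0 z"
    using e(1) e(2,3)[of 0] by (auto simp: \<gamma>_def taylor_curve_0)
  have \<gamma>: "smooth_curve \<A> \<gamma>" using e(4) by (simp add: \<gamma>_def)
  have "curve_deriv s (snd c \<circ> \<gamma>) 0 = a s z" if "s \<le> r" for s
  proof -
    have "curve_deriv s (snd c \<circ> \<gamma>) 0 = curve_deriv s ?P 0"
      using e by (intro curve_deriv_cong[of "{-e<..<e}"]) (auto simp: \<gamma>_def)
    then show ?thesis using curve_deriv_taylor_curve[OF that] by metis
  qed
  then have "a s (snd (jet_chart \<A> r \<iota> c) (jet \<A> r \<gamma>)) = a s z" if "s \<le> r" for s
    using jet_chart_coord[OF \<gamma> c 0(1) that] that by simp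
  then have "snd (jet_chart \<A> r \<iota> c) (jet \<A> r \<gamma>) = z"
    by (rule jet_frame_eqI[OF fr])
  then show ?thesis
    using that[OF e(1) \<gamma> 0] e(2,3) by (simp add: \<gamma>_def)
qed

lemma jet_chart_image_Int:
  assumes c: "c \<in> \<A>"
  shows "snd (jet_chart \<A> r \<iota> c) ` (fst (jet_chart \<A> r \<iota> c) \<inter> fst (jet_chart \<A> r \<iota> d))
    = {z. a 0 z \<in> snd c ` (fst c \<inter> fst d)}"
proof safe
  fix j assume j: "j \<in> fst (jet_chart \<A> r \<iota> c)" "j \<in> fst (jet_chart \<A> r \<iota> d)"
  obtain \<gamma> where \<gamma>: "smooth_curve \<A> \<gamma>" "j = jet \<A> r \<gamma>"
    using j unfolding jet_chart_def by (auto elim!: jet_spaceE)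
  have "\<gamma> 0 \<in> fst c" "\<gamma> 0 \<in> fst d" using j \<gamma> by (auto simp: jet_in_jet_chart)
  then show "a 0 (snd (jet_chart \<A> r \<iota> c) j) \<in> snd c ` (fst c \<inter> fst d)"
    using jet_chart_coord[OF \<gamma>(1) c, of 0] \<gamma>(2) by auto
next
  fix z x assume zx: "a 0 z = snd c x" "x \<in> fst c" "x \<in> fst d"
  obtain \<gamma> where \<gamma>: "smooth_curve \<A> \<gamma>" "\<gamma> 0 \<in> fst c" "snd c (\<gamma> 0) = a 0 z"
    "snd (jet_chart \<A> r \<iota> c) (jet \<A> r \<gamma>) = z"
    using jet_chart_curve[OF c, of z] zx by (metis imageI)
  have "\<gamma> 0 = x"
    using \<gamma> zx smooth_atlas_inj[OF A c] by (auto dest: inj_onD)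
  then show "z \<in> snd (jet_chart \<A> r \<iota> c) ` (fst (jet_chart \<A> r \<iota> c) \<inter> fst (jet_chart \<A> r \<iota> d))"
    using \<gamma> zx by (intro image_eqI[of _ _ "jet \<A> r \<gamma>"]) (auto simp: jet_in_jet_chart)
qed

lemma open_jet_frame_preimage: "open S \<Longrightarrow> open {z. a 0 z \<in> S}"
  using fr open_vimage[of S "a 0"]
  by (simp add: jet_frame_def vimage_def linear_continuous_on)

text \<open>The jet with coordinates z is represented by its Taylor polynomial P. In the other chart
  its coordinates are the time derivatives at 0 of the transition map composed with P, and these are
  smooth in z by \<open>curve_deriv_parameter\<close>.\<close>

lemma smooth_transition_jet_chart:
  assumes c: "c \<in> \<A>" and d: "d \<in> \<A>"
  shows "smooth_transition (jet_chart \<A> r \<iota> c) (jet_chart \<A> r \<iota> d)"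
proof -
  define S where "S = snd c ` (fst c \<inter> fst d)"
  define \<tau> where "\<tau> = local_rep c (snd d)"
  define O' where "O' = {z. a 0 z \<in> S}"
  have S: "open S" and \<tau>: "smooth_on S \<tau>"
    using smooth_atlas_open_Int[OF A c d] smooth_atlas_transition[OF A c d] by (auto simp: S_def \<tau>_def)
  have O: "open O'" using open_jet_frame_preimage[OF S] by (simp add: O'_def)
  define P where "P = (\<lambda>x :: 'e \<times> real. taylor_curve r (\<lambda>s. a s (fst x)) (snd x))"
  have P: "smooth_on UNIV P"
    unfolding P_def
  proof (rule smooth_on_taylor_curve)
    show "smooth_on UNIV (\<lambda>x :: 'e \<times> real. a s (fst x))" if "s \<le> r" for s
      using fr that
      by (intro smooth_on_linear_compose[of UNIV "a s"] smooth_on_fst smooth_on_id)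
        (auto simp: jet_frame_def)
  qed (auto intro: smooth_on_snd smooth_on_id)
  define Q where "Q = P -` S"
  have Q: "open Q"
    using smooth_on_continuous_on[OF P] S by (simp add: Q_def open_vimage)
  have G: "smooth_on Q (\<lambda>x. \<tau> (P x))"
    by (rule smooth_on_compose[OF Q smooth_on_subset[OF P] \<tau>]) (auto simp: Q_def)
  have "\<exists>h. smooth_on Q h \<and> (\<forall>z t. (z, t) \<in> Q \<longrightarrow> curve_deriv s (\<lambda>t. \<tau> (P (z, t))) t = h (z, t))" for s
    by (rule curve_deriv_parameter[OF Q G])
  then obtain h where h: "\<And>s. smooth_on Q (h s)"
    "\<And>s z t. (z, t) \<in> Q \<Longrightarrow> curve_deriv s (\<lambda>t. \<tau> (P (z, t))) t = h s (z, t)"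
    by metis
  have Q0: "(z, 0) \<in> Q \<longleftrightarrow> z \<in> O'" for z
    by (simp add: Q_def P_def O'_def taylor_curve_0)
  have "smooth_on O' (\<lambda>z. \<Sum>s\<le>r. \<iota> s (h s (z, 0)))"
    using fr O Q0
    by (intro smooth_on_sum smooth_on_linear_compose[of _ "\<iota> _"] smooth_on_compose[OF _ _ h(1)]
        smooth_on_Pair smooth_on_id smooth_on_const) (auto simp: jet_frame_def)
  then have "smooth_on O' (local_rep (jet_chart \<A> r \<iota> c) (snd (jet_chart \<A> r \<iota> d)))"
  proof (rule smooth_on_cong[OF O])
    fix z assume z: "z \<in> O'"
    then have "a 0 z \<in> snd c ` fst c" by (auto simp: O'_def S_def)
    then obtain \<gamma> e where \<gamma>: "e > 0" "smooth_curve \<A> \<gamma>" "\<gamma> 0 \<in> fst c" "snd c (\<gamma> 0) = a 0 z"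
      "\<And>t. t \<in> {-e<..<e} \<Longrightarrow> \<gamma> t \<in> fst c"
      "\<And>t. t \<in> {-e<..<e} \<Longrightarrow> snd c (\<gamma> t) = P (z, t)"
      "snd (jet_chart \<A> r \<iota> c) (jet \<A> r \<gamma>) = z"
      using jet_chart_curve[OF c] unfolding P_def by (metis fst_conv snd_conv)
    have inj: "inj_on (snd c) (fst c)" by (rule smooth_atlas_inj[OF A c])
    have 0: "\<gamma> 0 \<in> fst d"
      using z \<gamma>(3,4) inj by (auto simp: O'_def S_def dest: inj_onD)
    have "local_rep (jet_chart \<A> r \<iota> c) (snd (jet_chart \<A> r \<iota> d)) z
       = snd (jet_chart \<A> r \<iota> d) (jet \<A> r \<gamma>)"
      using local_rep_apply[OF inj_on_jet_chart[OF c], of "jet \<A> r \<gamma>" "snd (jet_chart \<A> r \<iota> d)"]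
        jet_in_jet_chart[OF \<gamma>(2), of r \<iota> c] \<gamma>(3,7) by simp
    also have "\<dots> = (\<Sum>s\<le>r. \<iota> s (curve_deriv s (snd d \<circ> \<gamma>) 0))"
      by (rule jet_chart_jet[OF \<gamma>(2) d 0])
    also have "\<dots> = (\<Sum>s\<le>r. \<iota> s (h s (z, 0)))"
    proof -
      have "curve_deriv s (snd d \<circ> \<gamma>) 0 = h s (z, 0)" for s
      proof -
        have "curve_deriv s (snd d \<circ> \<gamma>) 0 = curve_deriv s (\<lambda>t. \<tau> (P (z, t))) 0"
        proof (rule curve_deriv_cong)
          show "(snd d \<circ> \<gamma>) t = \<tau> (P (z, t))" if "t \<in> {-e<..<e}" for t
            using \<gamma>(5,6)[OF that] local_rep_apply[OF inj, of "\<gamma> t" "snd d"] by (simp add: \<tau>_def)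
        qed (use \<gamma>(1) in auto)
        then show ?thesis using h(2) Q0 z by simp
      qed
      then show ?thesis by simp
    qed
    finally show "(\<Sum>s\<le>r. \<iota> s (h s (z, 0))) = local_rep (jet_chart \<A> r \<iota> c) (snd (jet_chart \<A> r \<iota> d)) z"
      by simp
  qed
  then show ?thesis
    unfolding smooth_transition_def jet_chart_image_Int[OF c] by (simp add: O'_def S_def)
qed

lemma smooth_atlas_jet_chart: "smooth_atlas (jet_chart \<A> r \<iota> ` \<A>)"
  unfolding smooth_atlas_def
  using inj_on_jet_chart smooth_transition_jet_chart jet_chart_image_Int
    open_jet_frame_preimage[OF smooth_atlas_open_Int[OF A]]
  by auto

end

section \<open>Cotangent bundles\<close>

context
  fixes \<N> :: "('y, 'e::euclidean_space) chart set"
  assumes N: "smooth_atlas \<N>"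
begin

section \<open>Covectors and their momenta\<close>

lemma velocity_tangent:
  assumes "v \<in> tangent_space \<N> (points \<N>) y" "c \<in> \<N>" "y \<in> fst c" "d \<in> \<N>" "y \<in> fst d"
  shows "velocity (snd d) v = frechet_derivative (local_rep c (snd d)) (at (snd c y)) (velocity (snd c) v)"
proof -
  obtain \<gamma> where \<gamma>: "smooth_curve \<N> \<gamma>" "\<gamma> 0 = y" "v = jet \<N> 1 \<gamma>"
    using assms(1) by (auto simp: tangent_space_points)
  show ?thesis
    using velocity_transition[OF N \<gamma>(1) assms(2) _ assms(4)] assms \<gamma>(2)
    by (simp add: \<gamma>(3) velocity_jet[OF \<gamma>(1)] del: One_nat_def)
qed

lemma velocity_surj:
  assumes "c \<in> \<N>" "y \<in> fst c"
  obtains v where "v \<in> tangent_space \<N> (points \<N>) y" "velocity (snd c) v = w"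
proof -
  obtain \<gamma> where \<gamma>: "smooth_curve \<N> \<gamma>" "\<gamma> 0 = y" "vector_derivative (snd c \<circ> \<gamma>) (at 0) = w"
    using tangent_vector_exists[OF N assms] by blast
  show ?thesis
    using \<gamma> velocity_jet[OF \<gamma>(1) assms(1)] assms(2)
    by (intro that[of "jet \<N> 1 \<gamma>"]) (auto simp: tangent_space_points simp del: One_nat_def)
qed

text \<open>The velocities of tangent vectors at y exhaust the model space, so an identity tested on
  all of them determines p; this is the uniqueness behind the \<open>THE\<close> in
  \<open>momentum\<close>.\<close>

lemma momentum_eqI:
  assumes "c \<in> \<N>" "y \<in> fst c" "\<And>v. v \<in> tangent_space \<N> (points \<N>) y \<Longrightarrow> \<alpha> v = p \<bullet> velocity (snd c) v"
  shows "momentum \<N> (snd c) (y, \<alpha>) = p"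
proof -
  have "q = p" if "\<And>v. v \<in> tangent_space \<N> (points \<N>) y \<Longrightarrow> \<alpha> v = q \<bullet> velocity (snd c) v" for q
  proof -
    obtain v where "v \<in> tangent_space \<N> (points \<N>) y" "velocity (snd c) v = q - p"
      using velocity_surj[OF assms(1,2)] by blast
    then have "(q - p) \<bullet> (q - p) = 0"
      using that[of v] assms(3)[of v] by (simp add: inner_diff_left)
    then show ?thesis by simp
  qed
  then show ?thesis
    unfolding momentum_def using assms(3) by (auto intro!: the_equality)
qed

lemma linear_functional_inner:
  fixes l :: "'e \<Rightarrow> real"
  assumes "linear l"
  shows "l x = (\<Sum>b\<in>Basis. l b *\<^sub>R b) \<bullet> x"
  using linear_Basis_expand[OF assms, of x]
  by (simp add: inner_sum_left inner_commute[of x] mult.commute)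

lemma momentum_apply:
  assumes "c \<in> \<N>" "y \<in> fst c" "\<alpha> \<in> cotangent_space \<N> y" "v \<in> tangent_space \<N> (points \<N>) y"
  shows "\<alpha> v = momentum \<N> (snd c) (y, \<alpha>) \<bullet> velocity (snd c) v"
proof -
  obtain l where l: "linear l" "\<And>v. v \<in> tangent_space \<N> (points \<N>) y \<Longrightarrow> \<alpha> v = l (velocity (snd c) v)"
    using assms(1-3) unfolding cotangent_space_def by (auto simp: case_prod_beta)
  define p where "p = (\<Sum>b\<in>Basis. l b *\<^sub>R b)"
  have p: "\<alpha> v = p \<bullet> velocity (snd c) v" if "v \<in> tangent_space \<N> (points \<N>) y" for v
    unfolding p_def l(2)[OF that] by (rule linear_functional_inner[OF l(1)])
  then show ?thesis
    using momentum_eqI[OF assms(1,2) p] assms(4) by simp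
qed

lemma covector_exists:
  assumes c: "c \<in> \<N>" "y \<in> fst c"
  obtains \<alpha> where "\<alpha> \<in> cotangent_space \<N> y" "momentum \<N> (snd c) (y, \<alpha>) = p"
proof -
  define \<alpha> where "\<alpha> = restrict (\<lambda>v. p \<bullet> velocity (snd c) v) (tangent_space \<N> (points \<N>) y)"
  have "\<exists>l. linear l \<and> (\<forall>v\<in>tangent_space \<N> (points \<N>) y. \<alpha> v = l (velocity (snd d) v))"
    if d: "d \<in> \<N>" "y \<in> fst d" for d
  proof (intro exI conjI ballI)
    \<comment> \<open>Linearity of a covector is demanded in every chart d around y; there the
      functional is composed with the derivative of the transition from d to c.\<close>
    let ?D = "frechet_derivative (local_rep d (snd c)) (at (snd d y))"
    have "linear ?D"
      using smooth_on_derivative_linear[OF smooth_atlas_transition[OF N d(1) c(1)]] c d by blast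
    then show "linear (\<lambda>w. p \<bullet> ?D w)"
      by (simp add: linear_iff inner_add_right)
    show "\<alpha> v = p \<bullet> ?D (velocity (snd d) v)" if "v \<in> tangent_space \<N> (points \<N>) y" for v
      using velocity_tangent[OF that d c] that by (simp add: \<alpha>_def)
  qed
  then have "\<alpha> \<in> cotangent_space \<N> y"
    unfolding cotangent_space_def by (auto simp: \<alpha>_def)
  moreover have "momentum \<N> (snd c) (y, \<alpha>) = p"
    by (rule momentum_eqI[OF c]) (simp add: \<alpha>_def)
  ultimately show ?thesis using that by blast
qed

lemma covector_eqI:
  assumes "c \<in> \<N>" "y \<in> fst c" "\<alpha> \<in> cotangent_space \<N> y" "\<beta> \<in> cotangent_space \<N> y"
    "momentum \<N> (snd c) (y, \<alpha>) = momentum \<N> (snd c) (y, \<beta>)"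
  shows "\<alpha> = \<beta>"
proof (rule extensionalityI)
  show "\<alpha> \<in> extensional (tangent_space \<N> (points \<N>) y)" "\<beta> \<in> extensional (tangent_space \<N> (points \<N>) y)"
    using assms by (auto simp: cotangent_space_def)
  show "\<alpha> v = \<beta> v" if "v \<in> tangent_space \<N> (points \<N>) y" for v
    using momentum_apply[OF assms(1-3) that] momentum_apply[OF assms(1,2,4) that] assms(5) by simp
qed

text \<open>Momenta transform by the transpose of the derivative of the transition map; pairing with
  w expresses this without an adjoint.\<close>

lemma momentum_transition:
  assumes "c \<in> \<N>" "y \<in> fst c" "d \<in> \<N>" "y \<in> fst d" "\<alpha> \<in> cotangent_space \<N> y"
  shows "momentum \<N> (snd c) (y, \<alpha>) \<bullet> w
    = momentum \<N> (snd d) (y, \<alpha>) \<bullet> frechet_derivative (local_rep c (snd d)) (at (snd c y)) w"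
proof -
  obtain v where "v \<in> tangent_space \<N> (points \<N>) y" "velocity (snd c) v = w"
    using velocity_surj[OF assms(1,2)] by blast
  then show ?thesis
    using momentum_apply[OF assms(1,2,5), of v] momentum_apply[OF assms(3,4,5), of v]
      velocity_tangent[of v y c d] assms by simp
qed

text \<open>The transformation law solved for the momentum in d, by means of the inverse transition;
  in this form it is visibly smooth in the coordinates.\<close>

lemma momentum_transition_sum:
  assumes "c \<in> \<N>" "y \<in> fst c" "d \<in> \<N>" "y \<in> fst d" "\<alpha> \<in> cotangent_space \<N> y"
  shows "momentum \<N> (snd d) (y, \<alpha>)
    = (\<Sum>b\<in>Basis. (momentum \<N> (snd c) (y, \<alpha>) \<bullet> frechet_derivative (local_rep d (snd c)) (at (snd d y)) b) *\<^sub>R b)"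
  unfolding momentum_transition[OF assms(3,4,1,2,5), symmetric] euclidean_representation ..

section \<open>Charts of the cotangent bundle and the canonical form\<close>

lemma cotangent_chart_simps:
  "a \<in> fst (cotangent_chart \<N> c) \<longleftrightarrow> fst a \<in> fst c \<and> snd a \<in> cotangent_space \<N> (fst a)"
  "snd (cotangent_chart \<N> c) a = (snd c (fst a), momentum \<N> (snd c) a)"
  by (auto simp: cotangent_chart_def case_prod_beta)

lemma inj_on_cotangent_chart:
  assumes "c \<in> \<N>"
  shows "inj_on (snd (cotangent_chart \<N> c)) (fst (cotangent_chart \<N> c))"
proof (rule inj_onI)
  fix a b
  assume ab: "a \<in> fst (cotangent_chart \<N> c)" "b \<in> fst (cotangent_chart \<N> c)"
    "snd (cotangent_chart \<N> c) a = snd (cotangent_chart \<N> c) b"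
  then have "fst a = fst b"
    using smooth_atlas_inj[OF N assms] by (auto simp: cotangent_chart_simps dest: inj_onD)
  then show "a = b"
    using ab covector_eqI[OF assms, of "fst a" "snd a" "snd b"]
    by (cases a, cases b) (auto simp: cotangent_chart_simps)
qed

lemma cotangent_chart_image_Int:
  assumes c: "c \<in> \<N>"
  shows "snd (cotangent_chart \<N> c) ` (fst (cotangent_chart \<N> c) \<inter> fst (cotangent_chart \<N> d))
    = snd c ` (fst c \<inter> fst d) \<times> UNIV"
proof safe
  fix y p assume y: "y \<in> fst c" "y \<in> fst d"
  obtain \<alpha> where "\<alpha> \<in> cotangent_space \<N> y" "momentum \<N> (snd c) (y, \<alpha>) = p"
    using covector_exists[OF c y(1)] by blast
  then show "(snd c y, p) \<in> snd (cotangent_chart \<N> c) ` (fst (cotangent_chart \<N> c) \<inter> fst (cotangent_chart \<N> d))"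
    using y by (intro image_eqI[of _ _ "(y, \<alpha>)"]) (auto simp: cotangent_chart_simps)
qed (auto simp: cotangent_chart_simps)

lemma smooth_transition_cotangent_chart:
  assumes c: "c \<in> \<N>" and d: "d \<in> \<N>"
  shows "smooth_transition (cotangent_chart \<N> c) (cotangent_chart \<N> d)"
proof -
  define S where "S = snd c ` (fst c \<inter> fst d)"
  define \<tau> where "\<tau> = local_rep c (snd d)"
  define \<sigma> where "\<sigma> = local_rep d (snd c)"
  have S: "open S" and \<tau>: "smooth_on S \<tau>" and \<sigma>: "smooth_on (snd d ` (fst d \<inter> fst c)) \<sigma>"
    using smooth_atlas_open_Int[OF N c d] smooth_atlas_transition[OF N c d]
      smooth_atlas_transition[OF N d c] by (auto simp: S_def \<tau>_def \<sigma>_def)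
  have \<tau>_apply: "\<tau> (snd c y) = snd d y" if "y \<in> fst c" for y
    using local_rep_apply[OF smooth_atlas_inj[OF N c] that] by (simp add: \<tau>_def)
  have O: "open (S \<times> (UNIV :: 'e set))" using S by (simp add: open_Times)
  have f: "smooth_on (S \<times> (UNIV :: 'e set)) (\<lambda>x. \<tau> (fst x))"
    using O by (intro smooth_on_compose[OF _ _ \<tau>] smooth_on_fst smooth_on_id) auto
  have "smooth_on (S \<times> UNIV) (\<lambda>x. (\<tau> (fst x),
      \<Sum>b\<in>Basis. (snd x \<bullet> frechet_derivative \<sigma> (at (\<tau> (fst x))) b) *\<^sub>R b))"
    using O \<tau>_apply
    by (intro smooth_on_Pair f smooth_on_sum smooth_on_scaleR smooth_on_const smooth_on_inner
        smooth_on_snd smooth_on_id smooth_on_compose[OF _ f smooth_on_derivative[OF \<sigma>]])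
      (auto simp: S_def)
  then have "smooth_on (S \<times> UNIV) (local_rep (cotangent_chart \<N> c) (snd (cotangent_chart \<N> d)))"
  proof (rule smooth_on_cong[OF O])
    fix x assume "x \<in> S \<times> (UNIV :: 'e set)"
    then have "x \<in> snd (cotangent_chart \<N> c) ` (fst (cotangent_chart \<N> c) \<inter> fst (cotangent_chart \<N> d))"
      by (simp add: cotangent_chart_image_Int[OF c] S_def)
    then obtain a where a: "x = snd (cotangent_chart \<N> c) a" "a \<in> fst (cotangent_chart \<N> c)"
      "a \<in> fst (cotangent_chart \<N> d)" by auto
    have "local_rep (cotangent_chart \<N> c) (snd (cotangent_chart \<N> d)) x = snd (cotangent_chart \<N> d) a"
      unfolding a(1) by (rule local_rep_apply[OF inj_on_cotangent_chart[OF c] a(2)])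
    also have "\<dots> = (\<tau> (fst x), \<Sum>b\<in>Basis. (snd x \<bullet> frechet_derivative \<sigma> (at (\<tau> (fst x))) b) *\<^sub>R b)"
      using a(2,3) momentum_transition_sum[OF c _ d, of "fst a" "snd a"]
      by (simp add: a(1) cotangent_chart_simps \<tau>_apply \<sigma>_def)
    finally show "(\<tau> (fst x), \<Sum>b\<in>Basis. (snd x \<bullet> frechet_derivative \<sigma> (at (\<tau> (fst x))) b) *\<^sub>R b)
       = local_rep (cotangent_chart \<N> c) (snd (cotangent_chart \<N> d)) x" by simp
  qed
  then show ?thesis
    unfolding smooth_transition_def cotangent_chart_image_Int[OF c] by (simp add: S_def)
qed

lemma smooth_atlas_cotangent: "smooth_atlas (cotangent_atlas \<N>)"
  unfolding smooth_atlas_def cotangent_atlas_def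
  using inj_on_cotangent_chart smooth_transition_cotangent_chart cotangent_chart_image_Int
    smooth_atlas_open_Int[OF N]
  by (auto intro!: open_Times)

text \<open>The terms containing second derivatives of the transition map cancel by symmetry.\<close>

lemma canonical_form_transition:
  assumes c: "c \<in> \<N>" and d: "d \<in> \<N>"
    and \<gamma>: "smooth_curve (cotangent_atlas \<N>) \<gamma>" and \<delta>: "smooth_curve (cotangent_atlas \<N>) \<delta>"
    and 0: "\<gamma> 0 = \<delta> 0" "\<gamma> 0 \<in> fst (cotangent_chart \<N> c)" "\<gamma> 0 \<in> fst (cotangent_chart \<N> d)"
  defines "vc \<equiv> \<lambda>\<gamma>. vector_derivative (snd (cotangent_chart \<N> c) \<circ> \<gamma>) (at 0)"
    and "vd \<equiv> \<lambda>\<gamma>. vector_derivative (snd (cotangent_chart \<N> d) \<circ> \<gamma>) (at 0)"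
  shows "fst (vc \<gamma>) \<bullet> snd (vc \<delta>) - fst (vc \<delta>) \<bullet> snd (vc \<gamma>)
    = fst (vd \<gamma>) \<bullet> snd (vd \<delta>) - fst (vd \<delta>) \<bullet> snd (vd \<gamma>)"
proof -
  let ?C = "cotangent_chart \<N> c" and ?D = "cotangent_chart \<N> d"
  define S where "S = snd c ` (fst c \<inter> fst d)"
  define \<tau> where "\<tau> = local_rep c (snd d)"
  have S: "open S" and \<tau>: "smooth_on S \<tau>"
    using smooth_atlas_open_Int[OF N c d] smooth_atlas_transition[OF N c d] by (auto simp: S_def \<tau>_def)
  define x where "x = snd c (fst (\<gamma> 0))"
  define p where "p = momentum \<N> (snd d) (\<gamma> 0)"
  have xS: "x \<in> S" using 0 by (auto simp: x_def S_def cotangent_chart_simps)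
  have CD: "?C \<in> cotangent_atlas \<N>" "?D \<in> cotangent_atlas \<N>"
    using c d by (auto simp: cotangent_atlas_def)
  \<comment> \<open>The second conjunct is \<open>momentum_transition\<close> differentiated along
    the curve. As the matrix of the transformation moves with the base point, a term with the second
    derivative of \<open>\<tau>\<close>, contracted with the common momentum p, appears.\<close>
  have key: "fst (vd \<epsilon>) = frechet_derivative \<tau> (at x) (fst (vc \<epsilon>)) \<and>
      w \<bullet> snd (vc \<epsilon>) = frechet_derivative \<tau> (at x) w \<bullet> snd (vd \<epsilon>)
        + p \<bullet> frechet_derivative (\<lambda>y. frechet_derivative \<tau> (at y) w) (at x) (fst (vc \<epsilon>))"
    if \<epsilon>: "smooth_curve (cotangent_atlas \<N>) \<epsilon>" "\<epsilon> 0 = \<gamma> 0" for \<epsilon> w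
  proof -
    obtain e1 where e1: "e1 > 0" "\<And>t. t \<in> {-e1<..<e1} \<Longrightarrow> \<epsilon> t \<in> fst ?C" "smooth_on {-e1<..<e1} (snd ?C \<circ> \<epsilon>)"
      using smooth_curve_in_chart[OF smooth_atlas_cotangent \<epsilon>(1) CD(1)] 0 \<epsilon>(2) by metis
    obtain e2 where e2: "e2 > 0" "\<And>t. t \<in> {-e2<..<e2} \<Longrightarrow> \<epsilon> t \<in> fst ?D" "smooth_on {-e2<..<e2} (snd ?D \<circ> \<epsilon>)"
      using smooth_curve_in_chart[OF smooth_atlas_cotangent \<epsilon>(1) CD(2)] 0 \<epsilon>(2) by metis
    define I where "I = {-min e1 e2<..<min e1 e2}"
    have I: "open I" "0 \<in> I" using e1 e2 by (auto simp: I_def)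
    have IC: "fst (\<epsilon> t) \<in> fst c" "fst (\<epsilon> t) \<in> fst d" "snd (\<epsilon> t) \<in> cotangent_space \<N> (fst (\<epsilon> t))"
      if "t \<in> I" for t
      using that e1(2)[of t] e2(2)[of t] by (auto simp: I_def cotangent_chart_simps)
    define q where "q = (\<lambda>t. snd c (fst (\<epsilon> t)))"
    define P where "P = (\<lambda>t. momentum \<N> (snd c) (\<epsilon> t))"
    define q' where "q' = (\<lambda>t. snd d (fst (\<epsilon> t)))"
    define P' where "P' = (\<lambda>t. momentum \<N> (snd d) (\<epsilon> t))"
    have compC: "snd ?C \<circ> \<epsilon> = (\<lambda>t. (q t, P t))" and compD: "snd ?D \<circ> \<epsilon> = (\<lambda>t. (q' t, P' t))"
      by (auto simp: q_def P_def q'_def P'_def cotangent_chart_simps)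
    have vC: "((\<lambda>t. (q t, P t)) has_vector_derivative vc \<epsilon>) (at 0)"
      using smooth_on_has_vector_derivative[OF e1(3), of 0] e1(1) by (simp add: vc_def compC)
    have vD: "((\<lambda>t. (q' t, P' t)) has_vector_derivative vd \<epsilon>) (at 0)"
      using smooth_on_has_vector_derivative[OF e2(3), of 0] e2(1) by (simp add: vd_def compD)
    have q: "(q has_vector_derivative fst (vc \<epsilon>)) (at 0)" and P: "(P has_vector_derivative snd (vc \<epsilon>)) (at 0)"
      using bounded_linear.has_vector_derivative[OF bounded_linear_fst vC]
        bounded_linear.has_vector_derivative[OF bounded_linear_snd vC] by simp_all
    have q': "(q' has_vector_derivative fst (vd \<epsilon>)) (at 0)" and P': "(P' has_vector_derivative snd (vd \<epsilon>)) (at 0)"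
      using bounded_linear.has_vector_derivative[OF bounded_linear_fst vD]
        bounded_linear.has_vector_derivative[OF bounded_linear_snd vD] by simp_all
    have q0: "q 0 = x" and P'0: "P' 0 = p" by (auto simp: q_def x_def P'_def p_def \<epsilon>(2))
    have comp: "((\<lambda>t. F (q t)) has_vector_derivative frechet_derivative F (at x) (fst (vc \<epsilon>))) (at 0)"
      if "smooth_on S F" for F :: "'e \<Rightarrow> 'e"
      using vector_derivative_diff_chain_within[OF q, of F "frechet_derivative F (at x)"]
        smooth_on_has_derivative[OF that xS]
      by (simp add: q0 o_def has_derivative_at_withinI)
    have "((\<lambda>t. \<tau> (q t)) has_vector_derivative fst (vd \<epsilon>)) (at 0)"
      by (rule has_vector_derivative_transform_within_open[OF q' I])
        (use IC local_rep_apply[OF smooth_atlas_inj[OF N c], of _ "snd d"] in \<open>auto simp: q_def q'_def \<tau>_def\<close>)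
    then have 1: "fst (vd \<epsilon>) = frechet_derivative \<tau> (at x) (fst (vc \<epsilon>))"
      using comp[OF \<tau>] vector_derivative_unique_at by blast
    have w1: "((\<lambda>t. w \<bullet> P t) has_vector_derivative w \<bullet> snd (vc \<epsilon>)) (at 0)"
      by (rule bounded_linear.has_vector_derivative[OF bounded_linear_inner_right P])
    have "((\<lambda>t. P' t \<bullet> frechet_derivative \<tau> (at (q t)) w) has_vector_derivative w \<bullet> snd (vc \<epsilon>)) (at 0)"
    proof (rule has_vector_derivative_transform_within_open[OF w1 I])
      fix t assume "t \<in> I"
      from momentum_transition[OF c IC(1)[OF this] d IC(2,3)[OF this], of w]
      show "w \<bullet> P t = P' t \<bullet> frechet_derivative \<tau> (at (q t)) w"
        by (simp add: q_def P_def P'_def \<tau>_def inner_commute[of w])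
    qed
    moreover have "((\<lambda>t. P' t \<bullet> frechet_derivative \<tau> (at (q t)) w) has_vector_derivative
        (p \<bullet> frechet_derivative (\<lambda>y. frechet_derivative \<tau> (at y) w) (at x) (fst (vc \<epsilon>))
          + snd (vd \<epsilon>) \<bullet> frechet_derivative \<tau> (at x) w)) (at 0)"
      using bounded_bilinear.has_vector_derivative[OF bounded_bilinear_inner P'
          comp[OF smooth_on_derivative[OF \<tau>, of w]]] by (simp add: q0 P'0)
    ultimately have "w \<bullet> snd (vc \<epsilon>) = p \<bullet> frechet_derivative (\<lambda>y. frechet_derivative \<tau> (at y) w) (at x) (fst (vc \<epsilon>))
          + snd (vd \<epsilon>) \<bullet> frechet_derivative \<tau> (at x) w"
      using vector_derivative_unique_at by blast
    with 1 show ?thesis by (simp add: inner_commute)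
  qed
  note k1 = key[OF \<gamma> refl] and k2 = key[OF \<delta> 0(1)[symmetric]]
  show ?thesis
    using k1[of "fst (vc \<delta>)"] k2[of "fst (vc \<gamma>)"]
      second_derivative_symmetric[OF S \<tau> xS, of "fst (vc \<gamma>)" "fst (vc \<delta>)"] by simp
qed

text \<open>By \<open>canonical_form_transition\<close> all charts around the base point give the
  same number, so the \<open>THE\<close> in \<open>canonical_form\<close> finds a value; the chart c
  shows that it is the only one.\<close>

lemma canonical_form_jet:
  assumes c: "c \<in> \<N>"
    and \<gamma>: "smooth_curve (cotangent_atlas \<N>) \<gamma>" and \<delta>: "smooth_curve (cotangent_atlas \<N>) \<delta>"
    and 0: "\<gamma> 0 = \<delta> 0" "\<gamma> 0 \<in> fst (cotangent_chart \<N> c)"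
  defines "v \<equiv> \<lambda>\<gamma>. vector_derivative (snd (cotangent_chart \<N> c) \<circ> \<gamma>) (at 0)"
  shows "canonical_form \<N> (jet (cotangent_atlas \<N>) 1 \<gamma>) (jet (cotangent_atlas \<N>) 1 \<delta>)
    = fst (v \<gamma>) \<bullet> snd (v \<delta>) - fst (v \<delta>) \<bullet> snd (v \<gamma>)"
proof -
  let ?C = "cotangent_atlas \<N>"
  have vel: "velocity (snd D) (jet ?C 1 \<epsilon>) = vector_derivative (snd D \<circ> \<epsilon>) (at 0)"
    if "D \<in> ?C" "\<epsilon> 0 \<in> fst D" "smooth_curve ?C \<epsilon>" for D \<epsilon>
    using that velocity_jet by blast
  let ?R = "\<lambda>r. \<forall>(D, \<xi>)\<in>?C. jet_base (jet ?C 1 \<gamma>) \<in> D \<longrightarrow>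
        r = fst (velocity \<xi> (jet ?C 1 \<gamma>)) \<bullet> snd (velocity \<xi> (jet ?C 1 \<delta>))
          - fst (velocity \<xi> (jet ?C 1 \<delta>)) \<bullet> snd (velocity \<xi> (jet ?C 1 \<gamma>))"
  let ?r = "fst (v \<gamma>) \<bullet> snd (v \<delta>) - fst (v \<delta>) \<bullet> snd (v \<gamma>)"
  have 1: "?R ?r"
  proof (clarify)
    fix D \<xi> assume D: "(D, \<xi>) \<in> ?C" "jet_base (jet ?C 1 \<gamma>) \<in> D"
    then have "\<gamma> 0 \<in> D" by (metis \<gamma> jet_base_jet)
    moreover obtain d where d: "d \<in> \<N>" "(D, \<xi>) = cotangent_chart \<N> d"
      using D by (auto simp: cotangent_atlas_def)
    ultimately show "?r = fst (velocity \<xi> (jet ?C 1 \<gamma>)) \<bullet> snd (velocity \<xi> (jet ?C 1 \<delta>))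
          - fst (velocity \<xi> (jet ?C 1 \<delta>)) \<bullet> snd (velocity \<xi> (jet ?C 1 \<gamma>))"
      using canonical_form_transition[OF c d(1) \<gamma> \<delta> 0] vel[of "(D, \<xi>)" \<gamma>] vel[of "(D, \<xi>)" \<delta>] D(1) 0(1) \<gamma> \<delta>
      by (simp add: v_def flip: d(2))
  qed
  have 2: "r = ?r" if "?R r" for r
  proof -
    have "cotangent_chart \<N> c \<in> ?C" using c by (simp add: cotangent_atlas_def)
    with that have "jet_base (jet ?C 1 \<gamma>) \<in> fst (cotangent_chart \<N> c) \<longrightarrow>
        r = fst (velocity (snd (cotangent_chart \<N> c)) (jet ?C 1 \<gamma>)) \<bullet> snd (velocity (snd (cotangent_chart \<N> c)) (jet ?C 1 \<delta>))
          - fst (velocity (snd (cotangent_chart \<N> c)) (jet ?C 1 \<delta>)) \<bullet> snd (velocity (snd (cotangent_chart \<N> c)) (jet ?C 1 \<gamma>))"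
      by (auto simp: case_prod_beta)
    then show ?thesis
      using vel[OF \<open>cotangent_chart \<N> c \<in> ?C\<close>] 0 \<gamma> \<delta> jet_base_jet[OF \<gamma>, of 1] by (simp add: v_def)
  qed
  show ?thesis
    unfolding canonical_form_def using 1 2 by (rule the_equality)
qed

end

section \<open>The bundle carrying the presymplectic system\<close>

text \<open>Inverse to \<open>pos\<close> on the orders below k; beyond them its values are
  arbitrary, which explains the guards \<open>s < CARD('k)\<close>.\<close>

definition index_at :: "nat \<Rightarrow> 'k::{finite, linorder}" where
  "index_at = inv_into UNIV pos"

lemma pos_less_iff: "pos r < pos s \<longleftrightarrow> r < (s :: 'k::{finite, linorder})"
proof -
  have *: "pos r < pos s" if "r < s" for r s :: 'k
    unfolding pos_def using that by (intro psubset_card_mono) (auto intro: order.strict_trans)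
  show ?thesis
    using * by (metis linorder_neqE_nat linorder_neqE less_asym order.irrefl)
qed

lemma inj_pos: "inj (pos :: 'k::{finite, linorder} \<Rightarrow> nat)"
  by (rule injI) (metis pos_less_iff linorder_neqE order.irrefl)

lemma pos_less_card: "pos (r :: 'k::{finite, linorder}) < CARD('k)"
  unfolding pos_def by (intro psubset_card_mono) auto

lemma range_pos: "range (pos :: 'k::{finite, linorder} \<Rightarrow> nat) = {..<CARD('k)}"
  by (rule card_subset_eq) (auto simp: pos_less_card card_image inj_pos)

lemma index_at_pos [simp]: "index_at (pos r) = r"
  unfolding index_at_def by (simp add: inj_pos)

lemma pos_index_at [simp]: "s < CARD('k) \<Longrightarrow> pos (index_at s :: 'k::{finite, linorder}) = s"
  unfolding index_at_def by (rule f_inv_into_f) (simp add: range_pos)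

lemma index_at_eq_iff: "s < CARD('k) \<Longrightarrow> index_at s = (r :: 'k::{finite, linorder}) \<longleftrightarrow> s = pos r"
  by auto

text \<open>Identifies the component at \<open>Max UNIV\<close>, which \<open>multiplier\<close>
  reads, as the momentum of order k - 1.\<close>

lemma pos_Max: "pos (Max UNIV :: 'k::{finite, linorder}) = CARD('k) - 1"
proof -
  have "pos (index_at (CARD('k) - 1) :: 'k) \<le> pos (Max UNIV :: 'k)"
    by (metis Max_ge UNIV_I finite leD leI pos_less_iff)
  then show ?thesis
    using pos_less_card[of "Max UNIV :: 'k"] by simp
qed

section \<open>Frames for the bundles of order k - 1 and k\<close>

definition lower_coord :: "nat \<Rightarrow> ('n::finite, 'k::{finite, linorder}) lower \<Rightarrow> real^'n" where
  "lower_coord s u = u $ index_at s"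

definition lower_incl :: "nat \<Rightarrow> real^'n \<Rightarrow> ('n::finite, 'k::{finite, linorder}) lower" where
  "lower_incl s v = axis (index_at s) v"

text \<open>The top coordinate is stored apart from the vector indexed by \<open>'k\<close>, so
  order k needs its own case.\<close>

definition full_coord :: "nat \<Rightarrow> ('n::finite, 'k::{finite, linorder}) jet_coords \<Rightarrow> real^'n" where
  "full_coord s z = (if s < CARD('k) then fst z $ index_at s else snd z)"

definition full_incl :: "nat \<Rightarrow> real^'n \<Rightarrow> ('n::finite, 'k::{finite, linorder}) jet_coords" where
  "full_incl s v = (if s < CARD('k) then (axis (index_at s) v, 0) else (0, v))"

lemma le_card_pred_iff: "s \<le> CARD('k::finite) - Suc 0 \<longleftrightarrow> s < CARD('k)"
  using zero_less_card_finite[where 'a='k] by linarith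

lemma index_at_inj:
  "s < CARD('k) \<Longrightarrow> u < CARD('k) \<Longrightarrow> index_at s = (index_at u :: 'k::{finite, linorder}) \<longleftrightarrow> s = u"
  by (metis pos_index_at)

text \<open>Translates between the sums over orders in \<open>jet_chart\<close> and the vectors
  indexed by \<open>'k\<close> in the charts of the theorem.\<close>

lemma sum_lower:
  fixes w :: "nat \<Rightarrow> real^'n"
  shows "(\<Sum>s\<le>CARD('k::{finite, linorder}) - 1. axis (index_at s) (w s)) = (\<chi> r::'k. w (pos r))"
proof -
  have "(\<Sum>s\<le>CARD('k) - 1. (axis (index_at s) (w s) :: ('n, 'k) lower)) $ r = w (pos r)" for r :: 'k
  proof -
    have "(\<Sum>s\<le>CARD('k) - 1. (axis (index_at s) (w s) :: ('n, 'k) lower)) $ r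
       = (\<Sum>s\<le>CARD('k) - 1. if s = pos r then w s else 0)"
      unfolding sum_component
    proof (rule sum.cong[OF refl])
      fix s assume "s \<in> {..CARD('k) - 1}"
      then have "s < CARD('k)"
        using le_card_pred_iff[of s, where 'k='k] by simp
      then show "(axis (index_at s) (w s) :: ('n, 'k) lower) $ r = (if s = pos r then w s else 0)"
        using index_at_eq_iff[of s r] by (auto simp: axis_def)
    qed
    then show ?thesis
      using pos_less_card[of r] by simp
  qed
  then show ?thesis by (simp add: vec_eq_iff)
qed

lemma bounded_linear_lower_coord: "bounded_linear (lower_coord s)"
  unfolding lower_coord_def by (rule bounded_linear_vec_nth)

lemma bounded_linear_full_coord: "bounded_linear (full_coord s)"
proof -
  have "linear (full_coord s)" by (rule linearI) (auto simp: full_coord_def)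
  then show ?thesis by (simp add: linear_conv_bounded_linear)
qed

lemma bounded_linear_lower_incl: "bounded_linear (lower_incl s)"
  unfolding lower_incl_def by (rule bounded_linear_axis)

lemma bounded_linear_full_incl:
  "bounded_linear (full_incl s :: real^'n \<Rightarrow> ('n::finite, 'k::{finite, linorder}) jet_coords)"
proof -
  have "linear (full_incl s :: real^'n \<Rightarrow> ('n, 'k) jet_coords)"
    by (rule linearI) (auto simp: full_incl_def vec_eq_iff axis_def)
  then show ?thesis by (simp add: linear_conv_bounded_linear)
qed

lemma atMost_card: "{..CARD('k::finite)} = insert CARD('k) {..CARD('k) - 1}"
  using zero_less_card_finite[where 'a='k] by auto

lemma jet_frame_lower:
  "jet_frame (CARD('k) - 1) (lower_coord :: nat \<Rightarrow> ('n::finite, 'k::{finite, linorder}) lower \<Rightarrow> _) lower_incl"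
  unfolding jet_frame_def
proof (intro conjI allI impI)
  fix s u :: nat and v :: "real^'n"
  assume "s \<le> CARD('k) - 1" "u \<le> CARD('k) - 1"
  then have "s < CARD('k)" "u < CARD('k)" by (simp_all add: le_card_pred_iff)
  then show "lower_coord s (lower_incl u v :: ('n, 'k) lower) = (if s = u then v else 0)"
    by (auto simp: lower_coord_def lower_incl_def axis_def index_at_inj)
next
  fix z :: "('n, 'k) lower"
  show "(\<Sum>s\<le>CARD('k) - 1. lower_incl s (lower_coord s z)) = z"
    unfolding lower_incl_def sum_lower by (simp add: lower_coord_def)
qed (auto intro: bounded_linear_lower_coord bounded_linear_lower_incl)

lemma sum_full:
  fixes w :: "nat \<Rightarrow> real^'n"
  shows "(\<Sum>s\<le>CARD('k::{finite, linorder}). full_incl s (w s)) = ((\<chi> r::'k. w (pos r)), w CARD('k))"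
proof -
  have "(\<Sum>s\<le>CARD('k). (full_incl s (w s) :: ('n, 'k) jet_coords))
      = (0, w CARD('k)) + (\<Sum>s\<le>CARD('k) - 1. (axis (index_at s) (w s), 0))"
    unfolding atMost_card using zero_less_card_finite[where 'a='k]
    by (subst sum.insert) (auto simp: full_incl_def le_card_pred_iff intro!: sum.cong)
  also have "(\<Sum>s\<le>CARD('k) - 1. (axis (index_at s) (w s), 0)) = ((\<chi> r::'k. w (pos r)), 0 :: real^'n)"
    by (simp add: sum_prod sum_lower del: One_nat_def)
  finally show ?thesis by simp
qed

lemma jet_frame_full:
  "jet_frame CARD('k) (full_coord :: nat \<Rightarrow> ('n::finite, 'k::{finite, linorder}) jet_coords \<Rightarrow> _) full_incl"
  unfolding jet_frame_def
proof (intro conjI allI impI)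
  fix s u :: nat and v :: "real^'n"
  assume "s \<le> CARD('k)" "u \<le> CARD('k)"
  then show "full_coord s (full_incl u v :: ('n, 'k) jet_coords) = (if s = u then v else 0)"
    by (auto simp: full_coord_def full_incl_def axis_def index_at_inj)
next
  fix z :: "('n, 'k) jet_coords"
  show "(\<Sum>s\<le>CARD('k). full_incl s (full_coord s z)) = z"
    unfolding sum_full by (cases z) (simp add: full_coord_def pos_less_card)
qed (auto intro: bounded_linear_full_coord bounded_linear_full_incl)

text \<open>Both tangent bundles become instances of \<open>jet_chart\<close>, so a single argument
  makes their atlases smooth.\<close>

lemma Tk1_chart_eq:
  "(Tk1_chart \<A> c :: ('q jet, ('n::finite, 'k::{finite, linorder}) lower) chart)
    = jet_chart \<A> (CARD('k) - 1) lower_incl c"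
  unfolding Tk1_chart_def jet_chart_def lower_incl_def sum_lower by simp

lemma Tk_chart_eq:
  "(Tk_chart \<A> c :: ('q jet, ('n::finite, 'k::{finite, linorder}) jet_coords) chart)
    = jet_chart \<A> CARD('k) full_incl c"
  unfolding Tk_chart_def jet_chart_def sum_full by simp

text \<open>The coordinate expression of the canonical immersion.\<close>

definition shift :: "('n::finite, 'k::{finite, linorder}) jet_coords \<Rightarrow> ('n, 'k) lower" where
  "shift z = (\<chi> r. full_coord (Suc (pos r)) z)"

lemma bounded_linear_shift: "bounded_linear shift"
proof -
  have "linear (shift :: ('n::finite, 'k::{finite, linorder}) jet_coords \<Rightarrow> _)"
    by (rule linearI)
      (simp_all add: shift_def vec_eq_iff linear_add[OF bounded_linear.linear[OF bounded_linear_full_coord]]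
        linear_cmul[OF bounded_linear.linear[OF bounded_linear_full_coord]])
  then show ?thesis by (simp add: linear_conv_bounded_linear)
qed

text \<open>q^(k) enters the canonical immersion in the last slot only; therefore the derivative of
  the pairing with the momenta along q^(k) is p^(k-1).\<close>

lemma shift_top: "shift (0, w) = (axis (Max UNIV) w :: ('n::finite, 'k::{finite, linorder}) lower)"
proof -
  have "full_coord (Suc (pos r)) (0 :: ('n, 'k) lower, w) = (if Max UNIV = r then w else 0)" for r :: 'k
  proof (cases "r = Max UNIV")
    case True
    then have "\<not> Suc (pos r) < CARD('k)"
      unfolding True pos_Max by linarith
    then show ?thesis
      using True by (simp add: full_coord_def)
  next
    case False
    then have "r < Max UNIV" by (simp add: order_less_le)
    then have "Suc (pos r) < CARD('k)"
      using pos_Max[where 'k='k] pos_less_iff[of r "Max UNIV"] by linarith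
    then show ?thesis using False by (auto simp: full_coord_def)
  qed
  then show ?thesis by (simp add: vec_eq_iff shift_def axis_def)
qed

section \<open>Prolongation of a curve to its jets\<close>

text \<open>The s-th coordinate of the curve of jets along \<open>\<gamma>\<close> is the s-th
  derivative of \<open>\<gamma>\<close> at the running time, so the velocity consists of the
  derivatives of orders 1 to r + 1. For r = k - 1 this is the coordinate form of j_k.\<close>

lemma jet_prolongation:
  fixes \<A> :: "('x, 'f::euclidean_space) chart set" and \<iota> :: "nat \<Rightarrow> 'f \<Rightarrow> 'e::euclidean_space"
  assumes A: "smooth_atlas \<A>" and fr: "jet_frame r a \<iota>" and \<gamma>: "smooth_curve \<A> \<gamma>"
    and c: "c \<in> \<A>" "\<gamma> 0 \<in> fst c"
  defines "\<beta> \<equiv> \<lambda>t. jet \<A> r (\<lambda>s. \<gamma> (t + s))"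
  shows "smooth_curve (jet_chart \<A> r \<iota> ` \<A>) \<beta>"
    and "vector_derivative (snd (jet_chart \<A> r \<iota> c) \<circ> \<beta>) (at 0)
      = (\<Sum>s\<le>r. \<iota> s (curve_deriv (Suc s) (snd c \<circ> \<gamma>) 0))"
proof -
  obtain e where e: "e > 0" "\<And>t. t \<in> {-e<..<e} \<Longrightarrow> \<gamma> t \<in> fst c" "smooth_on {-e<..<e} (snd c \<circ> \<gamma>)"
    using smooth_curve_in_chart[OF A \<gamma> c] by blast
  let ?I = "{-e<..<e}"
  let ?z = "\<lambda>t. \<Sum>s\<le>r. \<iota> s (curve_deriv s (snd c \<circ> \<gamma>) t)"
  have shifted: "smooth_curve \<A> (\<lambda>s. \<gamma> (t + s))" if t: "t \<in> ?I" for t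
  proof (rule smooth_curveI[OF c(1)])
    \<comment> \<open>The distance from t to the ends of the interval, so that t + s stays
      inside.\<close>
    let ?d = "min (e - t) (e + t)"
    show d: "?d > 0" using t by auto
    show "\<gamma> (t + s) \<in> fst c" if "s \<in> {-?d<..<?d}" for s using that by (intro e(2)) auto
    have "smooth_on {-?d<..<?d} (\<lambda>s. (snd c \<circ> \<gamma>) (t + s))"
      by (intro smooth_on_compose[OF _ _ e(3)] smooth_on_add smooth_on_const smooth_on_id) auto
    then show "smooth_on {-?d<..<?d} (snd c \<circ> (\<lambda>s. \<gamma> (t + s)))"
      by (simp add: o_def)
  qed
  have dom: "\<beta> t \<in> fst (jet_chart \<A> r \<iota> c)" if "t \<in> ?I" for t
    using jet_in_jet_chart[OF shifted[OF that], of r \<iota> c] e(2)[OF that] by (simp add: \<beta>_def)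
  have coord: "snd (jet_chart \<A> r \<iota> c) (\<beta> t) = ?z t" if "t \<in> ?I" for t
    using jet_chart_jet[OF shifted[OF that] c(1)] e(2)[OF that]
      curve_deriv_shift[of _ "snd c \<circ> \<gamma>" t 0] by (simp add: \<beta>_def o_def)
  have "smooth_on ?I ?z"
    using fr e(3) by (intro smooth_on_sum smooth_on_linear_compose[of _ "\<iota> _"] smooth_on_curve_deriv)
      (auto simp: jet_frame_def)
  then have "smooth_on ?I (snd (jet_chart \<A> r \<iota> c) \<circ> \<beta>)"
    by (rule smooth_on_cong[rotated]) (auto simp: coord)
  then show "smooth_curve (jet_chart \<A> r \<iota> ` \<A>) \<beta>"
    using c e(1) dom by (intro smooth_curveI[of "jet_chart \<A> r \<iota> c"]) auto
  have "vector_derivative (snd (jet_chart \<A> r \<iota> c) \<circ> \<beta>) (at 0) = vector_derivative ?z (at 0)"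
    using e(1) coord by (intro vector_derivative_cong_open[of ?I]) auto
  also have "\<dots> = (\<Sum>s\<le>r. \<iota> s (curve_deriv (Suc s) (snd c \<circ> \<gamma>) 0))"
  proof (rule vector_derivative_at, rule has_vector_derivative_sum)
    fix s assume "s \<in> {..r}"
    then have "bounded_linear (\<iota> s)" using fr by (simp add: jet_frame_def)
    moreover have "(curve_deriv s (snd c \<circ> \<gamma>) has_vector_derivative curve_deriv (Suc s) (snd c \<circ> \<gamma>) 0) (at 0)"
      using smooth_on_has_vector_derivative[OF smooth_on_curve_deriv[OF _ e(3), of s], of 0] e(1)
      by (simp add: curve_deriv_Suc_left)
    ultimately show "((\<lambda>t. \<iota> s (curve_deriv s (snd c \<circ> \<gamma>) t)) has_vector_derivative
        \<iota> s (curve_deriv (Suc s) (snd c \<circ> \<gamma>) 0)) (at 0)"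
      by (rule bounded_linear.has_vector_derivative)
  qed
  finally show "vector_derivative (snd (jet_chart \<A> r \<iota> c) \<circ> \<beta>) (at 0)
      = (\<Sum>s\<le>r. \<iota> s (curve_deriv (Suc s) (snd c \<circ> \<gamma>) 0))" .
qed

section \<open>The fibre product and its atlas\<close>

locale jet_bundle =
  fixes \<A> :: "('q, (real, 'n::finite) vec) chart set" and k :: "'k::{finite, linorder} itself"
  assumes A: "smooth_atlas \<A>"
begin

abbreviation lower_chart :: "('q, real^'n) chart \<Rightarrow> ('q jet, ('n, 'k) lower) chart" where
  "lower_chart \<equiv> Tk1_chart \<A>"

abbreviation full_chart :: "('q, real^'n) chart \<Rightarrow> ('q jet, ('n, 'k) jet_coords) chart" where
  "full_chart \<equiv> Tk_chart \<A>"

abbreviation lower_atlas :: "('q jet, ('n, 'k) lower) chart set" where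
  "lower_atlas \<equiv> Tk1_atlas \<A>"

abbreviation fib_chart :: "('q, real^'n) chart \<Rightarrow> ('q fibre_point, ('n, 'k) fibre_coords) chart" where
  "fib_chart \<equiv> fibre_chart \<A>"

abbreviation fib_atlas :: "('q fibre_point, ('n, 'k) fibre_coords) chart set" where
  "fib_atlas \<equiv> fibre_atlas \<A>"

abbreviation proj :: "'q jet \<Rightarrow> 'q jet" where
  "proj \<equiv> jet_proj k \<A>"

text \<open>\<open>fibre_chart\<close> is written with \<open>TYPE('k)\<close>, the locale with the
  variable k; the argument carries only its type.\<close>

lemma jet_proj_TYPE: "jet_proj TYPE('k) \<A> = proj"
  by (simp add: jet_proj_def fun_eq_iff)

lemma smooth_atlas_lower: "smooth_atlas lower_atlas"
  unfolding Tk1_atlas_def Tk1_chart_eq by (rule smooth_atlas_jet_chart[OF A jet_frame_lower])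

lemma smooth_atlas_full: "smooth_atlas (Tk_atlas \<A> :: ('q jet, ('n, 'k) jet_coords) chart set)"
  unfolding Tk_atlas_def Tk_chart_eq by (rule smooth_atlas_jet_chart[OF A jet_frame_full])

lemma lower_chart_in: "c \<in> \<A> \<Longrightarrow> lower_chart c \<in> lower_atlas"
  by (simp add: Tk1_atlas_def)

lemma full_chart_in: "c \<in> \<A> \<Longrightarrow> full_chart c \<in> Tk_atlas \<A>"
  by (simp add: Tk_atlas_def)

lemma fib_chart_in: "c \<in> \<A> \<Longrightarrow> fib_chart c \<in> fib_atlas"
  by (simp add: fibre_atlas_def)

lemma full_chart_dom: "p \<in> fst (full_chart c) \<longleftrightarrow> p \<in> jet_space \<A> CARD('k) \<and> jet_base p \<in> fst c"
  by (auto simp: Tk_chart_def)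

lemma jet_proj_jet: "smooth_curve \<A> \<gamma> \<Longrightarrow> proj (jet \<A> CARD('k) \<gamma>) = jet \<A> (CARD('k) - 1) \<gamma>"
  unfolding jet_proj_def
  using jet_cong[OF contact_mono[OF jet_curve_jet(2)], of \<A> \<gamma> "CARD('k) - 1" "CARD('k)"] by simp

lemma jet_proj_simps:
  assumes "p \<in> jet_space \<A> CARD('k)"
  shows "jet_base (proj p) = jet_base p" "proj p \<in> jet_space \<A> (CARD('k) - 1)"
    "c \<in> \<A> \<Longrightarrow> jet_base p \<in> fst c \<Longrightarrow> proj p \<in> fst (lower_chart c)"
    "c \<in> \<A> \<Longrightarrow> jet_base p \<in> fst c \<Longrightarrow> snd (lower_chart c) (proj p) = fst (snd (full_chart c) p)"
proof -
  obtain \<gamma> where \<gamma>: "smooth_curve \<A> \<gamma>" "p = jet \<A> CARD('k) \<gamma>"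
    using assms by (rule jet_spaceE)
  note pr = jet_proj_jet[OF \<gamma>(1), folded \<gamma>(2)]
  have b: "jet_base p = \<gamma> 0" using jet_base_jet[OF \<gamma>(1)] by (simp add: \<gamma>(2))
  show 1: "jet_base (proj p) = jet_base p"
    using jet_base_jet[OF \<gamma>(1)] by (simp add: pr b)
  show 2: "proj p \<in> jet_space \<A> (CARD('k) - 1)"
    using \<gamma>(1) by (simp add: pr jet_space_def)
  show "proj p \<in> fst (lower_chart c)" if "c \<in> \<A>" "jet_base p \<in> fst c"
    using 1 2 that by (simp add: Tk1_chart_def)
  assume c: "c \<in> \<A>" "jet_base p \<in> fst c"
  have "jet_coord (snd c) (pos r) (proj p) = jet_coord (snd c) (pos r) p" for r :: 'k
    unfolding pr using jet_coord_jet[OF \<gamma>(1) c(1), of "pos r" "CARD('k) - 1"]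
      jet_coord_jet[OF \<gamma>(1) c(1), of "pos r" "CARD('k)"] c(2)[unfolded b] pos_less_card[of r]
    by (simp add: \<gamma>(2) le_card_pred_iff)
  then show "snd (lower_chart c) (proj p) = fst (snd (full_chart c) p)"
    by (simp add: Tk1_chart_def Tk_chart_def)
qed

lemma fib_chart_dom:
  assumes "c \<in> \<A>"
  shows "x \<in> fst (fib_chart c) \<longleftrightarrow> snd x \<in> jet_space \<A> CARD('k) \<and> jet_base (snd x) \<in> fst c \<and>
    fst (fst x) = proj (snd x) \<and> snd (fst x) \<in> cotangent_space lower_atlas (proj (snd x))"
  using assms jet_proj_simps(3)[of "snd x" c]
  by (auto simp: fibre_chart_def cotangent_chart_def full_chart_dom case_prod_beta jet_proj_TYPE)

lemma fib_chart_apply: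
  assumes "c \<in> \<A>" "x \<in> fst (fib_chart c)"
  shows "snd (fib_chart c) x = (fst (snd (full_chart c) (snd x)),
    momentum lower_atlas (snd (lower_chart c)) (fst x), snd (snd (full_chart c) (snd x)))"
proof -
  have "snd (lower_chart c) (proj (snd x)) = fst (snd (full_chart c) (snd x))"
    using assms by (intro jet_proj_simps) (auto simp: fib_chart_dom)
  moreover have "fst (fst x) = proj (snd x)" using assms by (simp add: fib_chart_dom)
  ultimately show ?thesis
    by (simp add: fibre_chart_def cotangent_chart_def case_prod_beta)
qed

text \<open>A fibre chart is glued from a cotangent chart and a chart of order k that share the
  lower coordinates. Injectivity and smoothness of transitions are inherited from the two factors
  through these projections.\<close>

lemma fib_chart_parts:
  assumes "c \<in> \<A>" "x \<in> fst (fib_chart c)"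
  shows "fst x \<in> fst (cotangent_chart lower_atlas (lower_chart c))"
    "snd x \<in> fst (full_chart c)"
    "snd (cotangent_chart lower_atlas (lower_chart c)) (fst x)
      = (fst (snd (fib_chart c) x), fst (snd (snd (fib_chart c) x)))"
    "snd (full_chart c) (snd x) = (fst (snd (fib_chart c) x), snd (snd (snd (fib_chart c) x)))"
proof -
  show "fst x \<in> fst (cotangent_chart lower_atlas (lower_chart c))" "snd x \<in> fst (full_chart c)"
    using assms by (auto simp: fibre_chart_def case_prod_beta)
  show "snd (cotangent_chart lower_atlas (lower_chart c)) (fst x)
      = (fst (snd (fib_chart c) x), fst (snd (snd (fib_chart c) x)))"
    by (simp add: fibre_chart_def case_prod_beta)
  show "snd (full_chart c) (snd x) = (fst (snd (fib_chart c) x), snd (snd (snd (fib_chart c) x)))"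
    by (simp add: fib_chart_apply[OF assms])
qed

lemma inj_on_fib_chart:
  assumes c: "c \<in> \<A>"
  shows "inj_on (snd (fib_chart c)) (fst (fib_chart c))"
proof (rule inj_onI)
  fix x y assume x: "x \<in> fst (fib_chart c)" and y: "y \<in> fst (fib_chart c)"
    and eq: "snd (fib_chart c) x = snd (fib_chart c) y"
  have "fst x = fst y"
    using fib_chart_parts(1,3)[OF c x] fib_chart_parts(1,3)[OF c y] eq
    by (intro inj_onD[OF inj_on_cotangent_chart[OF smooth_atlas_lower lower_chart_in[OF c]]]) auto
  moreover have "snd x = snd y"
    using fib_chart_parts(2,4)[OF c x] fib_chart_parts(2,4)[OF c y] eq
    by (intro inj_onD[OF smooth_atlas_inj[OF smooth_atlas_full full_chart_in[OF c]]]) auto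
  ultimately show "x = y" by (rule prod_eqI)
qed

lemma full_chart_image_Int:
  assumes "c \<in> \<A>"
  shows "snd (full_chart c) ` (fst (full_chart c) \<inter> fst (full_chart d))
    = {z. fst z $ index_at 0 \<in> snd c ` (fst c \<inter> fst d)}"
  unfolding Tk_chart_eq jet_chart_image_Int[OF A jet_frame_full assms]
  using zero_less_card_finite[where 'a='k] by (simp add: full_coord_def)

text \<open>Whether a point lies in a fibre chart is decided by its base point, so overlaps restrict
  q^(0) alone; all other coordinates range freely.\<close>

lemma fib_chart_image_Int:
  assumes c: "c \<in> \<A>" and d: "d \<in> \<A>"
  shows "snd (fib_chart c) ` (fst (fib_chart c) \<inter> fst (fib_chart d))
    = {z. fst z $ index_at 0 \<in> snd c ` (fst c \<inter> fst d)}" (is "?L = ?R")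
proof (intro equalityI subsetI)
  fix z assume "z \<in> ?L"
  then obtain x where z: "z = snd (fib_chart c) x" and x: "x \<in> fst (fib_chart c)" "x \<in> fst (fib_chart d)"
    by blast
  then have "snd x \<in> fst (full_chart c) \<inter> fst (full_chart d)"
    using c d by (auto simp: fib_chart_dom full_chart_dom)
  then have "snd (full_chart c) (snd x) \<in> {z. fst z $ index_at 0 \<in> snd c ` (fst c \<inter> fst d)}"
    using full_chart_image_Int[OF c, of d] by blast
  then show "z \<in> ?R"
    by (simp add: z fib_chart_parts(4)[OF c x(1)])
next
  fix z assume z: "z \<in> ?R"
  obtain u P v where z': "z = (u, P, v)" by (rule prod_cases3)
  have "(u, v) \<in> snd (full_chart c) ` (fst (full_chart c) \<inter> fst (full_chart d))"
    unfolding full_chart_image_Int[OF c] using z by (simp add: z')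
  then obtain p where p: "p \<in> fst (full_chart c)" "p \<in> fst (full_chart d)" "snd (full_chart c) p = (u, v)"
    by auto
  then have pp: "proj p \<in> fst (lower_chart c)"
    using jet_proj_simps(3)[of p c] c by (simp add: full_chart_dom)
  obtain \<alpha> where \<alpha>: "\<alpha> \<in> cotangent_space lower_atlas (proj p)"
    "momentum lower_atlas (snd (lower_chart c)) (proj p, \<alpha>) = P"
    using covector_exists[OF smooth_atlas_lower lower_chart_in[OF c] pp] by blast
  have x: "((proj p, \<alpha>), p) \<in> fst (fib_chart c)" "((proj p, \<alpha>), p) \<in> fst (fib_chart d)"
    using p \<alpha> c d by (auto simp: fib_chart_dom full_chart_dom)
  moreover have "snd (fib_chart c) ((proj p, \<alpha>), p) = (u, P, v)"
    by (simp add: fib_chart_apply[OF c x(1)] p \<alpha>)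
  ultimately show "z \<in> ?L"
    by (intro image_eqI[of _ _ "((proj p, \<alpha>), p)"]) (auto simp: z')
qed

lemma open_fib_coords: "open S \<Longrightarrow> open {z :: ('n, 'k) fibre_coords. fst z $ index_at 0 \<in> S}"
  by (rule open_vimage[of S "\<lambda>z. fst z $ index_at 0", unfolded vimage_def]) (auto intro!: continuous_intros)

lemma smooth_transition_fib_chart:
  assumes c: "c \<in> \<A>" and d: "d \<in> \<A>"
  shows "smooth_transition (fib_chart c) (fib_chart d)"
proof -
  let ?S = "snd (fib_chart c) ` (fst (fib_chart c) \<inter> fst (fib_chart d))"
  let ?cc = "cotangent_chart lower_atlas (lower_chart c)"
  let ?cd = "cotangent_chart lower_atlas (lower_chart d)"
  have S: "open ?S"
    unfolding fib_chart_image_Int[OF c d] by (intro open_fib_coords smooth_atlas_open_Int[OF A c d])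
  have cot: "?cc \<in> cotangent_atlas lower_atlas" "?cd \<in> cotangent_atlas lower_atlas"
    using lower_chart_in c d by (auto simp: cotangent_atlas_def)
  have 1: "smooth_on ?S (\<lambda>z. local_rep ?cc (snd ?cd) (fst z, fst (snd z)))"
  proof (rule smooth_on_compose[OF S _ smooth_atlas_transition[OF smooth_atlas_cotangent[OF smooth_atlas_lower] cot]])
    show "smooth_on ?S (\<lambda>z. (fst z, fst (snd z)))"
      using S by (intro smooth_on_Pair smooth_on_fst smooth_on_snd smooth_on_id)
    fix z assume "z \<in> ?S"
    then obtain x where "z = snd (fib_chart c) x" "x \<in> fst (fib_chart c)" "x \<in> fst (fib_chart d)" by auto
    then show "(fst z, fst (snd z)) \<in> snd ?cc ` (fst ?cc \<inter> fst ?cd)"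
      using fib_chart_parts[OF c, of x] fib_chart_parts[OF d, of x] by (metis IntI imageI)
  qed
  have 2: "smooth_on ?S (\<lambda>z. local_rep (full_chart c) (snd (full_chart d)) (fst z, snd (snd z)))"
  proof (rule smooth_on_compose[OF S _ smooth_atlas_transition[OF smooth_atlas_full full_chart_in[OF c] full_chart_in[OF d]]])
    show "smooth_on ?S (\<lambda>z. (fst z, snd (snd z)))"
      using S by (intro smooth_on_Pair smooth_on_fst smooth_on_snd smooth_on_id)
    fix z assume "z \<in> ?S"
    then obtain x where "z = snd (fib_chart c) x" "x \<in> fst (fib_chart c)" "x \<in> fst (fib_chart d)" by auto
    then show "(fst z, snd (snd z)) \<in> snd (full_chart c) ` (fst (full_chart c) \<inter> fst (full_chart d))"
      using fib_chart_parts[OF c, of x] fib_chart_parts[OF d, of x] by (metis IntI imageI)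
  qed
  have "smooth_on ?S (\<lambda>z. (fst (local_rep ?cc (snd ?cd) (fst z, fst (snd z))),
      snd (local_rep ?cc (snd ?cd) (fst z, fst (snd z))),
      snd (local_rep (full_chart c) (snd (full_chart d)) (fst z, snd (snd z)))))"
    by (intro smooth_on_Pair smooth_on_fst[OF S 1] smooth_on_snd[OF S 1] smooth_on_snd[OF S 2] S)
  then have "smooth_on ?S (local_rep (fib_chart c) (snd (fib_chart d)))"
  proof (rule smooth_on_cong[OF S])
    fix z assume "z \<in> ?S"
    then obtain x where x: "z = snd (fib_chart c) x" "x \<in> fst (fib_chart c)" "x \<in> fst (fib_chart d)" by auto
    have "local_rep ?cc (snd ?cd) (fst z, fst (snd z)) = snd ?cd (fst x)"
      using local_rep_apply[OF inj_on_cotangent_chart[OF smooth_atlas_lower lower_chart_in[OF c]]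
          fib_chart_parts(1)[OF c x(2)], of "snd ?cd"]
      unfolding fib_chart_parts(3)[OF c x(2)] x(1) .
    moreover have "local_rep (full_chart c) (snd (full_chart d)) (fst z, snd (snd z)) = snd (full_chart d) (snd x)"
      using local_rep_apply[OF smooth_atlas_inj[OF smooth_atlas_full full_chart_in[OF c]]
          fib_chart_parts(2)[OF c x(2)], of "snd (full_chart d)"]
      unfolding fib_chart_parts(4)[OF c x(2)] x(1) .
    moreover have "local_rep (fib_chart c) (snd (fib_chart d)) z = snd (fib_chart d) x"
      unfolding x(1) by (rule local_rep_apply[OF inj_on_fib_chart[OF c] x(2)])
    ultimately show "(fst (local_rep ?cc (snd ?cd) (fst z, fst (snd z))),
      snd (local_rep ?cc (snd ?cd) (fst z, fst (snd z))),
      snd (local_rep (full_chart c) (snd (full_chart d)) (fst z, snd (snd z))))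
      = local_rep (fib_chart c) (snd (fib_chart d)) z"
      using fib_chart_parts(3,4)[OF d x(3)] by simp
  qed
  then show ?thesis by (simp add: smooth_transition_def)
qed

lemma smooth_atlas_fib: "smooth_atlas fib_atlas"
  unfolding smooth_atlas_def fibre_atlas_def
  using inj_on_fib_chart smooth_transition_fib_chart
  by (auto simp: fib_chart_image_Int intro!: open_fib_coords smooth_atlas_open_Int[OF A])

section \<open>The canonical immersion and the Hamiltonian in coordinates\<close>

lemma canonical_immersion_velocity:
  assumes c: "c \<in> \<A>" and p: "p \<in> fst (full_chart c)"
  shows "canonical_immersion k \<A> p \<in> tangent_space lower_atlas (points lower_atlas) (proj p)"
    and "velocity (snd (lower_chart c)) (canonical_immersion k \<A> p) = shift (snd (full_chart c) p)"
proof -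
  have ps: "p \<in> jet_space \<A> CARD('k)" "jet_base p \<in> fst c" using p by (auto simp: full_chart_dom)
  define \<gamma> where "\<gamma> = jet_curve p"
  have \<gamma>: "smooth_curve \<A> \<gamma>" "p = jet \<A> CARD('k) \<gamma>"
    using jet_jet_curve[OF ps(1)] by (auto simp: \<gamma>_def)
  have 0: "\<gamma> 0 \<in> fst c" using ps(2) by (simp add: jet_base_def \<gamma>_def)
  define \<beta> where "\<beta> = (\<lambda>t. jet \<A> (CARD('k) - 1) (\<lambda>s. \<gamma> (t + s)))"
  note pr = jet_prolongation[OF A jet_frame_lower[where 'n='n and 'k='k] \<gamma>(1) c 0, folded \<beta>_def]
  have \<beta>: "smooth_curve lower_atlas \<beta>"
    unfolding Tk1_atlas_def Tk1_chart_eq by (rule pr(1))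
  have \<beta>0: "\<beta> 0 = proj p" using jet_proj_jet[OF \<gamma>(1)] by (simp add: \<beta>_def \<gamma>(2))
  have ci: "canonical_immersion k \<A> p = jet lower_atlas 1 \<beta>"
    by (simp add: canonical_immersion_def \<beta>_def \<gamma>_def)
  show "canonical_immersion k \<A> p \<in> tangent_space lower_atlas (points lower_atlas) (proj p)"
    using \<beta> \<beta>0 by (auto simp: ci tangent_space_points)
  have "\<beta> 0 \<in> fst (lower_chart c)"
    using jet_proj_simps(3)[OF ps(1) c ps(2)] by (simp add: \<beta>0)
  then have "velocity (snd (lower_chart c)) (canonical_immersion k \<A> p)
      = vector_derivative (snd (lower_chart c) \<circ> \<beta>) (at 0)"
    unfolding ci by (rule velocity_jet[OF \<beta> lower_chart_in[OF c]])
  also have "\<dots> = (\<Sum>s\<le>CARD('k) - 1. lower_incl s (curve_deriv (Suc s) (snd c \<circ> \<gamma>) 0))"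
    unfolding Tk1_chart_eq by (rule pr(2))
  also have "\<dots> = (\<chi> r. curve_deriv (Suc (pos r)) (snd c \<circ> \<gamma>) 0)"
    unfolding lower_incl_def sum_lower by simp
  also have "\<dots> = shift (snd (full_chart c) p)"
  proof -
    have "full_coord (Suc (pos r)) (snd (full_chart c) p) = curve_deriv (Suc (pos r)) (snd c \<circ> \<gamma>) 0" for r :: 'k
      unfolding Tk_chart_eq \<gamma>(2)
      using pos_less_card[of r] by (intro jet_chart_coord[OF A jet_frame_full \<gamma>(1) c 0]) auto
    then show ?thesis by (simp add: shift_def vec_eq_iff)
  qed
  finally show "velocity (snd (lower_chart c)) (canonical_immersion k \<A> p) = shift (snd (full_chart c) p)" .
qed

lemma H_coord:
  assumes c: "c \<in> \<A>" and x: "x \<in> fst (fib_chart c)" and z: "snd (fib_chart c) x = (u, P, v)"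
  shows "H_W0 k \<A> L x = P \<bullet> shift (u, v) - local_rep (full_chart c) L (u, v)"
proof -
  let ?p = "snd x"
  have p: "?p \<in> fst (full_chart c)" and uv: "snd (full_chart c) ?p = (u, v)"
    using fib_chart_parts[OF c x] z by auto
  have y: "fst (fst x) = proj ?p" "snd (fst x) \<in> cotangent_space lower_atlas (proj ?p)"
    using x c by (auto simp: fib_chart_dom)
  have pp: "proj ?p \<in> fst (lower_chart c)"
    using jet_proj_simps(3)[of ?p c] p c by (simp add: full_chart_dom)
  have "snd (fst x) (canonical_immersion k \<A> ?p)
      = momentum lower_atlas (snd (lower_chart c)) (proj ?p, snd (fst x)) \<bullet> shift (u, v)"
    using momentum_apply[OF smooth_atlas_lower lower_chart_in[OF c] pp y(2)
        canonical_immersion_velocity(1)[OF c p]]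
    by (simp add: canonical_immersion_velocity(2)[OF c p, simplified] uv)
  moreover have "momentum lower_atlas (snd (lower_chart c)) (proj ?p, snd (fst x)) = P"
    using z fib_chart_apply[OF c x] y(1) by (metis Pair_inject prod.collapse)
  moreover have "local_rep (full_chart c) L (u, v) = L ?p"
    using local_rep_apply[OF smooth_atlas_inj[OF smooth_atlas_full full_chart_in[OF c]] p, of L]
    by (simp add: uv)
  ultimately show ?thesis
    by (simp add: H_W0_def case_prod_beta)
qed

end

section \<open>Matrices of full rank and bordered matrices\<close>

text \<open>The form in which the rank condition is used from here on: the rows, as functionals,
  attain every tuple of values.\<close>

lemma full_rank_rows_surj:
  fixes b :: "'m::finite \<Rightarrow> real^'n"
  assumes "rank (\<chi> \<alpha> i. b \<alpha> $ i :: real^'n^'m) = CARD('m)"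
  shows "\<exists>x. \<forall>\<alpha>. b \<alpha> \<bullet> x = y $ \<alpha>"
proof -
  obtain x where "y = (\<chi> \<alpha> i. b \<alpha> $ i) *v x"
    using assms unfolding full_rank_surjective by (metis surjD)
  then have "\<forall>\<alpha>. b \<alpha> \<bullet> x = y $ \<alpha>"
    by (simp add: matrix_vector_mult_def inner_vec_def)
  then show ?thesis by blast
qed

context
  fixes b :: "'m::finite \<Rightarrow> real^'n"
  assumes surj: "\<And>y :: real^'m. \<exists>x. \<forall>\<alpha>. b \<alpha> \<bullet> x = y $ \<alpha>"
begin

lemma dual_rows:
  obtains c :: "'m \<Rightarrow> real^'n" where "\<And>\<alpha> \<beta>. b \<alpha> \<bullet> c \<beta> = (if \<alpha> = \<beta> then 1 else 0)"
proof -
  have "\<exists>x. \<forall>\<alpha>. b \<alpha> \<bullet> x = (if \<alpha> = \<beta> then 1 else 0)" for \<beta>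
    using surj[of "axis \<beta> 1"] by (simp add: axis_def eq_commute)
  then show ?thesis using that by metis
qed

lemma rows_independent:
  assumes "(\<Sum>\<alpha>\<in>UNIV. l $ \<alpha> *\<^sub>R b \<alpha>) = 0"
  shows "(l :: real^'m) = 0"
proof -
  \<comment> \<open>On a vector x at which the rows take the values l, the vanishing combination
    evaluates to the squared norm of l.\<close>
  obtain x where x: "\<And>\<alpha>. b \<alpha> \<bullet> x = l $ \<alpha>" using surj by blast
  have "0 = (\<Sum>\<alpha>\<in>UNIV. l $ \<alpha> *\<^sub>R b \<alpha>) \<bullet> x" using assms by simp
  also have "\<dots> = (\<Sum>\<alpha>\<in>UNIV. l $ \<alpha> * l $ \<alpha>)" by (simp add: inner_sum_left x)
  also have "\<dots> = l \<bullet> l" by (simp add: inner_vec_def)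
  finally show ?thesis by simp
qed

text \<open>The linear algebra of Lagrange multipliers: subtracting from w its components along a
  dual basis leaves a vector annihilated by all rows, so X is determined by its values on the dual
  basis, and these are the coefficients.\<close>

lemma orthogonal_to_kernel_imp_row_combination:
  assumes "\<And>w. (\<And>\<alpha>. b \<alpha> \<bullet> w = 0) \<Longrightarrow> X \<bullet> w = 0"
  obtains l :: "real^'m" where "X = (\<Sum>\<alpha>\<in>UNIV. l $ \<alpha> *\<^sub>R b \<alpha>)"
proof -
  obtain c where c: "\<And>\<alpha> \<beta>. b \<alpha> \<bullet> c \<beta> = (if \<alpha> = \<beta> then 1 else 0)"
    using dual_rows by blast
  define l where "l = (\<chi> \<beta>. X \<bullet> c \<beta>)"
  have "X \<bullet> w = (\<Sum>\<alpha>\<in>UNIV. l $ \<alpha> *\<^sub>R b \<alpha>) \<bullet> w" for w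
  proof -
    have "X \<bullet> (w - (\<Sum>\<beta>\<in>UNIV. (b \<beta> \<bullet> w) *\<^sub>R c \<beta>)) = 0"
      by (rule assms) (simp add: inner_diff_right inner_sum_right c if_distrib[of "times _"] cong: if_cong)
    then show ?thesis
      by (simp add: inner_diff_right inner_sum_right inner_sum_left l_def mult.commute)
  qed
  then have "X = (\<Sum>\<alpha>\<in>UNIV. l $ \<alpha> *\<^sub>R b \<alpha>)"
    by (metis vector_eq_ldot inner_commute)
  then show ?thesis using that by blast
qed

text \<open>Pairing with a dual basis bounds the coefficients \<open>\<mu>\<close> linearly in t; this replaces
  differentiability of the multipliers along the curve.\<close>

lemma derivative_orthogonal_to_kernel:
  fixes r :: "real \<Rightarrow> 'm \<Rightarrow> real^'n"
  assumes X: "(X has_vector_derivative X') (at 0)" "X 0 = 0"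
    and r: "\<And>\<alpha>. isCont (\<lambda>t. r t \<alpha>) 0" "\<And>\<alpha>. r 0 \<alpha> = b \<alpha>"
    and comb: "\<forall>\<^sub>F t in at 0. X t = (\<Sum>\<alpha>\<in>UNIV. \<mu> t \<alpha> *\<^sub>R r t \<alpha>)"
    and w: "\<And>\<alpha>. b \<alpha> \<bullet> w = 0"
  shows "X' \<bullet> w = 0"
proof -
  obtain c where c: "\<And>\<alpha> \<beta>. b \<alpha> \<bullet> c \<beta> = (if \<alpha> = \<beta> then 1 else 0)"
    using dual_rows by blast
  have lim: "((\<lambda>t. (X t \<bullet> v) / t) \<longlongrightarrow> X' \<bullet> v) (at 0)" for v
  proof -
    have "((\<lambda>t. X t \<bullet> v) has_real_derivative X' \<bullet> v) (at 0)"
      using bounded_linear.has_vector_derivative[OF bounded_linear_inner_left X(1)]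
      by (simp add: has_real_derivative_iff_has_vector_derivative)
    then show ?thesis
      using X(2) by (simp add: has_field_derivative_def DERIV_def flip: has_field_derivative_def)
  qed
  have rlim: "((\<lambda>t. r t \<alpha> \<bullet> v) \<longlongrightarrow> b \<alpha> \<bullet> v) (at 0)" for \<alpha> v
    using r(1)[of \<alpha>] unfolding isCont_def r(2) by (intro tendsto_intros)
  \<comment> \<open>The total deviation of the pairings of \<open>r t \<alpha>\<close> with the dual
    basis from their values at 0; it tends to 0 by continuity.\<close>
  define E where "E = (\<lambda>t. \<Sum>\<beta>\<in>UNIV. \<Sum>\<alpha>\<in>UNIV. \<bar>(r t \<alpha> - b \<alpha>) \<bullet> c \<beta>\<bar>)"
  have "(E \<longlongrightarrow> (\<Sum>\<beta>\<in>UNIV. \<Sum>\<alpha>\<in>UNIV. \<bar>b \<alpha> \<bullet> c \<beta> - b \<alpha> \<bullet> c \<beta>\<bar>)) (at 0)"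
    unfolding E_def inner_diff_left by (intro tendsto_intros rlim)
  then have "(E \<longlongrightarrow> 0) (at 0)" by simp
  then have "\<forall>\<^sub>F t in at 0. E t < 1 / 2"
    by (rule order_tendstoD) simp
  with comb have bound: "\<forall>\<^sub>F t in at 0. \<bar>(X t \<bullet> w) / t\<bar>
      \<le> 2 * (\<Sum>\<beta>\<in>UNIV. \<bar>(X t \<bullet> c \<beta>) / t\<bar>) * (\<Sum>\<alpha>\<in>UNIV. \<bar>r t \<alpha> \<bullet> w\<bar>)"
  proof eventually_elim
    case (elim t)
    define n where "n = (\<Sum>\<alpha>\<in>UNIV. \<bar>\<mu> t \<alpha>\<bar>)"
    have mu_le: "\<bar>\<mu> t \<alpha>\<bar> \<le> n" for \<alpha>
      unfolding n_def by (rule member_le_sum) auto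
    have n0: "n \<ge> 0" unfolding n_def by (intro sum_nonneg) auto
    have est: "\<bar>\<mu> t \<beta>\<bar> \<le> \<bar>X t \<bullet> c \<beta>\<bar> + n * (\<Sum>\<alpha>\<in>UNIV. \<bar>(r t \<alpha> - b \<alpha>) \<bullet> c \<beta>\<bar>)" for \<beta>
    proof -
      have "X t \<bullet> c \<beta> = (\<Sum>\<alpha>\<in>UNIV. \<mu> t \<alpha> * (b \<alpha> \<bullet> c \<beta>)) + (\<Sum>\<alpha>\<in>UNIV. \<mu> t \<alpha> * ((r t \<alpha> - b \<alpha>) \<bullet> c \<beta>))"
        unfolding elim(1) by (simp add: inner_sum_left inner_diff_left algebra_simps sum_subtractf)
      moreover have "(\<Sum>\<alpha>\<in>UNIV. \<mu> t \<alpha> * (b \<alpha> \<bullet> c \<beta>)) = \<mu> t \<beta>"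
        by (simp add: c if_distrib[of "times _"] cong: if_cong)
      moreover have "\<bar>\<Sum>\<alpha>\<in>UNIV. \<mu> t \<alpha> * ((r t \<alpha> - b \<alpha>) \<bullet> c \<beta>)\<bar> \<le> n * (\<Sum>\<alpha>\<in>UNIV. \<bar>(r t \<alpha> - b \<alpha>) \<bullet> c \<beta>\<bar>)"
        unfolding sum_distrib_left
        by (rule order.trans[OF sum_abs]) (auto intro!: sum_mono mult_right_mono mu_le simp: abs_mult)
      ultimately show ?thesis by linarith
    qed
    \<comment> \<open>Summing the estimates bounds n by the pairings of \<open>X t\<close> plus n
      times \<open>E t\<close>. With \<open>E t\<close> below 1/2, half of n is absorbed on the
      left, which produces the factor 2.\<close>
    have "n \<le> (\<Sum>\<beta>\<in>UNIV. \<bar>X t \<bullet> c \<beta>\<bar> + n * (\<Sum>\<alpha>\<in>UNIV. \<bar>(r t \<alpha> - b \<alpha>) \<bullet> c \<beta>\<bar>))"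
      unfolding n_def[of] using est by (intro sum_mono) (simp add: n_def)
    also have "\<dots> = (\<Sum>\<beta>\<in>UNIV. \<bar>X t \<bullet> c \<beta>\<bar>) + n * E t"
      by (simp add: sum.distrib E_def flip: sum_distrib_left)
    also have "\<dots> \<le> (\<Sum>\<beta>\<in>UNIV. \<bar>X t \<bullet> c \<beta>\<bar>) + n * (1 / 2)"
      using elim(2) n0 by (intro add_left_mono mult_left_mono) auto
    finally have n: "n \<le> 2 * (\<Sum>\<beta>\<in>UNIV. \<bar>X t \<bullet> c \<beta>\<bar>)" by simp
    have "\<bar>X t \<bullet> w\<bar> \<le> (\<Sum>\<alpha>\<in>UNIV. \<bar>\<mu> t \<alpha>\<bar> * \<bar>r t \<alpha> \<bullet> w\<bar>)"
      unfolding elim(1) inner_sum_left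
      by (rule order.trans[OF sum_abs]) (simp add: abs_mult)
    also have "\<dots> \<le> n * (\<Sum>\<alpha>\<in>UNIV. \<bar>r t \<alpha> \<bullet> w\<bar>)"
      unfolding sum_distrib_left by (intro sum_mono mult_right_mono mu_le) auto
    also have "\<dots> \<le> 2 * (\<Sum>\<beta>\<in>UNIV. \<bar>X t \<bullet> c \<beta>\<bar>) * (\<Sum>\<alpha>\<in>UNIV. \<bar>r t \<alpha> \<bullet> w\<bar>)"
      by (rule mult_right_mono[OF n]) (auto intro: sum_nonneg)
    finally have "\<bar>X t \<bullet> w\<bar> / \<bar>t\<bar> \<le> (2 * (\<Sum>\<beta>\<in>UNIV. \<bar>X t \<bullet> c \<beta>\<bar>) * (\<Sum>\<alpha>\<in>UNIV. \<bar>r t \<alpha> \<bullet> w\<bar>)) / \<bar>t\<bar>"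
      by (rule divide_right_mono) simp
    also have "\<dots> = 2 * (\<Sum>\<beta>\<in>UNIV. \<bar>(X t \<bullet> c \<beta>) / t\<bar>) * (\<Sum>\<alpha>\<in>UNIV. \<bar>r t \<alpha> \<bullet> w\<bar>)"
      by (simp add: abs_divide flip: sum_divide_distrib)
    finally show ?case by (simp add: abs_divide)
  qed
  \<comment> \<open>The first sum converges because X vanishes at 0 and is differentiable there; the
    second tends to 0 because w is annihilated by the rows at 0.\<close>
  have "((\<lambda>t. 2 * (\<Sum>\<beta>\<in>UNIV. \<bar>(X t \<bullet> c \<beta>) / t\<bar>) * (\<Sum>\<alpha>\<in>UNIV. \<bar>r t \<alpha> \<bullet> w\<bar>)) \<longlongrightarrow>
      2 * (\<Sum>\<beta>\<in>UNIV. \<bar>X' \<bullet> c \<beta>\<bar>) * (\<Sum>\<alpha>\<in>UNIV. \<bar>b \<alpha> \<bullet> w\<bar>)) (at 0)"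
    by (intro tendsto_intros lim rlim)
  then have "((\<lambda>t. 2 * (\<Sum>\<beta>\<in>UNIV. \<bar>(X t \<bullet> c \<beta>) / t\<bar>) * (\<Sum>\<alpha>\<in>UNIV. \<bar>r t \<alpha> \<bullet> w\<bar>)) \<longlongrightarrow> 0) (at 0)"
    by (simp add: w)
  from tendsto_le[OF _ this tendsto_rabs[OF lim[of w]] bound] have "\<bar>X' \<bullet> w\<bar> \<le> 0"
    by simp
  then show ?thesis by simp
qed

end

section \<open>Bordered matrices as block systems\<close>

definition join :: "real^'n \<Rightarrow> real^'m \<Rightarrow> real^('n::finite + 'm::finite)" where
  "join w l = (\<chi> a. case a of Inl i \<Rightarrow> w $ i | Inr \<alpha> \<Rightarrow> l $ \<alpha>)"

lemma join_exists: "\<exists>w l. x = join w l"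
  by (rule exI[of _ "\<chi> i. x $ Inl i"], rule exI[of _ "\<chi> \<alpha>. x $ Inr \<alpha>"])
    (simp add: join_def vec_eq_iff split: sum.split)

lemma join_eq_iff: "join w l = join w' l' \<longleftrightarrow> w = w' \<and> l = l'"
  by (auto simp: join_def vec_eq_iff split: sum.split)

lemma sum_UNIV_sum:
  "(\<Sum>a\<in>(UNIV :: ('n::finite + 'm::finite) set). f a) = (\<Sum>i\<in>UNIV. f (Inl i)) + (\<Sum>\<alpha>\<in>UNIV. f (Inr \<alpha>))"
  unfolding UNIV_sum by (subst sum.union_disjoint) (auto simp: sum.reindex)

lemma bordered_matrix_mult:
  "bordered_matrix A B *v join w l = join
     (\<chi> i. (\<Sum>j\<in>UNIV. A i j * w $ j) - (\<Sum>\<alpha>\<in>UNIV. l $ \<alpha> * B \<alpha> i)) (\<chi> \<beta>. \<Sum>j\<in>UNIV. B \<beta> j * w $ j)"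
  by (simp add: bordered_matrix_def join_def matrix_vector_mult_def vec_eq_iff sum_UNIV_sum sum_negf
      mult.commute split: sum.split)

lemma bordered_matrix_solvable:
  assumes "det (bordered_matrix A B :: real^('n::finite + 'm::finite)^('n + 'm)) \<noteq> 0"
  obtains w :: "real^'n" and l :: "real^'m"
  where "\<And>i. (\<Sum>j\<in>UNIV. A i j * w $ j) - (\<Sum>\<alpha>\<in>UNIV. l $ \<alpha> * B \<alpha> i) = f i"
    "\<And>\<beta>. (\<Sum>j\<in>UNIV. B \<beta> j * w $ j) = g \<beta>"
proof -
  let ?N = "bordered_matrix A B :: real^('n + 'm)^('n + 'm)"
  obtain N' where "?N ** N' = mat 1"
    using assms invertible_det_nz[of ?N] by (auto simp: invertible_def)
  then have "?N *v (N' *v join (\<chi> i. f i) (\<chi> \<beta>. g \<beta>)) = join (\<chi> i. f i) (\<chi> \<beta>. g \<beta>)"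
    by (simp add: matrix_vector_mul_assoc)
  moreover obtain w l where "N' *v join (\<chi> i. f i) (\<chi> \<beta>. g \<beta>) = join w l"
    using join_exists by blast
  ultimately have "?N *v join w l = join (\<chi> i. f i) (\<chi> \<beta>. g \<beta>)" by simp
  then show ?thesis
    unfolding bordered_matrix_mult join_eq_iff by (intro that[of w l]) (simp_all add: vec_eq_iff)
qed

lemma bordered_matrix_kernel:
  "det (bordered_matrix A B :: real^('n::finite + 'm::finite)^('n + 'm)) = 0 \<longleftrightarrow>
    (\<exists>(w :: real^'n) (l :: real^'m). (w \<noteq> 0 \<or> l \<noteq> 0) \<and>
      (\<forall>i. (\<Sum>j\<in>UNIV. A i j * w $ j) - (\<Sum>\<alpha>\<in>UNIV. l $ \<alpha> * B \<alpha> i) = 0) \<and>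
      (\<forall>\<beta>. (\<Sum>j\<in>UNIV. B \<beta> j * w $ j) = 0))"
proof -
  let ?N = "bordered_matrix A B :: real^('n + 'm)^('n + 'm)"
  have z: "(0 :: real^('n + 'm)) = join 0 0"
    by (simp add: join_def vec_eq_iff split: sum.split)
  have "det ?N = 0 \<longleftrightarrow> (\<exists>x. ?N *v x = 0 \<and> x \<noteq> 0)"
    using invertible_det_nz[of ?N] by (metis invertible_left_inverse matrix_left_invertible_ker)
  also have "\<dots> \<longleftrightarrow> (\<exists>w l. ?N *v join w l = 0 \<and> join w l \<noteq> (0 :: real^('n + 'm)))"
    by (metis join_exists)
  finally show ?thesis
    unfolding bordered_matrix_mult z join_eq_iff by (auto simp: vec_eq_iff)
qed

section \<open>Curves in level sets\<close>

text \<open>The curve is asserted to have the prescribed velocity at 0 only;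
  \<open>smooth_curve_in_slice\<close> turns it into a smooth curve.\<close>

lemma curve_in_level_set:
  fixes F :: "'a::euclidean_space \<Rightarrow> 'b::euclidean_space"
  assumes O: "open O'" "z \<in> O'" and F: "smooth_on O' F" "F z = 0"
    and surj: "surj (frechet_derivative F (at z))" and w: "frechet_derivative F (at z) w = 0"
  obtains h e where "e > 0" "h 0 = z" "(h has_vector_derivative w) (at 0)"
    "\<And>t. t \<in> {-e<..<e} \<Longrightarrow> h t \<in> O' \<and> F (h t) = 0"
proof -
  let ?D = "frechet_derivative F (at z)"
  have D: "linear ?D" by (rule smooth_on_derivative_linear[OF F(1) O(2)])
  obtain C where C: "linear C" "?D \<circ> C = id"
    using linear_surjective_right_inverse[OF D surj] by blast
  have CD: "?D (C y) = y" for y using C(2) by (metis comp_apply id_apply)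
  have bl: "bounded_linear ?D" "bounded_linear C"
    using D C(1) by (simp_all add: linear_conv_bounded_linear)
  \<comment> \<open>With D the derivative of F at z and C a right inverse of D, the map f has the
    identity as derivative at 0 and satisfies D (f x) = F (z + x). Its local inverse therefore sends
    kernel vectors of D to zeros of F shifted by z.\<close>
  define f where "f = (\<lambda>x. x - C (?D x) + C (F (z + x)))"
  define U where "U = (\<lambda>x. z + x) -` O'"
  have U: "open U" unfolding U_def using O(1) by (intro open_vimage) (auto intro!: continuous_intros)
  have fs: "smooth_on U f"
    unfolding f_def
    by (intro smooth_on_add smooth_on_diff U smooth_on_id smooth_on_linear_compose[OF _ bl(2)]
        smooth_on_linear_compose[OF _ bl(1)] smooth_on_compose[OF U _ F(1)] smooth_on_const)
      (auto simp: U_def)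
  define f' where "f' = (\<lambda>x. Blinfun (frechet_derivative f (at x)))"
  have f': "blinfun_apply (f' x) = frechet_derivative f (at x)" if "x \<in> U" for x
    unfolding f'_def
    using smooth_on_derivative_linear[OF fs that] by (simp add: bounded_linear_Blinfun_apply linear_conv_bounded_linear)
  have f0: "f 0 = 0"
    using F(2) linear_0[OF D] linear_0[OF C(1)] by (simp add: f_def)
  have zU: "0 \<in> U" using O(2) by (simp add: U_def)
  have "(f has_derivative (\<lambda>x. x - C (?D x) + C (?D x))) (at 0)"
  proof -
    have "((\<lambda>x. F (z + x)) has_derivative ?D) (at 0)"
    proof -
      have 1: "((\<lambda>x. z + x) has_derivative (\<lambda>x. x)) (at 0)"
        by (auto intro!: derivative_eq_intros)
      have 2: "(F has_derivative ?D) (at (z + 0))"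
        using smooth_on_has_derivative[OF F(1) O(2)] by simp
      show ?thesis using diff_chain_at[OF 1 2] by (simp add: o_def)
    qed
    then show ?thesis
      unfolding f_def
      by (intro has_derivative_add has_derivative_diff has_derivative_ident
          bounded_linear.has_derivative[OF bl(2)] bounded_linear.has_derivative[OF bl(1)])
  qed
  then have fd0: "frechet_derivative f (at 0) = (\<lambda>x. x)"
    by (simp add: frechet_derivative_eqI)
  obtain U' V g g' where inv: "open U'" "U' \<subseteq> U" "0 \<in> U'" "open V" "0 \<in> V" "homeomorphism U' V f g"
    "\<And>y. y \<in> V \<Longrightarrow> (g has_derivative (g' y)) (at y)"
    "\<And>y. y \<in> V \<Longrightarrow> g' y = inv (blinfun_apply (f' (g y)))"
    "\<And>y. y \<in> V \<Longrightarrow> bij (blinfun_apply (f' (g y)))"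
  proof (rule inverse_function_theorem_scaled[where U=U and f=f and f'=f'])
    show "(f has_derivative blinfun_apply (f' x)) (at x)" if "x \<in> U" for x
      using smooth_on_has_derivative[OF fs that] by (simp add: f'[OF that])
    show "continuous_on U f'"
    \<comment> \<open>The inverse function theorem asks for continuity in the operator norm; in
      finite dimension this reduces to basis directions, where smoothness provides it.\<close>
    proof (rule continuous_on_blinfun_componentwise)
      fix i :: 'a assume "i \<in> Basis"
      have "continuous_on U (\<lambda>x. frechet_derivative f (at x) i)"
        by (intro smooth_on_continuous_on smooth_on_derivative fs)
      then show "continuous_on U (\<lambda>x. blinfun_apply (f' x) i)"
        by (rule continuous_on_eq) (simp add: f')
    qed
    show "f' 0 = id_blinfun"
      using f'[OF zU] fd0 by (intro blinfun_eqI) simp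
  qed (use U zU f0 in blast)+
  have g0: "g 0 = 0"
    using homeomorphism_apply1[OF inv(6,3)] f0 by simp
  have "g' 0 = (\<lambda>x. x)"
    using inv(8)[OF inv(5)] f'[OF zU] fd0 by (simp add: g0 inv_equality)
  then have gd: "(g has_derivative (\<lambda>x. x)) (at 0)"
    using inv(7)[OF inv(5)] by simp
  define h where "h = (\<lambda>t::real. z + g (t *\<^sub>R w))"
  have "open ((\<lambda>t::real. t *\<^sub>R w) -` V)"
    using inv(4) by (intro open_vimage) (auto intro!: continuous_intros)
  then obtain e where e: "e > 0" "{-e<..<e} \<subseteq> (\<lambda>t::real. t *\<^sub>R w) -` V"
    using inv(5) by (elim open_interval_subset) auto
  have hd: "(h has_vector_derivative w) (at 0)"
  proof -
    have 1: "((\<lambda>t::real. t *\<^sub>R w) has_derivative (\<lambda>t. t *\<^sub>R w)) (at 0)"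
      by (auto intro!: derivative_eq_intros)
    have 2: "(g has_derivative (\<lambda>x. x)) (at (0 *\<^sub>R w))" using gd by simp
    have "((\<lambda>t. g (t *\<^sub>R w)) has_derivative (\<lambda>t. t *\<^sub>R w)) (at 0)"
      using diff_chain_at[OF 1 2] by (simp add: o_def)
    then show ?thesis
      unfolding h_def has_vector_derivative_def by (auto intro!: derivative_eq_intros)
  qed
  have "h t \<in> O' \<and> F (h t) = 0" if "t \<in> {-e<..<e}" for t
  proof -
    have tV: "t *\<^sub>R w \<in> V" using e that by auto
    have gU: "g (t *\<^sub>R w) \<in> U'" using homeomorphism_image2[OF inv(6)] tV by blast
    then have "h t \<in> O'" using inv(2) by (auto simp: h_def U_def)
    have "f (g (t *\<^sub>R w)) = t *\<^sub>R w" by (rule homeomorphism_apply2[OF inv(6) tV])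
    then have "?D (f (g (t *\<^sub>R w))) = 0" using w by (simp add: linear_cmul[OF D])
    then have "F (h t) = 0"
      unfolding f_def h_def by (simp add: linear_add[OF D] linear_diff[OF D] CD)
    with \<open>h t \<in> O'\<close> show ?thesis by blast
  qed
  then show ?thesis
    using that[of e h] e(1) hd by (simp add: h_def g0)
qed

text \<open>The difference quotients lie in P, and a subspace of a finite-dimensional space is
  closed.\<close>

lemma subspace_vector_derivative:
  assumes P: "subspace P" and f: "(f has_vector_derivative D) (at (0::real))"
    and ev: "\<forall>\<^sub>F t in at 0. f t - f 0 \<in> P"
  shows "D \<in> (P :: 'a::euclidean_space set)"
proof -
  have "((\<lambda>t. (f t - (f 0 + t *\<^sub>R D)) /\<^sub>R norm t) \<longlongrightarrow> 0) (at 0)"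
    using f by (simp add: has_vector_derivative_def has_derivative_within inverse_eq_divide)
  then have "((\<lambda>t. norm ((f t - (f 0 + t *\<^sub>R D)) /\<^sub>R norm t)) \<longlongrightarrow> 0) (at 0)"
    by (rule tendsto_norm_zero)
  then have "((\<lambda>t. norm ((f t - f 0) /\<^sub>R t - D)) \<longlongrightarrow> 0) (at 0)"
  proof (rule Lim_transform_eventually)
    show "\<forall>\<^sub>F t in at 0. norm ((f t - (f 0 + t *\<^sub>R D)) /\<^sub>R norm t) = norm ((f t - f 0) /\<^sub>R t - D)"
      unfolding eventually_at_filter
    proof (intro always_eventually allI impI)
      fix t :: real assume "t \<noteq> 0"
      then have "(f t - f 0) /\<^sub>R t - D = (f t - (f 0 + t *\<^sub>R D)) /\<^sub>R t"
        by (simp add: algebra_simps)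
      then show "norm ((f t - (f 0 + t *\<^sub>R D)) /\<^sub>R norm t) = norm ((f t - f 0) /\<^sub>R t - D)"
        by simp
    qed
  qed
  then have lim: "((\<lambda>t. (f t - f 0) /\<^sub>R t) \<longlongrightarrow> D) (at 0)"
    using LIM_zero_cancel tendsto_norm_zero_iff by blast
  have "\<forall>\<^sub>F t in at 0. (f t - f 0) /\<^sub>R t \<in> P"
    using ev by eventually_elim (rule subspace_scale[OF P])
  then show ?thesis
    by (rule Lim_in_closed_set[OF closed_subspace[OF P] _ _ lim]) simp
qed

text \<open>Flattening sends the velocity of h into P, because h runs in S. The straight line in
  that direction stays in P, and its preimage is a smooth curve in S with the same velocity.\<close>

lemma smooth_curve_in_slice:
  fixes S :: "'a::euclidean_space set"
  assumes sl: "slice S D \<Psi> P" and z: "z \<in> D" "z \<in> S"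
    and h: "(h has_vector_derivative w) (at 0)" "h 0 = z" "\<forall>\<^sub>F t in at 0. h t \<in> S"
  obtains g e where "e > 0" "g 0 = z" "smooth_on {-e<..<e} g" "vector_derivative g (at 0) = w"
    "\<And>t. t \<in> {-e<..<e} \<Longrightarrow> g t \<in> S \<inter> D"
proof -
  have D: "open D" "open (\<Psi> ` D)" "inj_on \<Psi> D" "smooth_on D \<Psi>" "smooth_on (\<Psi> ` D) (inv_into D \<Psi>)"
    "subspace P" "\<Psi> ` (S \<inter> D) = P \<inter> \<Psi> ` D"
    using sl by (auto simp: slice_def)
  define a where "a = frechet_derivative \<Psi> (at z) w"
  have \<Psi>z: "(\<Psi> has_derivative frechet_derivative \<Psi> (at z)) (at z)"
    by (rule smooth_on_has_derivative[OF D(4) z(1)])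
  have der: "((\<lambda>t. \<Psi> (h t)) has_vector_derivative a) (at 0)"
    using vector_derivative_diff_chain_within[OF h(1), of \<Psi>] \<Psi>z
    by (simp add: h(2) o_def a_def has_derivative_at_withinI)
  have "isCont h 0" using h(1) has_vector_derivative_continuous by blast
  then have "\<forall>\<^sub>F t in at 0. h t \<in> D"
    using D(1) z(1) h(2) by (metis isCont_def topological_tendstoD)
  with h(3) have "\<forall>\<^sub>F t in at 0. \<Psi> (h t) - \<Psi> (h 0) \<in> P"
  proof eventually_elim
    case (elim t)
    have "\<Psi> (h t) \<in> P" "\<Psi> (h 0) \<in> P" using elim z h(2) D(7) by blast+
    then show ?case by (rule subspace_diff[OF D(6)])
  qed
  then have aP: "a \<in> P" by (rule subspace_vector_derivative[OF D(6) der])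
  have \<Psi>zP: "\<Psi> z \<in> P" "\<Psi> z \<in> \<Psi> ` D" using z D(7) by blast+
  let ?l = "\<lambda>t::real. \<Psi> z + t *\<^sub>R a"
  have "open (?l -` (\<Psi> ` D))"
    using D(2) by (intro open_vimage) (auto intro!: continuous_intros)
  then obtain e where e: "e > 0" "{-e<..<e} \<subseteq> ?l -` (\<Psi> ` D)"
    using \<Psi>zP by (elim open_interval_subset) auto
  define g where "g = (\<lambda>t. inv_into D \<Psi> (?l t))"
  have g0: "g 0 = z" using D(3) z(1) by (simp add: g_def)
  have l: "smooth_on {-e<..<e} ?l"
    by (intro smooth_on_add smooth_on_const smooth_on_scaleR smooth_on_id) auto
  have gs: "smooth_on {-e<..<e} g"
    unfolding g_def by (rule smooth_on_compose[OF _ l D(5)]) (use e in auto)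
  have in_S: "g t \<in> S \<inter> D" if "t \<in> {-e<..<e}" for t
  proof -
    have "?l t \<in> P \<inter> \<Psi> ` D"
      using e that \<Psi>zP aP D(6) by (auto intro: subspace_add subspace_scale)
    then obtain y where "?l t = \<Psi> y" "y \<in> S \<inter> D" unfolding D(7)[symmetric] by (rule imageE)
    moreover from this have "g t = y"
      using D(3) by (metis IntD2 g_def inv_into_f_f)
    ultimately show ?thesis by simp
  qed
  have "(g has_vector_derivative w) (at 0)"
  proof -
    have inv: "(inv_into D \<Psi> has_derivative frechet_derivative (inv_into D \<Psi>) (at (\<Psi> z))) (at (\<Psi> z))"
      by (rule smooth_on_has_derivative[OF D(5) \<Psi>zP(2)])
    have "(inv_into D \<Psi> \<circ> \<Psi> has_derivative frechet_derivative (inv_into D \<Psi>) (at (\<Psi> z)) \<circ> frechet_derivative \<Psi> (at z)) (at z)"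
      by (rule diff_chain_at[OF \<Psi>z inv])
    then have "((\<lambda>x. x) has_derivative frechet_derivative (inv_into D \<Psi>) (at (\<Psi> z)) \<circ> frechet_derivative \<Psi> (at z)) (at z)"
      by (rule has_derivative_transform_within_open[OF _ D(1) z(1)]) (simp add: D(3))
    then have "frechet_derivative (inv_into D \<Psi>) (at (\<Psi> z)) \<circ> frechet_derivative \<Psi> (at z) = (\<lambda>x. x)"
      using has_derivative_ident has_derivative_unique by blast
    then have "frechet_derivative (inv_into D \<Psi>) (at (\<Psi> z)) a = w"
      unfolding a_def by (metis comp_apply)
    moreover have "(?l has_vector_derivative a) (at 0)"
      by (auto intro!: derivative_eq_intros)
    moreover have "(inv_into D \<Psi> has_derivative frechet_derivative (inv_into D \<Psi>) (at (\<Psi> z))) (at (?l 0) within range ?l)"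
      using inv by (simp add: has_derivative_at_withinI)
    ultimately show ?thesis
      using vector_derivative_diff_chain_within[of ?l a 0 UNIV "inv_into D \<Psi>"
          "frechet_derivative (inv_into D \<Psi>) (at (\<Psi> z))"]
      by (simp add: g_def o_def)
  qed
  then show ?thesis
    using that[OF e(1) g0 gs _ in_S] vector_derivative_at by blast
qed

section \<open>The constraint sets in coordinates\<close>

text \<open>\<open>differential\<close> and \<open>pullback\<close> evaluate on a representative
  chosen inside S. It may differ from the given curve but has the same 1-jet, so velocities computed
  from either agree.\<close>

lemma curve_in_jet:
  assumes "smooth_curve \<A> \<gamma>" "near0 \<gamma> S"
  defines "\<gamma>' \<equiv> curve_in S (jet \<A> 1 \<gamma>)"
  shows "smooth_curve \<A> \<gamma>'" "near0 \<gamma>' S" "contact \<A> 1 \<gamma> \<gamma>'" "\<gamma>' 0 = \<gamma> 0"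
    "jet \<A> 1 \<gamma>' = jet \<A> 1 \<gamma>"
proof -
  have "\<gamma> \<in> jet \<A> 1 \<gamma> \<and> near0 \<gamma> S"
    using assms(1,2) contact_refl by (simp add: in_jet)
  then have "\<gamma>' \<in> jet \<A> 1 \<gamma> \<and> near0 \<gamma>' S"
    unfolding \<gamma>'_def curve_in_def by (rule someI[of "\<lambda>c. c \<in> jet \<A> 1 \<gamma> \<and> near0 c S"])
  then show "smooth_curve \<A> \<gamma>'" "near0 \<gamma>' S" and *: "contact \<A> 1 \<gamma> \<gamma>'"
    by (auto simp: in_jet)
  from * show "\<gamma>' 0 = \<gamma> 0" "jet \<A> 1 \<gamma>' = jet \<A> 1 \<gamma>"
    using jet_cong[OF *] by (auto simp: contact_def)
qed

lemma near0_0: "near0 \<gamma> S \<Longrightarrow> \<gamma> 0 \<in> S"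
  by (auto simp: near0_def)

lemma near0_mono: "near0 \<gamma> S \<Longrightarrow> S \<subseteq> T \<Longrightarrow> near0 \<gamma> T"
  unfolding near0_def by blast

lemma velocity_has_vector_derivative:
  assumes "smooth_atlas \<A>" "smooth_curve \<A> \<gamma>" "c \<in> \<A>" "\<gamma> 0 \<in> fst c"
  shows "((snd c \<circ> \<gamma>) has_vector_derivative vector_derivative (snd c \<circ> \<gamma>) (at 0)) (at 0)"
proof -
  obtain e where "e > 0" "smooth_on {-e<..<e} (snd c \<circ> \<gamma>)"
    using smooth_curve_in_chart[OF assms] by blast
  then show ?thesis by (intro smooth_on_has_vector_derivative) auto
qed

section \<open>Coordinates on the fibre product and derivatives along q^(k)\<close>

text \<open>The projection to T^(k)Q in coordinates; \<open>base_mom\<close> is the one to the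
  cotangent bundle.\<close>

definition base_top :: "('n::finite, 'k::finite) fibre_coords \<Rightarrow> ('n, 'k) jet_coords" where
  "base_top z = (fst z, snd (snd z))"

definition base_mom :: "('n::finite, 'k::finite) fibre_coords \<Rightarrow> ('n, 'k) lower \<times> ('n, 'k) lower" where
  "base_mom z = (fst z, fst (snd z))"

lemma bounded_linear_base_top: "bounded_linear base_top"
  unfolding base_top_def
  by (intro bounded_linear_Pair bounded_linear_fst
      bounded_linear_compose[OF bounded_linear_snd bounded_linear_snd])

lemma bounded_linear_base_mom: "bounded_linear base_mom"
  unfolding base_mom_def
  by (intro bounded_linear_Pair bounded_linear_fst
      bounded_linear_compose[OF bounded_linear_fst bounded_linear_snd])

lemma base_top_simp [simp]: "base_top (u, P, v) = (u, v)"
  by (simp add: base_top_def)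

text \<open>The form dq ^ dp with constant coefficients on the fibre coordinates; the q^(k)
  components do not enter, and they span its kernel.\<close>

definition canonical2 :: "('n::finite, 'k::finite) fibre_coords \<Rightarrow> ('n, 'k) fibre_coords \<Rightarrow> real" where
  "canonical2 a b = fst a \<bullet> fst (snd b) - fst b \<bullet> fst (snd a)"

definition grad_top :: "('e::euclidean_space \<times> (real^'n::finite) \<Rightarrow> real) \<Rightarrow> 'e \<times> (real^'n) \<Rightarrow> real^'n" where
  "grad_top f z = (\<chi> i. top_partial i f z)"

lemma derivative_top:
  assumes "f differentiable (at z)"
  shows "frechet_derivative f (at z) (0, w) = grad_top f z \<bullet> w"
proof -
  let ?D = "frechet_derivative f (at z)"
  have D: "linear ?D" by (rule linear_frechet_derivative[OF assms])
  have "(0, w) = (\<Sum>i\<in>UNIV. (w $ i) *\<^sub>R (0 :: 'a, axis i 1 :: real^'b))"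
  proof (rule prod_eqI)
    have "w = (\<Sum>i\<in>UNIV. (w $ i) *\<^sub>R axis i 1)"
      using basis_expansion[of w] by (simp add: scalar_mult_eq_scaleR)
    then show "snd (0 :: 'a, w) = snd (\<Sum>i\<in>UNIV. (w $ i) *\<^sub>R (0 :: 'a, axis i 1 :: real^'b))"
      by (simp add: snd_sum)
  qed (simp add: fst_sum)
  then have "?D (0, w) = (\<Sum>i\<in>UNIV. (w $ i) * ?D (0, axis i 1))"
    by (simp add: linear_sum[OF D] linear_cmul[OF D] del: scaleR_Pair)
  then show ?thesis
    by (simp add: grad_top_def top_partial_def inner_vec_def mult.commute)
qed

lemma smooth_on_grad_top: "open S \<Longrightarrow> smooth_on S f \<Longrightarrow> smooth_on S (grad_top f)"
  unfolding grad_top_def top_partial_def by (intro smooth_on_vec_lambda smooth_on_derivative)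

lemma smooth_on_top_partial: "smooth_on S f \<Longrightarrow> smooth_on S (top_partial i f)"
  unfolding top_partial_def by (rule smooth_on_derivative)

lemma derivative_grad_top:
  assumes "open S" "smooth_on S f" "z \<in> S"
  shows "frechet_derivative (grad_top f) (at z) (0, w) $ i
    = (\<Sum>j\<in>UNIV. top_partial i (top_partial j f) z * w $ j)"
proof -
  have "frechet_derivative (\<lambda>y. grad_top f y $ i) (at z) (0, w) = frechet_derivative (grad_top f) (at z) (0, w) $ i"
    using bounded_linear.has_derivative[OF bounded_linear_vec_nth
        smooth_on_has_derivative[OF smooth_on_grad_top[OF assms(1,2)] assms(3)], of i]
    by (simp add: frechet_derivative_eqI)
  moreover have "(\<lambda>y. grad_top f y $ i) = top_partial i f"
    by (simp add: grad_top_def fun_eq_iff)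
  ultimately have "frechet_derivative (grad_top f) (at z) (0, w) $ i = grad_top (top_partial i f) z \<bullet> w"
    using derivative_top[OF smooth_on_differentiable[OF smooth_on_top_partial[OF assms(2)] assms(3)], of i w]
    by simp
  also have "\<dots> = (\<Sum>j\<in>UNIV. top_partial j (top_partial i f) z * w $ j)"
    by (simp add: grad_top_def inner_vec_def)
  \<comment> \<open>Symmetry of second derivatives puts the indices in the order in which the
    bordered matrix has them.\<close>
  also have "\<dots> = (\<Sum>j\<in>UNIV. top_partial i (top_partial j f) z * w $ j)"
    using second_derivative_symmetric_real[OF assms, of "(0, axis i 1)"]
    by (intro sum.cong) (simp_all add: top_partial_def[abs_def])
  finally show ?thesis .
qed

context jet_bundle
begin

section \<open>The form and the differential of the Hamiltonian along curves\<close>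

abbreviation W0_set :: "'q jet set \<Rightarrow> 'q fibre_point set" where
  "W0_set \<equiv> W0 k \<A>"

abbreviation vel :: "('q, (real, 'n) vec) chart \<Rightarrow> (real \<Rightarrow> 'q fibre_point) \<Rightarrow> ('n, 'k) fibre_coords" where
  "vel c \<gamma> \<equiv> vector_derivative (snd (fib_chart c) \<circ> \<gamma>) (at 0)"

lemma Omega_W0_jet:
  assumes c: "c \<in> \<A>" and \<gamma>: "smooth_curve fib_atlas \<gamma>" "near0 \<gamma> (W0_set M)"
    and \<delta>: "smooth_curve fib_atlas \<delta>" "near0 \<delta> (W0_set M)" and 0: "\<gamma> 0 = \<delta> 0" "\<gamma> 0 \<in> fst (fib_chart c)"
  shows "Omega_W0 k \<A> M (jet fib_atlas 1 \<gamma>) (jet fib_atlas 1 \<delta>) = canonical2 (vel c \<gamma>) (vel c \<delta>)"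
proof -
  let ?cc = "cotangent_chart lower_atlas (lower_chart c)"
  \<comment> \<open>The pullback projects the chosen representative \<open>\<epsilon>'\<close>; its
    projection has to be a smooth curve in the cotangent bundle whose velocity can be read off from
    the original \<open>\<epsilon>\<close>.\<close>
  have main: "smooth_curve (cotangent_atlas lower_atlas) (fst \<circ> \<epsilon>') \<and> \<epsilon>' 0 = \<epsilon> 0 \<and>
      vector_derivative (snd ?cc \<circ> (fst \<circ> \<epsilon>')) (at 0) = base_mom (vel c \<epsilon>)"
    if \<epsilon>: "smooth_curve fib_atlas \<epsilon>" "near0 \<epsilon> (W0_set M)" "\<epsilon> 0 \<in> fst (fib_chart c)"
      and \<epsilon>': "\<epsilon>' = curve_in (W0_set M) (jet fib_atlas 1 \<epsilon>)" for \<epsilon> \<epsilon>'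
  proof -
    note ci = curve_in_jet[OF \<epsilon>(1,2), folded \<epsilon>']
    have 0: "\<epsilon>' 0 \<in> fst (fib_chart c)" using ci(4) \<epsilon>(3) by simp
    obtain e where e: "e > 0" "\<And>t. t \<in> {-e<..<e} \<Longrightarrow> \<epsilon>' t \<in> fst (fib_chart c)"
      "smooth_on {-e<..<e} (snd (fib_chart c) \<circ> \<epsilon>')"
      using smooth_curve_in_chart[OF smooth_atlas_fib ci(1) fib_chart_in[OF c] 0] by blast
    have eq: "(snd ?cc \<circ> (fst \<circ> \<epsilon>')) t = base_mom ((snd (fib_chart c) \<circ> \<epsilon>') t)" if "t \<in> {-e<..<e}" for t
      using fib_chart_parts(3)[OF c e(2)[OF that]] by (simp add: base_mom_def)
    have "smooth_on {-e<..<e} (\<lambda>t. base_mom ((snd (fib_chart c) \<circ> \<epsilon>') t))"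
      by (intro smooth_on_linear_compose[OF _ bounded_linear_base_mom] e(3)) auto
    then have "smooth_on {-e<..<e} (snd ?cc \<circ> (fst \<circ> \<epsilon>'))"
      by (rule smooth_on_cong[rotated]) (simp_all add: eq[simplified])
    then have 1: "smooth_curve (cotangent_atlas lower_atlas) (fst \<circ> \<epsilon>')"
      using e(1) fib_chart_parts(1)[OF c e(2)] lower_chart_in[OF c]
      by (intro smooth_curveI[of ?cc _ e]) (auto simp: cotangent_atlas_def)
    have same: "vel c \<epsilon>' = vel c \<epsilon>"
      using ci(3) contact_iff[OF smooth_atlas_fib \<epsilon>(1) ci(1) fib_chart_in[OF c] \<epsilon>(3)]
      by (simp add: same_jet_1 del: One_nat_def)
    have "((\<lambda>t. base_mom ((snd (fib_chart c) \<circ> \<epsilon>') t)) has_vector_derivative base_mom (vel c \<epsilon>')) (at 0)"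
      by (rule bounded_linear.has_vector_derivative[OF bounded_linear_base_mom
            velocity_has_vector_derivative[OF smooth_atlas_fib ci(1) fib_chart_in[OF c] 0]])
    then have "vector_derivative (\<lambda>t. base_mom ((snd (fib_chart c) \<circ> \<epsilon>') t)) (at 0) = base_mom (vel c \<epsilon>)"
      unfolding same by (rule vector_derivative_at)
    moreover have "vector_derivative (snd ?cc \<circ> (fst \<circ> \<epsilon>')) (at 0)
        = vector_derivative (\<lambda>t. base_mom ((snd (fib_chart c) \<circ> \<epsilon>') t)) (at 0)"
      using e(1) eq by (intro vector_derivative_cong_open[of "{-e<..<e}"]) auto
    ultimately show ?thesis using 1 ci(4) by simp
  qed
  let ?\<gamma> = "curve_in (W0_set M) (jet fib_atlas 1 \<gamma>)" and ?\<delta> = "curve_in (W0_set M) (jet fib_atlas 1 \<delta>)"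
  have m1: "smooth_curve (cotangent_atlas lower_atlas) (fst \<circ> ?\<gamma>)" "?\<gamma> 0 = \<gamma> 0"
    "vector_derivative (snd ?cc \<circ> (fst \<circ> ?\<gamma>)) (at 0) = base_mom (vel c \<gamma>)"
    using main[OF \<gamma> 0(2) refl] by auto
  have m2: "smooth_curve (cotangent_atlas lower_atlas) (fst \<circ> ?\<delta>)" "?\<delta> 0 = \<delta> 0"
    "vector_derivative (snd ?cc \<circ> (fst \<circ> ?\<delta>)) (at 0) = base_mom (vel c \<delta>)"
    using main[OF \<delta> _ refl] 0 by auto
  have "canonical_form lower_atlas (jet (cotangent_atlas lower_atlas) 1 (fst \<circ> ?\<gamma>))
      (jet (cotangent_atlas lower_atlas) 1 (fst \<circ> ?\<delta>)) = canonical2 (vel c \<gamma>) (vel c \<delta>)"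
    using canonical_form_jet[OF smooth_atlas_lower lower_chart_in[OF c] m1(1) m2(1)]
      fib_chart_parts(1)[OF c 0(2)] 0(1) m1(2,3) m2(2,3)
    by (simp add: canonical2_def base_mom_def del: One_nat_def)
  then show ?thesis
    by (simp add: Omega_W0_def pullback_def Let_def del: One_nat_def)
qed

lemma W1_subset: "W1 k \<A> L M \<subseteq> W0_set M"
  by (auto simp: W1_def Let_def)

text \<open>The pullback along the inclusion passes to a representative in W1, but this leaves the
  jet unchanged, so the formula for W0 applies.\<close>

lemma Omega_W1_jet:
  assumes c: "c \<in> \<A>" and \<gamma>: "smooth_curve fib_atlas \<gamma>" "near0 \<gamma> (W1 k \<A> L M)"
    and \<delta>: "smooth_curve fib_atlas \<delta>" "near0 \<delta> (W1 k \<A> L M)" and 0: "\<gamma> 0 = \<delta> 0" "\<gamma> 0 \<in> fst (fib_chart c)"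
  shows "Omega_W1 k \<A> L M (jet fib_atlas 1 \<gamma>) (jet fib_atlas 1 \<delta>) = canonical2 (vel c \<gamma>) (vel c \<delta>)"
proof -
  have "Omega_W1 k \<A> L M (jet fib_atlas 1 \<gamma>) (jet fib_atlas 1 \<delta>)
     = Omega_W0 k \<A> M (jet fib_atlas 1 \<gamma>) (jet fib_atlas 1 \<delta>)"
    using curve_in_jet(5)[OF \<gamma>] curve_in_jet(5)[OF \<delta>]
    by (simp add: Omega_W1_def pullback_def o_def del: One_nat_def)
  then show ?thesis
    using Omega_W0_jet[OF c \<gamma>(1) near0_mono[OF \<gamma>(2) W1_subset] \<delta>(1) near0_mono[OF \<delta>(2) W1_subset] 0]
    by simp
qed

text \<open>A fibre chart contains the entire fibre over each point of its base chart, so any base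
  chart around the base point will do.\<close>

lemma fib_points_chart:
  assumes "x \<in> points fib_atlas" "c \<in> \<A>" "jet_base (snd x) \<in> fst c"
  shows "x \<in> fst (fib_chart c)"
proof -
  obtain d where "d \<in> \<A>" "x \<in> fst (fib_chart d)"
    using assms(1) by (auto simp: points_iff fibre_atlas_def)
  then show ?thesis using assms(2,3) by (simp add: fib_chart_dom)
qed

lemma fib_chart_points: "c \<in> \<A> \<Longrightarrow> x \<in> fst (fib_chart c) \<Longrightarrow> x \<in> points fib_atlas"
  using fib_chart_in[of c] unfolding points_iff by blast

text \<open>For a vertical velocity the momenta are stationary, and by \<open>shift_top\<close> the
  pairing with the immersion varies only through p^(k-1). The derivative is computed along the
  representative that \<open>differential\<close> chooses.\<close>

lemma H_W0_derivative:
  assumes c: "c \<in> \<A>" and \<gamma>: "smooth_curve fib_atlas \<gamma>" "near0 \<gamma> (W0_set M)" "\<gamma> 0 \<in> fst (fib_chart c)"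
    and coords: "snd (fib_chart c) (\<gamma> 0) = (u, P, v)" and vert: "vel c \<gamma> = (0, 0, w)"
    and L: "local_rep (full_chart c) L differentiable (at (u, v))"
  shows "differential (W0_set M) (H_W0 k \<A> L) (jet fib_atlas 1 \<gamma>)
    = (P $ Max UNIV - grad_top (local_rep (full_chart c) L) (u, v)) \<bullet> w"
proof -
  let ?L = "local_rep (full_chart c) L"
  define \<gamma>' where "\<gamma>' = curve_in (W0_set M) (jet fib_atlas 1 \<gamma>)"
  note ci = curve_in_jet[OF \<gamma>(1,2), folded \<gamma>'_def]
  have 0: "\<gamma>' 0 \<in> fst (fib_chart c)" using ci(4) \<gamma>(3) by simp
  obtain e where e: "e > 0" "\<And>t. t \<in> {-e<..<e} \<Longrightarrow> \<gamma>' t \<in> fst (fib_chart c)"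
    using smooth_curve_in_chart[OF smooth_atlas_fib ci(1) fib_chart_in[OF c] 0] by blast
  have same: "vel c \<gamma>' = (0, 0, w)"
    using ci(3) contact_iff[OF smooth_atlas_fib \<gamma>(1) ci(1) fib_chart_in[OF c] \<gamma>(3)] vert
    by (simp add: same_jet_1 del: One_nat_def)
  define g where "g = snd (fib_chart c) \<circ> \<gamma>'"
  have g: "(g has_vector_derivative (0, 0, w)) (at 0)"
    using velocity_has_vector_derivative[OF smooth_atlas_fib ci(1) fib_chart_in[OF c] 0] same
    by (simp add: g_def)
  have g0: "g 0 = (u, P, v)" using coords ci(4) by (simp add: g_def)
  have m: "((\<lambda>t. fst (snd (g t))) has_vector_derivative 0) (at 0)"
    using bounded_linear.has_vector_derivative[OF bounded_linear_fst
        bounded_linear.has_vector_derivative[OF bounded_linear_snd g]] by simp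
  have b: "((\<lambda>t. base_top (g t)) has_vector_derivative (0, w)) (at 0)"
    using bounded_linear.has_vector_derivative[OF bounded_linear_base_top g] by simp
  have s: "((\<lambda>t. shift (base_top (g t))) has_vector_derivative shift (0, w)) (at 0)"
    by (rule bounded_linear.has_vector_derivative[OF bounded_linear_shift b])
  have l: "((\<lambda>t. ?L (base_top (g t))) has_vector_derivative grad_top ?L (u, v) \<bullet> w) (at 0)"
  proof -
    have "(?L has_derivative frechet_derivative ?L (at (u, v))) (at (base_top (g 0)) within range (\<lambda>t. base_top (g t)))"
      using L by (simp add: g0 frechet_derivative_works has_derivative_at_withinI)
    from vector_derivative_diff_chain_within[of "\<lambda>t. base_top (g t)", OF b this]
    show ?thesis by (simp add: o_def derivative_top[OF L])
  qed
  have "((\<lambda>t. fst (snd (g t)) \<bullet> shift (base_top (g t)) - ?L (base_top (g t))) has_vector_derivative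
      (fst (snd (g 0)) \<bullet> shift (0, w) + 0 \<bullet> shift (base_top (g 0))) - grad_top ?L (u, v) \<bullet> w) (at 0)"
    by (intro has_vector_derivative_diff l bounded_bilinear.has_vector_derivative[OF bounded_bilinear_inner m s])
  moreover have "fst (snd (g 0)) \<bullet> shift (0, w) = P $ Max UNIV \<bullet> w"
    by (simp add: g0 shift_top inner_axis)
  ultimately have "((\<lambda>t. fst (snd (g t)) \<bullet> shift (base_top (g t)) - ?L (base_top (g t))) has_vector_derivative
      (P $ Max UNIV - grad_top ?L (u, v)) \<bullet> w) (at 0)"
    by (simp add: inner_diff_left)
  then have "((H_W0 k \<A> L \<circ> \<gamma>') has_vector_derivative (P $ Max UNIV - grad_top ?L (u, v)) \<bullet> w) (at 0)"
  proof (rule has_vector_derivative_transform_within_open[of _ _ _ "{-e<..<e}"])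
    fix t assume t: "t \<in> {-e<..<e}"
    obtain u' P' v' where "g t = (u', P', v')" by (rule prod_cases3)
    then show "fst (snd (g t)) \<bullet> shift (base_top (g t)) - ?L (base_top (g t)) = (H_W0 k \<A> L \<circ> \<gamma>') t"
      using H_coord[OF c e(2)[OF t], of u' P' v' L] by (simp add: g_def)
  qed (use e(1) in auto)
  then show ?thesis
    unfolding differential_def \<gamma>'_def[symmetric]
    by (intro DERIV_imp_deriv) (simp add: has_real_derivative_iff_has_vector_derivative)
qed

end

section \<open>The constraints in one chart\<close>

text \<open>The argument is local: one base chart and one system of defining functions are fixed,
  and the results concern points over both domains.\<close>

locale constrained_system = jet_bundle \<A> k
  for \<A> :: "('q, (real, 'n::finite) vec) chart set" and k :: "'k::{finite, linorder} itself" +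
  fixes L :: "'q jet \<Rightarrow> real" and M :: "'q jet set"
    and c :: "('q, (real, 'n) vec) chart" and V :: "'q jet set" and \<Phi> :: "'q jet \<Rightarrow> real^'m"
  assumes L: "smooth_fun (Tk_atlas \<A> :: ('q jet, ('n, 'k) jet_coords) chart set) (jet_space \<A> CARD('k)) L"
    and M: "submanifold (Tk_atlas \<A> :: ('q jet, ('n, 'k) jet_coords) chart set) M"
    and c: "c \<in> \<A>"
    and \<Phi>: "defining_functions k \<A> M V \<Phi>"
begin

definition Q :: "('n, 'k) jet_coords set" where
  "Q = snd (full_chart c) ` (V \<inter> fst (full_chart c))"

definition Lc :: "('n, 'k) jet_coords \<Rightarrow> real" where
  "Lc = local_rep (full_chart c) L"

definition Fc :: "'m \<Rightarrow> ('n, 'k) jet_coords \<Rightarrow> real" where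
  "Fc \<alpha> = local_rep (full_chart c) (\<lambda>p. \<Phi> p $ \<alpha>)"

lemma open_Q: "open Q"
  using \<Phi> full_chart_in[OF c] unfolding defining_functions_def atlas_open_def Q_def
  by (auto simp: case_prod_beta)

lemma inj_full: "inj_on (snd (full_chart c)) (fst (full_chart c))"
  by (rule smooth_atlas_inj[OF smooth_atlas_full full_chart_in[OF c]])

lemma smooth_Lc: "smooth_on Q Lc"
proof -
  have "smooth_on (snd (full_chart c) ` (jet_space \<A> CARD('k) \<inter> fst (full_chart c))) Lc"
    using L full_chart_in[OF c] unfolding smooth_fun_def Lc_def by blast
  then show ?thesis
    by (rule smooth_on_subset) (auto simp: Q_def full_chart_dom)
qed

lemma smooth_Fc_vec: "smooth_on Q (local_rep (full_chart c) \<Phi>)"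
  using \<Phi> full_chart_in[OF c] unfolding defining_functions_def smooth_fun_def Q_def by blast

lemma Fc_nth: "Fc \<alpha> z = local_rep (full_chart c) \<Phi> z $ \<alpha>"
  by (simp add: Fc_def local_rep_def)

lemma smooth_Fc: "smooth_on Q (Fc \<alpha>)"
  using smooth_on_nth[OF open_Q smooth_Fc_vec, of \<alpha>] by (simp add: Fc_nth[abs_def])

lemma Fc_zero_iff:
  assumes "p \<in> V" "p \<in> fst (full_chart c)"
  shows "p \<in> M \<longleftrightarrow> (\<forall>\<alpha>. Fc \<alpha> (snd (full_chart c) p) = 0)"
proof -
  have "M \<inter> V = {p \<in> V. \<Phi> p = 0}" using \<Phi> by (simp add: defining_functions_def)
  then show ?thesis
    using assms local_rep_apply[OF inj_full assms(2), of \<Phi>] by (auto simp: Fc_nth vec_eq_iff)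
qed

lemma rows_surj:
  assumes "z \<in> Q" "\<And>\<alpha>. Fc \<alpha> z = 0"
  shows "\<exists>x. \<forall>\<alpha>. grad_top (Fc \<alpha>) z \<bullet> x = (y :: real^'m) $ \<alpha>"
proof (rule full_rank_rows_surj)
  obtain p where p: "p \<in> V" "p \<in> fst (full_chart c)" "z = snd (full_chart c) p"
    using assms(1) by (auto simp: Q_def)
  then have "p \<in> M \<inter> V \<inter> fst (full_chart c)" using Fc_zero_iff assms(2) by simp
  then show "rank (\<chi> \<alpha> i. grad_top (Fc \<alpha>) z $ i) = CARD('m)"
    using \<Phi> full_chart_in[OF c] unfolding defining_functions_def
    by (auto simp: grad_top_def Fc_def p(3))
qed

text \<open>A level-set curve of the constraints lies in M but is not known to be smooth; a slice of
  M repairs this. Shrinking the interval keeps the new curve in Q, where M is the zero set of the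
  constraints.\<close>

lemma curve_in_constraint:
  assumes z: "z \<in> Q" "\<And>\<alpha>. Fc \<alpha> z = 0" and w: "\<And>\<alpha>. frechet_derivative (Fc \<alpha>) (at z) w = 0"
  obtains g e where "e > 0" "g 0 = z" "smooth_on {-e<..<e} g" "vector_derivative g (at 0) = w"
    "\<And>t. t \<in> {-e<..<e} \<Longrightarrow> g t \<in> Q \<and> (\<forall>\<alpha>. Fc \<alpha> (g t) = 0)"
proof -
  let ?F = "local_rep (full_chart c) \<Phi>" and ?S = "snd (full_chart c) ` (M \<inter> fst (full_chart c))"
  have F0: "?F z = 0" using z(2) by (simp add: vec_eq_iff flip: Fc_nth)
  have der: "frechet_derivative (Fc \<alpha>) (at z) x = frechet_derivative ?F (at z) x $ \<alpha>" for \<alpha> x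
    using bounded_linear.has_derivative[OF bounded_linear_vec_nth
        smooth_on_has_derivative[OF smooth_Fc_vec z(1)], of \<alpha>]
    by (simp add: Fc_nth[abs_def] frechet_derivative_eqI)
  \<comment> \<open>The vectors (0, x) alone attain every value, by the rank condition in
    q^(k).\<close>
  have "surj (frechet_derivative ?F (at z))"
  proof (rule surjI)
    fix y
    obtain x where "\<And>\<alpha>. grad_top (Fc \<alpha>) z \<bullet> x = y $ \<alpha>" using rows_surj[OF z] by blast
    then have "frechet_derivative ?F (at z) (0, x) = y"
      using derivative_top[OF smooth_on_differentiable[OF smooth_Fc z(1)], of _ x]
      by (simp add: vec_eq_iff flip: der)
    then show "frechet_derivative ?F (at z) (SOME x. frechet_derivative ?F (at z) x = y) = y"
      by (rule someI)
  qed
  moreover have "frechet_derivative ?F (at z) w = 0"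
    using w by (simp add: vec_eq_iff der)
  ultimately obtain h e where h: "e > 0" "h 0 = z" "(h has_vector_derivative w) (at 0)"
    "\<And>t. t \<in> {-e<..<e} \<Longrightarrow> h t \<in> Q \<and> ?F (h t) = 0"
    using curve_in_level_set[OF open_Q z(1) smooth_Fc_vec F0] by metis
  have S: "y \<in> ?S" if y: "y \<in> Q" "\<And>\<alpha>. Fc \<alpha> y = 0" for y
    using y Fc_zero_iff by (auto simp: Q_def)
  have S': "Fc \<alpha> y = 0" if y: "y \<in> ?S" "y \<in> Q" for y \<alpha>
  proof -
    obtain p where p: "p \<in> M" "p \<in> fst (full_chart c)" "y = snd (full_chart c) p"
      using y(1) by blast
    moreover have "p \<in> V" using y(2) p inj_full by (auto simp: Q_def dest: inj_onD)
    ultimately show ?thesis using Fc_zero_iff by simp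
  qed
  have zS: "z \<in> ?S" by (rule S[OF z])
  then obtain D \<Psi> P where D: "z \<in> D" "slice ?S D \<Psi> P"
    using M full_chart_in[OF c] unfolding submanifold_def slice_in_def by meson
  have "\<forall>\<^sub>F t in at 0. t \<in> {-e<..<e}"
    using h(1) by (intro eventually_at_in_open') auto
  then have ev: "\<forall>\<^sub>F t in at 0. h t \<in> ?S"
    by eventually_elim (use h(4) in \<open>auto intro!: S simp: Fc_nth\<close>)
  obtain g e' where g: "e' > 0" "g 0 = z" "smooth_on {-e'<..<e'} g" "vector_derivative g (at 0) = w"
    "\<And>t. t \<in> {-e'<..<e'} \<Longrightarrow> g t \<in> ?S \<inter> D"
    by (rule smooth_curve_in_slice[OF D(2,1) zS h(3,2) ev]) blast
  have "open ({-e'<..<e'} \<inter> g -` Q)"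
    using smooth_on_continuous_on[OF g(3)] open_Q by (intro continuous_open_preimage) auto
  moreover have "0 \<in> {-e'<..<e'} \<inter> g -` Q" using g z by simp
  ultimately obtain d where d: "d > 0" "{-d<..<d} \<subseteq> {-e'<..<e'} \<inter> g -` Q"
    by (rule open_interval_subset)
  show ?thesis
  proof (rule that[OF d(1) g(2) _ g(4)])
    show "smooth_on {-d<..<d} g" by (rule smooth_on_subset[OF g(3)]) (use d in blast)
    show "g t \<in> Q \<and> (\<forall>\<alpha>. Fc \<alpha> (g t) = 0)" if "t \<in> {-d<..<d}" for t
      using d(2) that S'[of "g t"] g(5)[of t] by blast
  qed
qed

definition D :: "'q fibre_point set" where
  "D = {x \<in> fst (fib_chart c). snd x \<in> V}"

abbreviation \<xi> :: "'q fibre_point \<Rightarrow> ('n, 'k) fibre_coords" where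
  "\<xi> \<equiv> snd (fib_chart c)"

lemma D_fib: "x \<in> D \<Longrightarrow> x \<in> fst (fib_chart c)"
  by (simp add: D_def)

lemma D_iff: "x \<in> fst (fib_chart c) \<Longrightarrow> x \<in> D \<longleftrightarrow> base_top (\<xi> x) \<in> Q"
  using fib_chart_parts(2,4)[OF c, of x] inj_on_image_mem_iff[OF inj_full, of "snd x" "V \<inter> fst (full_chart c)"]
  by (simp add: D_def Q_def base_top_def)

lemma W0_iff: "x \<in> D \<Longrightarrow> x \<in> W0_set M \<longleftrightarrow> (\<forall>\<alpha>. Fc \<alpha> (base_top (\<xi> x)) = 0)"
  using Fc_zero_iff[of "snd x"] fib_chart_parts(2,4)[OF c, of x] fib_chart_points[OF c, of x]
  by (auto simp: D_def W0_def base_top_def)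

lemma curve_in_D:
  assumes "smooth_curve fib_atlas \<gamma>" "\<gamma> 0 \<in> D"
  obtains e where "e > 0" "\<And>t. t \<in> {-e<..<e} \<Longrightarrow> \<gamma> t \<in> D" "smooth_on {-e<..<e} (\<xi> \<circ> \<gamma>)"
proof -
  obtain e where e: "e > 0" "\<And>t. t \<in> {-e<..<e} \<Longrightarrow> \<gamma> t \<in> fst (fib_chart c)" "smooth_on {-e<..<e} (\<xi> \<circ> \<gamma>)"
    using smooth_curve_in_chart[OF smooth_atlas_fib assms(1) fib_chart_in[OF c] D_fib[OF assms(2)]] by blast
  have "smooth_on {-e<..<e} (\<lambda>t. base_top ((\<xi> \<circ> \<gamma>) t))"
    by (intro smooth_on_linear_compose[OF _ bounded_linear_base_top] e(3)) auto
  then have "open ({-e<..<e} \<inter> (\<lambda>t. base_top ((\<xi> \<circ> \<gamma>) t)) -` Q)"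
    using open_Q by (intro continuous_open_preimage smooth_on_continuous_on) auto
  moreover have "0 \<in> {-e<..<e} \<inter> (\<lambda>t. base_top ((\<xi> \<circ> \<gamma>) t)) -` Q"
    using e(1) assms(2) D_iff[OF D_fib[OF assms(2)]] by simp
  ultimately obtain d where d: "d > 0" "{-d<..<d} \<subseteq> {-e<..<e} \<inter> (\<lambda>t. base_top ((\<xi> \<circ> \<gamma>) t)) -` Q"
    by (rule open_interval_subset)
  show ?thesis
  proof (rule that[OF d(1)])
    show "\<gamma> t \<in> D" if "t \<in> {-d<..<d}" for t
    proof -
      have "t \<in> {-e<..<e}" "base_top (\<xi> (\<gamma> t)) \<in> Q" using d(2) that by auto
      then show ?thesis using e(2) D_iff by blast
    qed
    show "smooth_on {-d<..<d} (\<xi> \<circ> \<gamma>)" by (rule smooth_on_subset[OF e(3)]) (use d in blast)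
  qed
qed

lemma curve_of_coords:
  assumes e: "e > 0" "smooth_on {-e<..<e} g" and x: "x \<in> D" "g 0 = \<xi> x"
    and Q: "\<And>t. t \<in> {-e<..<e} \<Longrightarrow> base_top (g t) \<in> Q"
  obtains \<gamma> d where "smooth_curve fib_atlas \<gamma>" "\<gamma> 0 = x" "vel c \<gamma> = vector_derivative g (at 0)"
    "d > 0" "\<And>t. t \<in> {-d<..<d} \<Longrightarrow> t \<in> {-e<..<e} \<and> \<gamma> t \<in> D \<and> \<xi> (\<gamma> t) = g t"
proof -
  have g0: "g 0 \<in> \<xi> ` fst (fib_chart c)" using x D_fib by auto
  obtain d where d: "d > 0" "{-d<..<d} \<subseteq> {-e<..<e}"
    "\<And>t. t \<in> {-d<..<d} \<Longrightarrow> inv_into (fst (fib_chart c)) \<xi> (g t) \<in> fst (fib_chart c)"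
    "\<And>t. t \<in> {-d<..<d} \<Longrightarrow> \<xi> (inv_into (fst (fib_chart c)) \<xi> (g t)) = g t"
    "smooth_curve fib_atlas (\<lambda>t. inv_into (fst (fib_chart c)) \<xi> (g t))"
    by (rule curve_of_chart[OF smooth_atlas_fib fib_chart_in[OF c] _ _ e(2) g0]) (use e(1) in auto)
  let ?\<gamma> = "\<lambda>t. inv_into (fst (fib_chart c)) \<xi> (g t)"
  show ?thesis
  proof (rule that[OF d(5) _ _ d(1)])
    show "?\<gamma> 0 = x" using x D_fib[OF x(1)] inj_on_fib_chart[OF c] by simp
    show "vel c ?\<gamma> = vector_derivative g (at 0)"
      using d(1,4) by (intro vector_derivative_cong_open[of "{-d<..<d}"]) auto
    show "t \<in> {-e<..<e} \<and> ?\<gamma> t \<in> D \<and> \<xi> (?\<gamma> t) = g t" if "t \<in> {-d<..<d}" for t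
      using d(2,3,4) that D_iff[OF d(3)[OF that]] Q[of t] by auto
  qed
qed

text \<open>The left-hand side of the multiplier equation. The multiplier is a parameter and not a
  function of the point, so it can be frozen under differentiation.\<close>

definition residual :: "real^'m \<Rightarrow> ('n, 'k) fibre_coords \<Rightarrow> real^'n" where
  "residual l z = fst (snd z) $ Max UNIV - grad_top Lc (base_top z) +
     (\<Sum>\<alpha>\<in>UNIV. l $ \<alpha> *\<^sub>R grad_top (Fc \<alpha>) (base_top z))"

definition G :: "('n, 'k) fibre_coords set" where
  "G = base_top -` Q"

lemma open_G: "open G"
  unfolding G_def by (rule open_vimage[OF open_Q linear_continuous_on[OF bounded_linear_base_top]])

lemma D_G: "x \<in> D \<Longrightarrow> \<xi> x \<in> G"
  using D_iff[OF D_fib] by (auto simp: G_def)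

lemma smooth_base_top_compose:
  fixes f :: "('n, 'k) jet_coords \<Rightarrow> 'b::real_normed_vector"
  shows "smooth_on Q f \<Longrightarrow> smooth_on G (\<lambda>z. f (base_top z))"
  by (rule smooth_on_compose[OF open_G smooth_on_linear[OF bounded_linear_base_top]]) (auto simp: G_def)

lemma smooth_residual: "smooth_on G (residual l)"
  unfolding residual_def[abs_def]
  by (intro smooth_on_add smooth_on_diff smooth_on_sum smooth_on_scaleR smooth_on_const open_G
      smooth_base_top_compose smooth_on_grad_top open_Q smooth_Lc smooth_Fc
      smooth_on_nth smooth_on_fst smooth_on_snd smooth_on_id)

lemma frechet_derivative_base_top:
  fixes f :: "('n, 'k) jet_coords \<Rightarrow> 'b::real_normed_vector"
  assumes "smooth_on Q f" "z \<in> G"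
  shows "((\<lambda>z. f (base_top z)) has_derivative (\<lambda>d. frechet_derivative f (at (base_top z)) (base_top d))) (at z)"
proof -
  have 1: "(base_top has_derivative base_top) (at z)"
    by (rule bounded_linear_imp_has_derivative[OF bounded_linear_base_top])
  have 2: "(f has_derivative frechet_derivative f (at (base_top z))) (at (base_top z))"
    using assms(2) by (intro smooth_on_has_derivative[OF assms(1)]) (simp add: G_def)
  show ?thesis using diff_chain_at[OF 1 2] by (simp add: o_def)
qed

lemma residual_derivative:
  assumes "z \<in> G"
  shows "frechet_derivative (residual l) (at z) d = fst (snd d) $ Max UNIV
    - frechet_derivative (grad_top Lc) (at (base_top z)) (base_top d)
    + (\<Sum>\<alpha>\<in>UNIV. l $ \<alpha> *\<^sub>R frechet_derivative (grad_top (Fc \<alpha>)) (at (base_top z)) (base_top d))"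
proof -
  have "bounded_linear (\<lambda>z :: ('n, 'k) fibre_coords. fst (snd z) $ Max UNIV)"
    by (intro bounded_linear_compose[OF bounded_linear_vec_nth]
        bounded_linear_compose[OF bounded_linear_fst bounded_linear_snd])
  note lin = bounded_linear_imp_has_derivative[OF this]
  have "(residual l has_derivative (\<lambda>d. fst (snd d) $ Max UNIV
    - frechet_derivative (grad_top Lc) (at (base_top z)) (base_top d)
    + (\<Sum>\<alpha>\<in>UNIV. l $ \<alpha> *\<^sub>R frechet_derivative (grad_top (Fc \<alpha>)) (at (base_top z)) (base_top d)))) (at z)"
    unfolding residual_def[abs_def]
    by (intro has_derivative_add has_derivative_diff has_derivative_sum has_derivative_scaleR_right lin
        frechet_derivative_base_top assms smooth_on_grad_top open_Q smooth_Lc smooth_Fc)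
  then show ?thesis by (simp add: frechet_derivative_eqI)
qed

text \<open>Residuals for different multipliers differ by a combination of constraint gradients.
  This underlies both the uniqueness of multipliers and the treatment of tangent vectors modulo
  gradients.\<close>

lemma residual_linear:
  "residual (l + s *\<^sub>R l') z = residual l z + s *\<^sub>R (\<Sum>\<alpha>\<in>UNIV. l' $ \<alpha> *\<^sub>R grad_top (Fc \<alpha>) (base_top z))"
  by (simp add: residual_def scaleR_add_left sum.distrib scaleR_sum_right)

section \<open>Tangent vectors of W0 and the kernel of its form\<close>

lemma W0_tangent_imp:
  assumes \<gamma>: "smooth_curve fib_atlas \<gamma>" "near0 \<gamma> (W0_set M)" "\<gamma> 0 \<in> D"
  shows "frechet_derivative (Fc \<alpha>) (at (base_top (\<xi> (\<gamma> 0)))) (base_top (vel c \<gamma>)) = 0"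
proof -
  obtain e where e: "e > 0" "\<And>t. t \<in> {-e<..<e} \<Longrightarrow> \<gamma> t \<in> D" "smooth_on {-e<..<e} (\<xi> \<circ> \<gamma>)"
    using curve_in_D[OF \<gamma>(1,3)] by blast
  obtain e' where e': "e' > 0" "\<And>t. t \<in> {-e'<..<e'} \<Longrightarrow> \<gamma> t \<in> W0_set M"
    using \<gamma>(2) unfolding near0_def by blast
  define d where "d = min e e'"
  have d: "open {-d<..<d}" "0 \<in> {-d<..<d}" using e e' by (auto simp: d_def)
  have "vector_derivative (\<lambda>t. Fc \<alpha> (base_top ((\<xi> \<circ> \<gamma>) t))) (at 0) = vector_derivative (\<lambda>t. 0) (at 0)"
  proof (rule vector_derivative_cong_open[OF d])
    fix t assume "t \<in> {-d<..<d}"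
    then have "\<gamma> t \<in> D" "\<gamma> t \<in> W0_set M" using e(2)[of t] e'(2)[of t] by (auto simp: d_def)
    then show "Fc \<alpha> (base_top ((\<xi> \<circ> \<gamma>) t)) = 0" using W0_iff by simp
  qed
  moreover have "vector_derivative (\<lambda>t. Fc \<alpha> (base_top ((\<xi> \<circ> \<gamma>) t))) (at 0)
      = frechet_derivative (\<lambda>z. Fc \<alpha> (base_top z)) (at ((\<xi> \<circ> \<gamma>) 0)) (vel c \<gamma>)"
    using e d D_G[OF \<gamma>(3)]
    by (intro vector_derivative_compose[of "{-e<..<e}" "\<xi> \<circ> \<gamma>" G "\<lambda>z. Fc \<alpha> (base_top z)" 0] smooth_base_top_compose smooth_Fc) auto
  ultimately show ?thesis
    using frechet_derivative_eqI[OF frechet_derivative_base_top[OF smooth_Fc D_G[OF \<gamma>(3)]]] by simp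
qed

lemma prod_has_vector_derivative:
  assumes "(g has_vector_derivative base_top d) (at 0)" "(P has_vector_derivative fst (snd d)) (at 0)"
  shows "((\<lambda>t. (fst (g t), P t, snd (g t))) has_vector_derivative d) (at 0)"
proof -
  have "((\<lambda>t. fst (g t)) has_vector_derivative fst d) (at 0)" "((\<lambda>t. snd (g t)) has_vector_derivative snd (snd d)) (at 0)"
    using bounded_linear.has_vector_derivative[OF bounded_linear_fst assms(1)]
      bounded_linear.has_vector_derivative[OF bounded_linear_snd assms(1)]
    by (simp_all add: base_top_def)
  from has_vector_derivative_Pair[OF this(1) has_vector_derivative_Pair[OF assms(2) this(2)]]
  show ?thesis by simp
qed

text \<open>The constraints do not involve the momenta, so these move along a straight line while
  the remaining coordinates follow a curve in M.\<close>

lemma W0_tangent_exists: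
  assumes x: "x \<in> D" "x \<in> W0_set M"
    and d: "\<And>\<alpha>. frechet_derivative (Fc \<alpha>) (at (base_top (\<xi> x))) (base_top d) = 0"
  obtains \<gamma> where "smooth_curve fib_atlas \<gamma>" "near0 \<gamma> (W0_set M)" "\<gamma> 0 = x" "vel c \<gamma> = d"
proof -
  have z: "base_top (\<xi> x) \<in> Q" "\<And>\<alpha>. Fc \<alpha> (base_top (\<xi> x)) = 0"
    using D_G[OF x(1)] W0_iff[OF x(1)] x(2) by (auto simp: G_def)
  obtain g e where g: "e > 0" "g 0 = base_top (\<xi> x)" "smooth_on {-e<..<e} g"
    "vector_derivative g (at 0) = base_top d"
    "\<And>t. t \<in> {-e<..<e} \<Longrightarrow> g t \<in> Q \<and> (\<forall>\<alpha>. Fc \<alpha> (g t) = 0)"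
    by (rule curve_in_constraint[OF z d]) blast
  let ?P = "\<lambda>t. fst (snd (\<xi> x)) + t *\<^sub>R fst (snd d)"
  let ?g = "\<lambda>t. (fst (g t), ?P t, snd (g t))"
  have sm: "smooth_on {-e<..<e} ?g"
    by (intro smooth_on_Pair smooth_on_fst smooth_on_snd smooth_on_add smooth_on_const
        smooth_on_scaleR smooth_on_id g(3)) auto
  have "(g has_vector_derivative base_top d) (at 0)"
    using smooth_on_has_vector_derivative[OF g(3), of 0] g(1,4) by simp
  moreover have "(?P has_vector_derivative fst (snd d)) (at 0)"
    by (auto intro!: derivative_eq_intros)
  ultimately have vd: "vector_derivative ?g (at 0) = d"
    by (intro vector_derivative_at prod_has_vector_derivative)
  have bt: "base_top (?g t) = g t" for t by simp
  have g0: "?g 0 = \<xi> x" by (simp add: g(2) base_top_def)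
  obtain \<gamma> r where \<gamma>: "smooth_curve fib_atlas \<gamma>" "\<gamma> 0 = x" "vel c \<gamma> = vector_derivative ?g (at 0)"
    "r > 0" "\<And>t. t \<in> {-r<..<r} \<Longrightarrow> t \<in> {-e<..<e} \<and> \<gamma> t \<in> D \<and> \<xi> (\<gamma> t) = ?g t"
    by (rule curve_of_coords[OF g(1) sm x(1) g0]) (use g(5) in \<open>auto simp: bt\<close>)
  have "\<gamma> t \<in> W0_set M" if "t \<in> {-r<..<r}" for t
    using \<gamma>(5)[OF that] g(5)[of t] W0_iff[of "\<gamma> t"] by simp
  then have "near0 \<gamma> (W0_set M)" unfolding near0_def using \<gamma>(4) by blast
  then show ?thesis using that \<gamma>(1-3) vd by simp
qed

text \<open>The rank condition solves the linearized constraints for the variation of q^(k),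
  whatever the variation a of the lower coordinates. Hence tangent vectors of W0 have arbitrary
  components in the cotangent bundle.\<close>

lemma tangent_correction:
  assumes x: "x \<in> D" "x \<in> W0_set M"
  obtains v where "\<And>\<alpha>. frechet_derivative (Fc \<alpha>) (at (base_top (\<xi> x))) (a, v) = 0"
proof -
  let ?z = "base_top (\<xi> x)"
  have z: "?z \<in> Q" "\<And>\<alpha>. Fc \<alpha> ?z = 0"
    using D_G[OF x(1)] W0_iff[OF x(1)] x(2) by (auto simp: G_def)
  obtain v where v: "\<And>\<alpha>. grad_top (Fc \<alpha>) ?z \<bullet> v = (\<chi> \<alpha>. - frechet_derivative (Fc \<alpha>) (at ?z) (a, 0)) $ \<alpha>"
    using rows_surj[OF z] by blast
  have "frechet_derivative (Fc \<alpha>) (at ?z) (a, v) = 0" for \<alpha>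
    using linear_add[OF smooth_on_derivative_linear[OF smooth_Fc z(1)], of \<alpha> "(a, 0)" "(0, v)"] v[of \<alpha>]
    by (simp add: derivative_top[OF smooth_on_differentiable[OF smooth_Fc z(1)]])
  then show ?thesis using that by blast
qed

lemma Omega_W0_kernel:
  assumes \<gamma>: "smooth_curve fib_atlas \<gamma>" "near0 \<gamma> (W0_set M)" "\<gamma> 0 \<in> D"
  shows "jet fib_atlas 1 \<gamma> \<in> form_kernel fib_atlas (W0_set M) (Omega_W0 k \<A> M) (\<gamma> 0)
    \<longleftrightarrow> fst (vel c \<gamma>) = 0 \<and> fst (snd (vel c \<gamma>)) = 0"
proof
  assume K: "jet fib_atlas 1 \<gamma> \<in> form_kernel fib_atlas (W0_set M) (Omega_W0 k \<A> M) (\<gamma> 0)"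
  have W0: "\<gamma> 0 \<in> W0_set M" by (rule near0_0[OF \<gamma>(2)])
  have *: "fst (vel c \<gamma>) \<bullet> b - a \<bullet> fst (snd (vel c \<gamma>)) = 0" for a b
  proof -
    obtain v where v: "\<And>\<alpha>. frechet_derivative (Fc \<alpha>) (at (base_top (\<xi> (\<gamma> 0)))) (a, v) = 0"
      using tangent_correction[OF \<gamma>(3) W0] by blast
    then obtain \<delta> where \<delta>: "smooth_curve fib_atlas \<delta>" "near0 \<delta> (W0_set M)" "\<delta> 0 = \<gamma> 0" "vel c \<delta> = (a, b, v)"
      using W0_tangent_exists[OF \<gamma>(3) W0, of "(a, b, v)"] by auto
    have "jet fib_atlas 1 \<delta> \<in> tangent_space fib_atlas (W0_set M) (\<gamma> 0)"
      unfolding tangent_space_def using \<delta> by blast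
    then have "Omega_W0 k \<A> M (jet fib_atlas 1 \<gamma>) (jet fib_atlas 1 \<delta>) = 0"
      using K by (simp add: form_kernel_def del: One_nat_def)
    then show ?thesis
      using Omega_W0_jet[OF c \<gamma>(1,2) \<delta>(1,2) \<delta>(3)[symmetric] D_fib[OF \<gamma>(3)]]
      by (simp add: canonical2_def \<delta>(4) del: One_nat_def)
  qed
  \<comment> \<open>With b the q-component and a = 0, and with a the p-component and b = 0, the
    pairing becomes a squared norm up to sign.\<close>
  show "fst (vel c \<gamma>) = 0 \<and> fst (snd (vel c \<gamma>)) = 0"
    using *[of "fst (vel c \<gamma>)" 0] *[of 0 "fst (snd (vel c \<gamma>))"] by simp
next
  assume 0: "fst (vel c \<gamma>) = 0 \<and> fst (snd (vel c \<gamma>)) = 0"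
  have "Omega_W0 k \<A> M (jet fib_atlas 1 \<gamma>) (jet fib_atlas 1 \<delta>) = 0"
    if "smooth_curve fib_atlas \<delta>" "near0 \<delta> (W0_set M)" "\<delta> 0 = \<gamma> 0" for \<delta>
    using Omega_W0_jet[OF c \<gamma>(1,2) that(1,2) that(3)[symmetric] D_fib[OF \<gamma>(3)]] 0
    by (simp add: canonical2_def)
  then show "jet fib_atlas 1 \<gamma> \<in> form_kernel fib_atlas (W0_set M) (Omega_W0 k \<A> M) (\<gamma> 0)"
    unfolding form_kernel_def tangent_space_def using \<gamma>(1,2) by blast
qed

section \<open>The multiplier equation for W1\<close>

abbreviation W1_set :: "'q fibre_point set" where
  "W1_set \<equiv> W1 k \<A> L M"

lemma W0_rows_surj:
  assumes "x \<in> D" "x \<in> W0_set M"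
  shows "\<exists>v. \<forall>\<alpha>. grad_top (Fc \<alpha>) (base_top (\<xi> x)) \<bullet> v = (y :: real^'m) $ \<alpha>"
  using assms D_G W0_iff by (intro rows_surj) (auto simp: G_def)

text \<open>Since the kernel is vertical, the condition on dH says that p^(k-1) minus the gradient
  of L annihilates the common kernel of the constraint gradients. Linear duality turns this into the
  existence of multipliers.\<close>

lemma W1_iff:
  assumes x: "x \<in> D" "x \<in> W0_set M"
  shows "x \<in> W1_set \<longleftrightarrow> (\<exists>l. residual l (\<xi> x) = 0)"
proof -
  let ?z = "base_top (\<xi> x)"
  let ?X = "fst (snd (\<xi> x)) $ Max UNIV - grad_top Lc ?z"
  have zQ: "?z \<in> Q" using D_G[OF x(1)] by (simp add: G_def)
  note Fdiff = smooth_on_differentiable[OF smooth_Fc zQ]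
  have diff: "differential (W0_set M) (H_W0 k \<A> L) (jet fib_atlas 1 \<gamma>) = ?X \<bullet> w"
    if \<gamma>: "smooth_curve fib_atlas \<gamma>" "near0 \<gamma> (W0_set M)" "\<gamma> 0 = x" "vel c \<gamma> = (0, 0, w)" for \<gamma> w
  proof -
    obtain u P v where uPv: "\<xi> x = (u, P, v)" by (rule prod_cases3)
    have "Lc differentiable (at (u, v))"
      using smooth_on_differentiable[OF smooth_Lc zQ] by (simp add: uPv)
    then show ?thesis
      using H_W0_derivative[OF c \<gamma>(1,2) _ _ \<gamma>(4), of u P v L] D_fib[OF x(1)]
      by (simp add: \<gamma>(3) uPv Lc_def del: One_nat_def)
  qed
  have "x \<in> W1_set \<longleftrightarrow> (\<forall>w. (\<forall>\<alpha>. grad_top (Fc \<alpha>) ?z \<bullet> w = 0) \<longrightarrow> ?X \<bullet> w = 0)"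
  proof
    assume W1: "x \<in> W1_set"
    show "\<forall>w. (\<forall>\<alpha>. grad_top (Fc \<alpha>) ?z \<bullet> w = 0) \<longrightarrow> ?X \<bullet> w = 0"
    proof (intro allI impI)
      fix w assume w: "\<forall>\<alpha>. grad_top (Fc \<alpha>) ?z \<bullet> w = 0"
      have "frechet_derivative (Fc \<alpha>) (at ?z) (base_top (0, 0, w)) = 0" for \<alpha>
        using w by (simp add: derivative_top[OF Fdiff])
      then obtain \<gamma> where \<gamma>: "smooth_curve fib_atlas \<gamma>" "near0 \<gamma> (W0_set M)" "\<gamma> 0 = x" "vel c \<gamma> = (0, 0, w)"
        using W0_tangent_exists[OF x] by blast
      have "jet fib_atlas 1 \<gamma> \<in> form_kernel fib_atlas (W0_set M) (Omega_W0 k \<A> M) x"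
        using Omega_W0_kernel[OF \<gamma>(1,2)] x(1) \<gamma>(3,4) by simp
      then show "?X \<bullet> w = 0"
        using W1 diff[OF \<gamma>] by (simp add: W1_def Let_def del: One_nat_def)
    qed
  next
    assume *: "\<forall>w. (\<forall>\<alpha>. grad_top (Fc \<alpha>) ?z \<bullet> w = 0) \<longrightarrow> ?X \<bullet> w = 0"
    have "differential (W0_set M) (H_W0 k \<A> L) Z = 0"
      if Z: "Z \<in> form_kernel fib_atlas (W0_set M) (Omega_W0 k \<A> M) x" for Z
    proof -
      obtain \<gamma> where \<gamma>: "Z = jet fib_atlas 1 \<gamma>" "smooth_curve fib_atlas \<gamma>" "near0 \<gamma> (W0_set M)" "\<gamma> 0 = x"
        using Z unfolding form_kernel_def tangent_space_def by blast
      then have "fst (vel c \<gamma>) = 0 \<and> fst (snd (vel c \<gamma>)) = 0"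
        using Omega_W0_kernel[OF \<gamma>(2,3)] x(1) Z by simp
      then obtain w where w: "vel c \<gamma> = (0, 0, w)" by (metis prod.collapse)
      have "grad_top (Fc \<alpha>) ?z \<bullet> w = 0" for \<alpha>
        using W0_tangent_imp[OF \<gamma>(2,3), of \<alpha>] x(1) by (simp add: \<gamma>(4) w derivative_top[OF Fdiff])
      then show ?thesis
        using diff[OF \<gamma>(2-4) w] * by (simp add: \<gamma>(1))
    qed
    then show "x \<in> W1_set" using x(2) by (simp add: W1_def Let_def)
  qed
  also have "\<dots> \<longleftrightarrow> (\<exists>l. residual l (\<xi> x) = 0)"
  proof
    assume *: "\<forall>w. (\<forall>\<alpha>. grad_top (Fc \<alpha>) ?z \<bullet> w = 0) \<longrightarrow> ?X \<bullet> w = 0"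
    obtain l :: "real^'m" where "?X = (\<Sum>\<alpha>\<in>UNIV. l $ \<alpha> *\<^sub>R grad_top (Fc \<alpha>) ?z)"
      using orthogonal_to_kernel_imp_row_combination[OF W0_rows_surj[OF x], of ?X] * by blast
    \<comment> \<open>The duality lemma writes \<open>?X\<close> as a combination, whereas
      \<open>residual\<close> adds the combination to it; hence the sign.\<close>
    then have "residual (- l) (\<xi> x) = 0" by (simp add: residual_def sum_negf)
    then show "\<exists>l. residual l (\<xi> x) = 0" by blast
  next
    assume "\<exists>l. residual l (\<xi> x) = 0"
    then obtain l where "?X + (\<Sum>\<alpha>\<in>UNIV. l $ \<alpha> *\<^sub>R grad_top (Fc \<alpha>) ?z) = 0"
      by (auto simp: residual_def)
    then have X: "?X = - (\<Sum>\<alpha>\<in>UNIV. l $ \<alpha> *\<^sub>R grad_top (Fc \<alpha>) ?z)"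
      by (simp only: eq_neg_iff_add_eq_0)
    show "\<forall>w. (\<forall>\<alpha>. grad_top (Fc \<alpha>) ?z \<bullet> w = 0) \<longrightarrow> ?X \<bullet> w = 0"
      unfolding X by (simp add: inner_sum_left)
  qed
  finally show ?thesis .
qed

lemma residual_unique:
  assumes x: "x \<in> D" "x \<in> W0_set M" and "residual l (\<xi> x) = 0" "residual l' (\<xi> x) = 0"
  shows "l = l'"
proof -
  have "residual (l' + 1 *\<^sub>R (l - l')) (\<xi> x) = residual l' (\<xi> x)
    + (\<Sum>\<alpha>\<in>UNIV. (l - l') $ \<alpha> *\<^sub>R grad_top (Fc \<alpha>) (base_top (\<xi> x)))"
    using residual_linear[of l' 1 "l - l'" "\<xi> x"] by (simp only: scaleR_one)
  then have "(\<Sum>\<alpha>\<in>UNIV. (l - l') $ \<alpha> *\<^sub>R grad_top (Fc \<alpha>) (base_top (\<xi> x))) = 0"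
    using assms(3,4) by simp
  then have "l - l' = 0" by (rule rows_independent[OF W0_rows_surj[OF x]])
  then show ?thesis by simp
qed

lemma multiplier_eq:
  assumes x: "x \<in> D" "x \<in> W0_set M" and l: "residual l (\<xi> x) = 0"
  shows "multiplier k \<A> L \<Phi> c x = l"
proof -
  obtain u P v where uPv: "\<xi> x = (u, P, v)" by (rule prod_cases3)
  have "(\<forall>i. P $ Max UNIV $ i - top_partial i Lc (u, v) + (\<Sum>\<alpha>\<in>UNIV. l $ \<alpha> * top_partial i (Fc \<alpha>) (u, v)) = 0)
      \<longleftrightarrow> residual l (\<xi> x) = 0" for l
    by (simp add: residual_def vec_eq_iff grad_top_def uPv)
  then have "multiplier k \<A> L \<Phi> c x = (THE l. residual l (\<xi> x) = 0)"
    unfolding multiplier_def Let_def by (simp add: uPv Lc_def Fc_def)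
  also have "\<dots> = l"
    using l residual_unique[OF x] by (intro the_equality)
  finally show ?thesis .
qed

section \<open>Tangent vectors of W1\<close>

text \<open>The multipliers \<open>mu t\<close> along the curve are chosen pointwise, without
  continuity. With l frozen, the residual equals the combination of gradients with coefficients
  \<open>l - mu t\<close>, which is the situation of
  \<open>derivative_orthogonal_to_kernel\<close>.\<close>

lemma W1_tangent_imp:
  assumes \<gamma>: "smooth_curve fib_atlas \<gamma>" "near0 \<gamma> W1_set" "\<gamma> 0 \<in> D" and l: "residual l (\<xi> (\<gamma> 0)) = 0"
    and w: "\<And>\<alpha>. grad_top (Fc \<alpha>) (base_top (\<xi> (\<gamma> 0))) \<bullet> w = 0"
  shows "frechet_derivative (residual l) (at (\<xi> (\<gamma> 0))) (vel c \<gamma>) \<bullet> w = 0"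
proof -
  obtain e where e: "e > 0" "\<And>t. t \<in> {-e<..<e} \<Longrightarrow> \<gamma> t \<in> D" "smooth_on {-e<..<e} (\<xi> \<circ> \<gamma>)"
    using curve_in_D[OF \<gamma>(1,3)] by blast
  obtain e' where e': "e' > 0" "\<And>t. t \<in> {-e'<..<e'} \<Longrightarrow> \<gamma> t \<in> W1_set"
    using \<gamma>(2) unfolding near0_def by blast
  have W0: "\<gamma> 0 \<in> W0_set M" using near0_0[OF \<gamma>(2)] W1_subset by blast
  have "\<exists>l. residual l (\<xi> (\<gamma> t)) = 0" if "t \<in> {-e<..<e} \<inter> {-e'<..<e'}" for t
    using W1_iff[of "\<gamma> t"] e(2)[of t] e'(2)[of t] that W1_subset by auto
  then obtain mu where mu: "\<And>t. t \<in> {-e<..<e} \<inter> {-e'<..<e'} \<Longrightarrow> residual (mu t) (\<xi> (\<gamma> t)) = 0"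
    by metis
  let ?r = "\<lambda>t \<alpha>. grad_top (Fc \<alpha>) (base_top (\<xi> (\<gamma> t)))"
  have in0: "0 \<in> {-e<..<e}" using e(1) by simp
  show ?thesis
  proof (rule derivative_orthogonal_to_kernel[where b="?r 0" and r="?r" and \<mu>="\<lambda>t \<alpha>. (l - mu t) $ \<alpha>"])
    show "\<exists>v. \<forall>\<alpha>. ?r 0 \<alpha> \<bullet> v = y $ \<alpha>" for y :: "real^'m"
      by (rule W0_rows_surj[OF \<gamma>(3) W0])
    have "smooth_on {-e<..<e} (\<lambda>t. residual l ((\<xi> \<circ> \<gamma>) t))"
      using D_G e(2) by (intro smooth_on_compose[OF _ e(3) smooth_residual]) auto
    from smooth_on_has_vector_derivative[OF this in0]
    show "((\<lambda>t. residual l (\<xi> (\<gamma> t))) has_vector_derivative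
        frechet_derivative (residual l) (at (\<xi> (\<gamma> 0))) (vel c \<gamma>)) (at 0)"
      using vector_derivative_compose[OF _ _ e(3) smooth_residual in0] D_G[OF \<gamma>(3)] in0 by simp
    show "residual l (\<xi> (\<gamma> 0)) = 0" by (rule l)
    show "isCont (\<lambda>t. ?r t \<alpha>) 0" for \<alpha>
    proof -
      have "smooth_on {-e<..<e} (\<lambda>t. grad_top (Fc \<alpha>) (base_top ((\<xi> \<circ> \<gamma>) t)))"
        using D_G e(2)
        by (intro smooth_on_compose[OF _ e(3) smooth_base_top_compose[OF smooth_on_grad_top[OF open_Q smooth_Fc]]]) auto
      then show ?thesis
        using smooth_on_continuous_on continuous_on_eq_continuous_at[of "{-e<..<e}"] in0 by fastforce
    qed
    have "\<forall>\<^sub>F t in at 0. t \<in> {-e<..<e} \<inter> {-e'<..<e'}"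
      using e(1) e'(1) by (intro eventually_at_in_open') auto
    then show "\<forall>\<^sub>F t in at 0. residual l (\<xi> (\<gamma> t)) = (\<Sum>\<alpha>\<in>UNIV. (l - mu t) $ \<alpha> *\<^sub>R ?r t \<alpha>)"
    proof eventually_elim
      case (elim t)
      have "residual (mu t + 1 *\<^sub>R (l - mu t)) (\<xi> (\<gamma> t)) = residual (mu t) (\<xi> (\<gamma> t))
        + (\<Sum>\<alpha>\<in>UNIV. (l - mu t) $ \<alpha> *\<^sub>R ?r t \<alpha>)"
        using residual_linear[of "mu t" 1 "l - mu t" "\<xi> (\<gamma> t)"] by (simp only: scaleR_one)
      then show ?case using mu[OF elim] by simp
    qed
  qed (use w in auto)
qed

text \<open>The highest momentum is determined by the other coordinates and the multipliers, so it is
  corrected along a curve of W0 to satisfy the equations of W1.\<close>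

lemma W1_tangent_exists:
  assumes x: "x \<in> D" "x \<in> W1_set" and l: "residual l (\<xi> x) = 0"
    and d: "\<And>\<alpha>. frechet_derivative (Fc \<alpha>) (at (base_top (\<xi> x))) (base_top d) = 0"
    and ort: "\<And>w. (\<And>\<alpha>. grad_top (Fc \<alpha>) (base_top (\<xi> x)) \<bullet> w = 0) \<Longrightarrow>
      frechet_derivative (residual l) (at (\<xi> x)) d \<bullet> w = 0"
  obtains \<gamma> where "smooth_curve fib_atlas \<gamma>" "near0 \<gamma> W1_set" "\<gamma> 0 = x" "vel c \<gamma> = d"
proof -
  have W0: "x \<in> W0_set M" using x(2) W1_subset by blast
  have z: "base_top (\<xi> x) \<in> Q" "\<And>\<alpha>. Fc \<alpha> (base_top (\<xi> x)) = 0"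
    using D_G[OF x(1)] W0_iff[OF x(1)] W0 by (auto simp: G_def)
  \<comment> \<open>By \<open>ort\<close> the linearized residual is a combination of gradients. Its
    coefficients give the variation of the multiplier, which will be l - t l' along the
    curve.\<close>
  obtain l' :: "real^'m" where l': "frechet_derivative (residual l) (at (\<xi> x)) d
      = (\<Sum>\<alpha>\<in>UNIV. l' $ \<alpha> *\<^sub>R grad_top (Fc \<alpha>) (base_top (\<xi> x)))"
    by (rule orthogonal_to_kernel_imp_row_combination[OF W0_rows_surj[OF x(1) W0] ort])
  obtain g e where g: "e > 0" "g 0 = base_top (\<xi> x)" "smooth_on {-e<..<e} g"
    "vector_derivative g (at 0) = base_top d"
    "\<And>t. t \<in> {-e<..<e} \<Longrightarrow> g t \<in> Q \<and> (\<forall>\<alpha>. Fc \<alpha> (g t) = 0)"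
    by (rule curve_in_constraint[OF z d]) blast
  let ?I = "{-e<..<e}"
  have in0: "0 \<in> ?I" using g(1) by simp
  let ?P = "\<lambda>t. fst (snd (\<xi> x)) + t *\<^sub>R fst (snd d)"
  define g0 where "g0 = (\<lambda>t. (fst (g t), ?P t, snd (g t)))"
  define R where "R = (\<lambda>t. \<Sum>\<alpha>\<in>UNIV. l' $ \<alpha> *\<^sub>R grad_top (Fc \<alpha>) (g t))"
  \<comment> \<open>The residual of \<open>g0 t\<close> for the multiplier l - t l'. Value and
    derivative of Y vanish at 0, so subtracting Y from the highest momentum changes neither the
    initial point nor the velocity.\<close>
  define Y where "Y = (\<lambda>t. residual l (g0 t) - t *\<^sub>R R t)"
  define g1 where "g1 = (\<lambda>t. (fst (g t), ?P t - axis (Max UNIV) (Y t), snd (g t)))"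
  have bt: "base_top (g0 t) = g t" "base_top (g1 t) = g t" for t by (simp_all add: g0_def g1_def)
  have sm0: "smooth_on ?I g0"
    unfolding g0_def
    by (intro smooth_on_Pair smooth_on_fst smooth_on_snd smooth_on_add smooth_on_const
        smooth_on_scaleR smooth_on_id g(3)) auto
  have G0: "g0 t \<in> G" if "t \<in> ?I" for t using g(5)[OF that] by (simp add: G_def bt)
  have smr: "smooth_on ?I (\<lambda>t. residual l (g0 t))"
    by (rule smooth_on_compose[OF _ sm0 smooth_residual G0]) auto
  have smR: "smooth_on ?I R"
    unfolding R_def using g(5)
    by (intro smooth_on_sum smooth_on_scaleR smooth_on_const
        smooth_on_compose[OF _ g(3) smooth_on_grad_top[OF open_Q smooth_Fc]]) auto
  have smY: "smooth_on ?I Y"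
    unfolding Y_def by (intro smooth_on_diff smr smooth_on_scaleR smooth_on_id smR) auto
  have sm1: "smooth_on ?I g1"
    unfolding g1_def
    by (intro smooth_on_Pair smooth_on_fst smooth_on_snd smooth_on_add smooth_on_diff smooth_on_const
        smooth_on_scaleR smooth_on_id g(3) smooth_on_linear_compose[OF _ bounded_linear_axis smY]) auto
  have gd: "(g has_vector_derivative base_top d) (at 0)"
    using smooth_on_has_vector_derivative[OF g(3) in0] g(4) by simp
  have Pd: "(?P has_vector_derivative fst (snd d)) (at 0)"
    by (auto intro!: derivative_eq_intros)
  have g0d: "(g0 has_vector_derivative d) (at 0)"
    unfolding g0_def by (rule prod_has_vector_derivative[OF gd Pd])
  have g0x: "g0 0 = \<xi> x" by (simp add: g0_def g(2) base_top_def)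
  have "((\<lambda>t. residual l (g0 t)) has_vector_derivative R 0) (at 0)"
    using smooth_on_has_vector_derivative[OF smr in0]
      vector_derivative_compose[OF _ _ sm0 smooth_residual in0 G0[OF in0]] vector_derivative_at[OF g0d] in0
    by (simp add: g0x l' R_def g(2))
  moreover have "((\<lambda>t. t *\<^sub>R R t) has_vector_derivative R 0) (at 0)"
    using has_vector_derivative_scaleR[OF DERIV_ident smooth_on_has_vector_derivative[OF smR in0]] by simp
  ultimately have Yd: "(Y has_vector_derivative 0) (at 0)"
    unfolding Y_def using has_vector_derivative_diff by fastforce
  have "((\<lambda>t. ?P t - axis (Max UNIV) (Y t)) has_vector_derivative fst (snd d) - axis (Max UNIV) 0) (at 0)"
    by (intro has_vector_derivative_diff Pd bounded_linear.has_vector_derivative[OF bounded_linear_axis Yd])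
  moreover have ax0: "axis (Max UNIV) 0 = (0 :: ('n, 'k) lower)" by (simp add: vec_eq_iff axis_def)
  ultimately have g1d: "vector_derivative g1 (at 0) = d"
    unfolding g1_def by (intro vector_derivative_at prod_has_vector_derivative[OF gd]) simp
  have Y0: "Y 0 = 0" using l by (simp add: Y_def g0x)
  have g1x: "g1 0 = \<xi> x"
    by (simp add: g1_def g(2) base_top_def Y0 ax0)
  have res: "residual (l + (- t) *\<^sub>R l') (g1 t) = 0" for t
  proof -
    \<comment> \<open>The highest momentum occurs in \<open>residual\<close> with coefficient one,
      so subtracting \<open>Y t\<close> from it lowers the residual by exactly
      \<open>Y t\<close>.\<close>
    have "residual l (g1 t) = residual l (g0 t) - Y t"
      by (simp add: residual_def bt) (simp add: g1_def g0_def axis_def)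
    then show ?thesis
      unfolding residual_linear by (simp add: bt Y_def R_def)
  qed
  obtain \<gamma> r where \<gamma>: "smooth_curve fib_atlas \<gamma>" "\<gamma> 0 = x" "vel c \<gamma> = vector_derivative g1 (at 0)"
    "r > 0" "\<And>t. t \<in> {-r<..<r} \<Longrightarrow> t \<in> ?I \<and> \<gamma> t \<in> D \<and> \<xi> (\<gamma> t) = g1 t"
    by (rule curve_of_coords[OF g(1) sm1 x(1) g1x]) (use g(5) in \<open>auto simp: bt\<close>)
  have "\<gamma> t \<in> W1_set" if "t \<in> {-r<..<r}" for t
  proof -
    have "\<gamma> t \<in> W0_set M"
      using \<gamma>(5)[OF that] g(5)[of t] W0_iff[of "\<gamma> t"] by (simp add: bt)
    then show ?thesis using W1_iff[of "\<gamma> t"] \<gamma>(5)[OF that] res[of t] by auto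
  qed
  then have "near0 \<gamma> W1_set" unfolding near0_def using \<gamma>(4) by blast
  then show ?thesis using that \<gamma>(1-3) g1d by simp
qed

section \<open>Nondegeneracy and the bordered matrix\<close>

definition hess :: "real^'m \<Rightarrow> ('n, 'k) jet_coords \<Rightarrow> 'n \<Rightarrow> 'n \<Rightarrow> real" where
  "hess l z i j = top_partial i (top_partial j Lc) z -
     (\<Sum>\<alpha>\<in>UNIV. l $ \<alpha> * top_partial i (top_partial j (Fc \<alpha>)) z)"

definition jac :: "('n, 'k) jet_coords \<Rightarrow> 'm \<Rightarrow> 'n \<Rightarrow> real" where
  "jac z \<alpha> i = top_partial i (Fc \<alpha>) z"

lemma jac_mult: "(\<Sum>j\<in>UNIV. jac z \<alpha> j * w $ j) = grad_top (Fc \<alpha>) z \<bullet> w"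
  by (simp add: jac_def grad_top_def inner_vec_def)

lemma jac_combination: "(\<Sum>\<alpha>\<in>UNIV. l $ \<alpha> * jac z \<alpha> i) = (\<Sum>\<alpha>\<in>UNIV. l $ \<alpha> *\<^sub>R grad_top (Fc \<alpha>) z) $ i"
  by (simp add: jac_def grad_top_def)

text \<open>Differentiating the multiplier equation in q^(k) produces the upper left block of the
  matrix; the sign arises because L enters \<open>residual\<close> with a minus.\<close>

lemma residual_derivative_vertical:
  assumes "z \<in> G"
  shows "frechet_derivative (residual l) (at z) (0, 0, w) $ i = - (\<Sum>j\<in>UNIV. hess l (base_top z) i j * w $ j)"
proof -
  have zQ: "base_top z \<in> Q" using assms by (simp add: G_def)
  have "(\<Sum>j\<in>UNIV. hess l (base_top z) i j * w $ j)
    = (\<Sum>j\<in>UNIV. top_partial i (top_partial j Lc) (base_top z) * w $ j)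
      - (\<Sum>\<alpha>\<in>UNIV. l $ \<alpha> * (\<Sum>j\<in>UNIV. top_partial i (top_partial j (Fc \<alpha>)) (base_top z) * w $ j))"
  proof -
    have "(\<Sum>j\<in>UNIV. (\<Sum>\<alpha>\<in>UNIV. l $ \<alpha> * top_partial i (top_partial j (Fc \<alpha>)) (base_top z)) * w $ j)
      = (\<Sum>\<alpha>\<in>UNIV. l $ \<alpha> * (\<Sum>j\<in>UNIV. top_partial i (top_partial j (Fc \<alpha>)) (base_top z) * w $ j))"
      unfolding sum_distrib_right sum_distrib_left by (subst sum.swap) (simp add: mult.assoc)
    then show ?thesis by (simp add: hess_def left_diff_distrib sum_subtractf)
  qed
  then show ?thesis
    by (simp add: residual_derivative[OF assms] derivative_grad_top[OF open_Q smooth_Lc zQ]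
        derivative_grad_top[OF open_Q smooth_Fc zQ])
qed

lemma const_curve:
  assumes "x \<in> D"
  shows "smooth_curve fib_atlas (\<lambda>_. x)" "vel c (\<lambda>_. x) = 0"
proof -
  show "smooth_curve fib_atlas (\<lambda>_. x)"
    using D_fib[OF assms] by (intro smooth_curveI[OF fib_chart_in[OF c], of 1]) (auto simp: o_def smooth_on_const)
  show "vel c (\<lambda>_. x) = 0" by (simp add: o_def)
qed

lemma nondegenerate_iff:
  assumes x: "x \<in> D" "x \<in> W1_set" and l: "residual l (\<xi> x) = 0"
  defines "z \<equiv> base_top (\<xi> x)"
  shows "form_kernel fib_atlas W1_set (Omega_W1 k \<A> L M) x = {jet fib_atlas 1 (\<lambda>_. x)} \<longleftrightarrow>
    det (bordered_matrix (hess l z) (jac z) :: real^('n + 'm)^('n + 'm)) \<noteq> 0"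
proof -
  let ?\<Omega> = "Omega_W1 k \<A> L M"
  have W0: "x \<in> W0_set M" using x(2) W1_subset by blast
  have xG: "\<xi> x \<in> G" by (rule D_G[OF x(1)])
  have zQ: "z \<in> Q" using xG by (simp add: G_def z_def)
  note Fdiff = smooth_on_differentiable[OF smooth_Fc zQ]
  note Flin = smooth_on_derivative_linear[OF smooth_Fc zQ]
  let ?DX = "frechet_derivative (residual l) (at (\<xi> x))"
  have DXlin: "linear ?DX" by (rule smooth_on_derivative_linear[OF smooth_residual xG])
  have vert: "?DX (0, 0, w) = - (\<chi> i. \<Sum>j\<in>UNIV. hess l z i j * w $ j)" for w
    using residual_derivative_vertical[OF xG, of l w] by (simp add: vec_eq_iff z_def)
  have const: "near0 (\<lambda>_. x) W1_set" "(\<lambda>_ :: real. x) 0 = x"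
    using x(2) unfolding near0_def by (auto intro: exI[of _ 1])
  note cc = const_curve[OF x(1)]
  have form: "?\<Omega> (jet fib_atlas 1 \<gamma>) (jet fib_atlas 1 \<delta>) = canonical2 (vel c \<gamma>) (vel c \<delta>)"
    if "smooth_curve fib_atlas \<gamma>" "near0 \<gamma> W1_set" "\<gamma> 0 = x" "smooth_curve fib_atlas \<delta>" "near0 \<delta> W1_set" "\<delta> 0 = x"
    for \<gamma> \<delta>
    using Omega_W1_jet[OF c that(1,2,4,5)] that(3,6) D_fib[OF x(1)] by simp
  have const_eq: "jet fib_atlas 1 \<gamma> = jet fib_atlas 1 (\<lambda>_. x) \<longleftrightarrow> vel c \<gamma> = 0"
    if "smooth_curve fib_atlas \<gamma>" "\<gamma> 0 = x" for \<gamma>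
  proof -
    have "jet fib_atlas 1 \<gamma> = jet fib_atlas 1 (\<lambda>_. x) \<longleftrightarrow> contact fib_atlas 1 \<gamma> (\<lambda>_. x)"
      using jet_cong jet_eqD[OF cc(1)] by blast
    also have "\<dots> \<longleftrightarrow> vel c \<gamma> = 0"
      using contact_iff[OF smooth_atlas_fib that(1) cc(1) fib_chart_in[OF c], of 1] that(2) D_fib[OF x(1)] cc(2)
      by (simp add: same_jet_1 del: One_nat_def)
    finally show ?thesis .
  qed
  \<comment> \<open>Restates the kernel condition in terms of velocities, where the jet of the
    constant curve is the zero vector.\<close>
  have kernel: "form_kernel fib_atlas W1_set ?\<Omega> x = {jet fib_atlas 1 (\<lambda>_. x)} \<longleftrightarrow>
    (\<forall>\<gamma>. smooth_curve fib_atlas \<gamma> \<and> near0 \<gamma> W1_set \<and> \<gamma> 0 = x \<and>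
      (\<forall>\<delta>. smooth_curve fib_atlas \<delta> \<and> near0 \<delta> W1_set \<and> \<delta> 0 = x \<longrightarrow> canonical2 (vel c \<gamma>) (vel c \<delta>) = 0)
      \<longrightarrow> vel c \<gamma> = 0)" (is "_ \<longleftrightarrow> ?K")
  proof
    assume k0: "form_kernel fib_atlas W1_set ?\<Omega> x = {jet fib_atlas 1 (\<lambda>_. x)}"
    show ?K
    proof (intro allI impI, elim conjE)
      fix \<gamma> assume \<gamma>: "smooth_curve fib_atlas \<gamma>" "near0 \<gamma> W1_set" "\<gamma> 0 = x"
        and \<delta>: "\<forall>\<delta>. smooth_curve fib_atlas \<delta> \<and> near0 \<delta> W1_set \<and> \<delta> 0 = x \<longrightarrow> canonical2 (vel c \<gamma>) (vel c \<delta>) = 0"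
      have "jet fib_atlas 1 \<gamma> \<in> form_kernel fib_atlas W1_set ?\<Omega> x"
        unfolding form_kernel_def tangent_space_def using \<gamma> \<delta> form by auto
      then show "vel c \<gamma> = 0" using k0 const_eq[OF \<gamma>(1,3)] by simp
    qed
  next
    assume K: ?K
    have "Z = jet fib_atlas 1 (\<lambda>_. x)" if Z: "Z \<in> form_kernel fib_atlas W1_set ?\<Omega> x" for Z
    proof -
      obtain \<gamma> where \<gamma>: "Z = jet fib_atlas 1 \<gamma>" "smooth_curve fib_atlas \<gamma>" "near0 \<gamma> W1_set" "\<gamma> 0 = x"
        using Z unfolding form_kernel_def tangent_space_def by blast
      have "canonical2 (vel c \<gamma>) (vel c \<delta>) = 0"
        if \<delta>: "smooth_curve fib_atlas \<delta>" "near0 \<delta> W1_set" "\<delta> 0 = x" for \<delta>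
      proof -
        have "jet fib_atlas 1 \<delta> \<in> tangent_space fib_atlas W1_set x"
          unfolding tangent_space_def using \<delta> by blast
        then have "?\<Omega> Z (jet fib_atlas 1 \<delta>) = 0" using Z unfolding form_kernel_def by blast
        then show ?thesis using form[OF \<gamma>(2-4) \<delta>] \<gamma>(1) by simp
      qed
      then have "vel c \<gamma> = 0" using K \<gamma>(2-4) by blast
      then show ?thesis using const_eq[OF \<gamma>(2,4)] \<gamma>(1) by simp
    qed
    moreover have "jet fib_atlas 1 (\<lambda>_. x) \<in> form_kernel fib_atlas W1_set ?\<Omega> x"
    proof -
      have "jet fib_atlas 1 (\<lambda>_. x) \<in> tangent_space fib_atlas W1_set x"
        unfolding tangent_space_def using cc(1) const(1) by blast
      moreover have "?\<Omega> (jet fib_atlas 1 (\<lambda>_. x)) Y = 0" if Y: "Y \<in> tangent_space fib_atlas W1_set x" for Y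
      proof -
        obtain \<delta> where "Y = jet fib_atlas 1 \<delta>" "smooth_curve fib_atlas \<delta>" "near0 \<delta> W1_set" "\<delta> 0 = x"
          using Y unfolding tangent_space_def by blast
        then show ?thesis using form[OF cc(1) const] cc(2) by (simp add: canonical2_def)
      qed
      ultimately show ?thesis unfolding form_kernel_def by blast
    qed
    ultimately show "form_kernel fib_atlas W1_set ?\<Omega> x = {jet fib_atlas 1 (\<lambda>_. x)}" by blast
  qed
  show ?thesis
  proof (intro iffI)
    assume "form_kernel fib_atlas W1_set ?\<Omega> x = {jet fib_atlas 1 (\<lambda>_. x)}"
    then have K: ?K using kernel by blast
    show "det (bordered_matrix (hess l z) (jac z) :: real^('n + 'm)^('n + 'm)) \<noteq> 0"
    proof
      assume "det (bordered_matrix (hess l z) (jac z) :: real^('n + 'm)^('n + 'm)) = 0"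
      then obtain w :: "real^'n" and q :: "real^'m" where wq: "w \<noteq> 0 \<or> q \<noteq> 0"
        "\<And>i. (\<Sum>j\<in>UNIV. hess l z i j * w $ j) - (\<Sum>\<alpha>\<in>UNIV. q $ \<alpha> * jac z \<alpha> i) = 0"
        "\<And>\<beta>. (\<Sum>j\<in>UNIV. jac z \<beta> j * w $ j) = 0"
        unfolding bordered_matrix_kernel by blast
      have comb: "(\<chi> i. \<Sum>j\<in>UNIV. hess l z i j * w $ j) = (\<Sum>\<alpha>\<in>UNIV. q $ \<alpha> *\<^sub>R grad_top (Fc \<alpha>) z)"
        using wq(2) by (simp add: vec_eq_iff jac_combination del: sum_component)
      have ker: "grad_top (Fc \<alpha>) z \<bullet> w = 0" for \<alpha>
        using wq(3) by (simp add: jac_mult)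
      \<comment> \<open>A solution might consist of multipliers alone, which would give no tangent
        vector; independence of the gradients excludes this.\<close>
      have w: "w \<noteq> 0"
      proof
        assume "w = 0"
        then have "(\<Sum>\<alpha>\<in>UNIV. q $ \<alpha> *\<^sub>R grad_top (Fc \<alpha>) z) = 0"
          using comb by (simp add: vec_eq_iff del: sum_component)
        then have "q = 0" unfolding z_def by (rule rows_independent[OF W0_rows_surj[OF x(1) W0]])
        then show False using wq(1) \<open>w = 0\<close> by simp
      qed
      obtain \<gamma> where \<gamma>: "smooth_curve fib_atlas \<gamma>" "near0 \<gamma> W1_set" "\<gamma> 0 = x" "vel c \<gamma> = (0, 0, w)"
      proof (rule W1_tangent_exists[OF x l])
        show "frechet_derivative (Fc \<alpha>) (at (base_top (\<xi> x))) (base_top (0, 0, w)) = 0" for \<alpha>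
          using ker by (simp add: derivative_top[OF Fdiff] flip: z_def)
        show "?DX (0, 0, w) \<bullet> v = 0" if "\<And>\<alpha>. grad_top (Fc \<alpha>) (base_top (\<xi> x)) \<bullet> v = 0" for v
          using that unfolding vert comb by (simp add: inner_sum_left z_def)
      qed blast
      have "vel c \<gamma> = 0"
      proof (rule K[rule_format], intro conjI allI impI)
        fix \<delta> assume \<delta>: "smooth_curve fib_atlas \<delta> \<and> near0 \<delta> W1_set \<and> \<delta> 0 = x"
        show "canonical2 (vel c \<gamma>) (vel c \<delta>) = 0" by (simp add: canonical2_def \<gamma>(4))
      qed (use \<gamma> in auto)
      then show False using w \<gamma>(4) by (simp add: zero_prod_def)
    qed
  next
    assume det: "det (bordered_matrix (hess l z) (jac z) :: real^('n + 'm)^('n + 'm)) \<noteq> 0"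
    have ?K
    proof (intro allI impI, elim conjE)
      fix \<gamma> assume \<gamma>: "smooth_curve fib_atlas \<gamma>" "near0 \<gamma> W1_set" "\<gamma> 0 = x"
        and \<delta>: "\<forall>\<delta>. smooth_curve fib_atlas \<delta> \<and> near0 \<delta> W1_set \<and> \<delta> 0 = x \<longrightarrow> canonical2 (vel c \<gamma>) (vel c \<delta>) = 0"
      have pair: "fst (vel c \<gamma>) \<bullet> b - a \<bullet> fst (snd (vel c \<gamma>)) = 0" for a b
      proof -
        \<comment> \<open>The right-hand sides are chosen for (a, b, w): the first block turns its
          linearized residual into a combination of gradients with coefficients - q, and the second
          makes it satisfy the linearized constraints.\<close>
        obtain w :: "real^'n" and q :: "real^'m" where
          w1: "\<And>i. (\<Sum>j\<in>UNIV. hess l z i j * w $ j) - (\<Sum>\<alpha>\<in>UNIV. q $ \<alpha> * jac z \<alpha> i) = ?DX (a, b, 0) $ i" and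
          w2: "\<And>\<beta>. (\<Sum>j\<in>UNIV. jac z \<beta> j * w $ j) = - frechet_derivative (Fc \<beta>) (at z) (a, 0)"
          using bordered_matrix_solvable[OF det, where f = "\<lambda>i. ?DX (a, b, 0) $ i"
              and g = "\<lambda>\<beta>. - frechet_derivative (Fc \<beta>) (at z) (a, 0)"] by blast
        have "?DX (a, b, w) = ?DX (a, b, 0) + ?DX (0, 0, w)"
          using linear_add[OF DXlin, of "(a, b, 0)" "(0, 0, w)"] by simp
        also have "\<dots> = - (\<Sum>\<alpha>\<in>UNIV. q $ \<alpha> *\<^sub>R grad_top (Fc \<alpha>) z)"
          unfolding vert using w1 by (simp add: vec_eq_iff jac_combination[symmetric] del: sum_component) (simp add: algebra_simps)
        finally have DX: "?DX (a, b, w) = - (\<Sum>\<alpha>\<in>UNIV. q $ \<alpha> *\<^sub>R grad_top (Fc \<alpha>) z)" .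
        obtain \<delta>' where \<delta>': "smooth_curve fib_atlas \<delta>'" "near0 \<delta>' W1_set" "\<delta>' 0 = x" "vel c \<delta>' = (a, b, w)"
        proof (rule W1_tangent_exists[OF x l])
          show "frechet_derivative (Fc \<alpha>) (at (base_top (\<xi> x))) (base_top (a, b, w)) = 0" for \<alpha>
            using linear_add[OF Flin, of \<alpha> "(a, 0)" "(0, w)"] w2[of \<alpha>]
            by (simp add: derivative_top[OF Fdiff] jac_mult flip: z_def)
          show "?DX (a, b, w) \<bullet> v = 0" if "\<And>\<alpha>. grad_top (Fc \<alpha>) (base_top (\<xi> x)) \<bullet> v = 0" for v
            using that unfolding DX by (simp add: inner_sum_left z_def)
        qed blast
        have "canonical2 (vel c \<gamma>) (vel c \<delta>') = 0" using \<delta> \<delta>'(1-3) by blast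
        then show ?thesis by (simp add: canonical2_def \<delta>'(4))
      qed
      have "fst (vel c \<gamma>) = 0" "fst (snd (vel c \<gamma>)) = 0"
        using pair[of "fst (vel c \<gamma>)" 0] pair[of 0 "fst (snd (vel c \<gamma>))"] by simp_all
      then obtain w where w: "vel c \<gamma> = (0, 0, w)" by (metis prod.collapse)
      have ker: "grad_top (Fc \<alpha>) z \<bullet> w = 0" for \<alpha>
        using W0_tangent_imp[OF \<gamma>(1) near0_mono[OF \<gamma>(2) W1_subset], of \<alpha>] x(1)
        by (simp add: \<gamma>(3) w derivative_top[OF Fdiff] flip: z_def)
      have "?DX (0, 0, w) \<bullet> v = 0" if "\<And>\<alpha>. grad_top (Fc \<alpha>) (base_top (\<xi> x)) \<bullet> v = 0" for v
        using W1_tangent_imp[OF \<gamma>(1,2), of l v] x(1) l that by (simp add: \<gamma>(3) w)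
      then obtain q :: "real^'m" where "?DX (0, 0, w) = (\<Sum>\<alpha>\<in>UNIV. q $ \<alpha> *\<^sub>R grad_top (Fc \<alpha>) (base_top (\<xi> x)))"
        using orthogonal_to_kernel_imp_row_combination[OF W0_rows_surj[OF x(1) W0]] by blast
      \<comment> \<open>The minus sign in \<open>vert\<close> makes (w, - q) the solution of the
        homogeneous bordered system.\<close>
      then have "(\<chi> i. \<Sum>j\<in>UNIV. hess l z i j * w $ j) = (\<Sum>\<alpha>\<in>UNIV. (- q) $ \<alpha> *\<^sub>R grad_top (Fc \<alpha>) z)"
        unfolding vert by (simp add: sum_negf minus_equation_iff flip: z_def)
      then have "(\<Sum>j\<in>UNIV. hess l z i j * w $ j) - (\<Sum>\<alpha>\<in>UNIV. (- q) $ \<alpha> * jac z \<alpha> i) = 0" for i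
        unfolding jac_combination by (metis (no_types, lifting) right_minus_eq vec_lambda_beta)
      moreover have "(\<Sum>j\<in>UNIV. jac z \<beta> j * w $ j) = 0" for \<beta>
        using ker by (simp add: jac_mult)
      ultimately have "w = 0"
        using det unfolding bordered_matrix_kernel by blast
      then show "vel c \<gamma> = 0" by (simp add: w zero_prod_def)
    qed
    then show "form_kernel fib_atlas W1_set ?\<Omega> x = {jet fib_atlas 1 (\<lambda>_. x)}" using kernel by blast
  qed
qed

end

section \<open>The two-form on the primary constraint set\<close>

lemma bounded_bilinear_canonical2: "bounded_bilinear canonical2"
  unfolding bilinear_conv_bounded_bilinear[symmetric] bilinear_def linear_iff canonical2_def
  by (simp add: inner_add_left inner_add_right algebra_simps)

lemma canonical2_antisym: "canonical2 a b = - canonical2 b a"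
  by (simp add: canonical2_def)

context jet_bundle
begin

text \<open>In slice coordinates the form is the constant form \<open>canonical2\<close> pulled back
  by the parametrization \<open>inv_into D \<Psi>\<close> of W1 in fibre coordinates. Bilinearity,
  smoothness and closedness all follow from this expression.\<close>

lemma form_coeff_W1:
  assumes c: "c \<in> \<A>" and sl: "slice_in (fib_chart c) (W1 k \<A> L M) D \<Psi> P"
    and y: "y \<in> P \<inter> \<Psi> ` D" and ab: "a \<in> P" "b \<in> P"
  shows "form_coeff fib_atlas (Omega_W1 k \<A> L M) (fib_chart c) D \<Psi> y a b
    = canonical2 (frechet_derivative (inv_into D \<Psi>) (at y) a) (frechet_derivative (inv_into D \<Psi>) (at y) b)"
proof -
  let ?S = "W1 k \<A> L M" and ?\<Theta> = "inv_into D \<Psi>"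
  let ?\<psi> = "inv_into (fst (fib_chart c)) (snd (fib_chart c)) \<circ> ?\<Theta>"
  have D: "open (\<Psi> ` D)" "inj_on \<Psi> D" "smooth_on (\<Psi> ` D) ?\<Theta>" "subspace P"
    "\<Psi> ` (snd (fib_chart c) ` (?S \<inter> fst (fib_chart c)) \<inter> D) = P \<inter> \<Psi> ` D"
    using sl by (auto simp: slice_in_def slice_def)
  have in_S: "?\<psi> z \<in> ?S \<and> ?\<psi> z \<in> fst (fib_chart c) \<and> snd (fib_chart c) (?\<psi> z) = ?\<Theta> z" if z: "z \<in> P \<inter> \<Psi> ` D" for z
  proof -
    obtain q where q: "z = \<Psi> q" "q \<in> snd (fib_chart c) ` (?S \<inter> fst (fib_chart c)) \<inter> D"
      using z unfolding D(5)[symmetric] by (rule imageE)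
    then obtain x where x: "q = snd (fib_chart c) x" "x \<in> ?S" "x \<in> fst (fib_chart c)" by blast
    have "?\<Theta> z = q" using q D(2) by simp
    then show ?thesis using x inj_on_fib_chart[OF c] by simp
  qed
  have curve: "smooth_curve fib_atlas (\<lambda>t. ?\<psi> (y + t *\<^sub>R a)) \<and> near0 (\<lambda>t. ?\<psi> (y + t *\<^sub>R a)) ?S \<and>
      vel c (\<lambda>t. ?\<psi> (y + t *\<^sub>R a)) = frechet_derivative ?\<Theta> (at y) a" if a: "a \<in> P" for a
  proof -
    let ?l = "\<lambda>t::real. y + t *\<^sub>R a"
    have "open (?l -` (\<Psi> ` D))"
      using D(1) by (intro open_vimage) (auto intro!: continuous_intros)
    moreover have "0 \<in> ?l -` (\<Psi> ` D)" using y by simp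
    ultimately obtain e where e: "e > 0" "{-e<..<e} \<subseteq> ?l -` (\<Psi> ` D)"
      by (rule open_interval_subset)
    have lP: "?l t \<in> P \<inter> \<Psi> ` D" if "t \<in> {-e<..<e}" for t
      using e(2) that y a D(4) by (auto intro: subspace_add subspace_scale)
    have l: "smooth_on {-e<..<e} ?l"
      by (intro smooth_on_add smooth_on_const smooth_on_scaleR smooth_on_id) auto
    have sm: "smooth_on {-e<..<e} (\<lambda>t. ?\<Theta> (?l t))"
      by (rule smooth_on_compose[OF _ l D(3)]) (use lP in auto)
    have "smooth_on {-e<..<e} (snd (fib_chart c) \<circ> (\<lambda>t. ?\<psi> (?l t)))"
      by (rule smooth_on_cong[OF _ sm]) (use in_S[OF lP] in auto)
    then have 1: "smooth_curve fib_atlas (\<lambda>t. ?\<psi> (?l t))"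
      using in_S[OF lP] e(1) by (intro smooth_curveI[OF fib_chart_in[OF c], of e]) auto
    have 2: "near0 (\<lambda>t. ?\<psi> (?l t)) ?S" unfolding near0_def using in_S[OF lP] e(1) by blast
    have "vel c (\<lambda>t. ?\<psi> (?l t)) = vector_derivative (\<lambda>t. ?\<Theta> (?l t)) (at 0)"
      using in_S[OF lP] e(1) by (intro vector_derivative_cong_open[of "{-e<..<e}"]) auto
    also have "\<dots> = frechet_derivative ?\<Theta> (at (?l 0)) (vector_derivative ?l (at 0))"
      using e(1) y by (intro vector_derivative_compose[OF _ _ l D(3)]) auto
    also have "vector_derivative ?l (at 0) = a"
      by (rule vector_derivative_at) (auto intro!: derivative_eq_intros)
    finally show ?thesis using 1 2 by (simp add: o_def)
  qed
  have "?\<psi> (y + 0 *\<^sub>R a) \<in> fst (fib_chart c)" using in_S[OF y] by simp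
  then show ?thesis
    unfolding form_coeff_def Let_def
    using Omega_W1_jet[OF c, of "\<lambda>t. ?\<psi> (y + t *\<^sub>R a)" L M "\<lambda>t. ?\<psi> (y + t *\<^sub>R b)"] curve[OF ab(1)] curve[OF ab(2)]
    by (simp del: One_nat_def comp_apply)
qed

lemma two_form_W1: "two_form fib_atlas (W1 k \<A> L M) (Omega_W1 k \<A> L M)"
  unfolding two_form_def
proof (intro ballI allI impI)
  fix c' D \<Psi> P assume "c' \<in> fib_atlas" and sl: "slice_in c' (W1 k \<A> L M) D \<Psi> P"
  then obtain c where c: "c \<in> \<A>" "c' = fib_chart c" by (auto simp: fibre_atlas_def)
  note fc = form_coeff_W1[OF c(1) sl[unfolded c(2)]]
  have D: "open (\<Psi> ` D)" "smooth_on (\<Psi> ` D) (inv_into D \<Psi>)" "subspace P"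
    using sl by (auto simp: slice_in_def slice_def)
  show "(\<forall>y\<in>P \<inter> \<Psi> ` D. \<forall>a\<in>P. \<forall>b\<in>P. \<forall>b'\<in>P. \<forall>s.
           form_coeff fib_atlas (Omega_W1 k \<A> L M) c' D \<Psi> y a b = - form_coeff fib_atlas (Omega_W1 k \<A> L M) c' D \<Psi> y b a \<and>
           form_coeff fib_atlas (Omega_W1 k \<A> L M) c' D \<Psi> y a (s *\<^sub>R b + b') =
             s * form_coeff fib_atlas (Omega_W1 k \<A> L M) c' D \<Psi> y a b + form_coeff fib_atlas (Omega_W1 k \<A> L M) c' D \<Psi> y a b') \<and>
        (\<forall>a\<in>P. \<forall>b\<in>P. \<exists>h. smooth_on (\<Psi> ` D) h \<and>
           (\<forall>y\<in>P \<inter> \<Psi> ` D. form_coeff fib_atlas (Omega_W1 k \<A> L M) c' D \<Psi> y a b = h y))"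
  proof (intro conjI ballI allI)
    fix y a b b' s assume *: "y \<in> P \<inter> \<Psi> ` D" "a \<in> P" "b \<in> P" "b' \<in> P"
    have lin: "linear (frechet_derivative (inv_into D \<Psi>) (at y))"
      using * by (intro smooth_on_derivative_linear[OF D(2)]) auto
    show "form_coeff fib_atlas (Omega_W1 k \<A> L M) c' D \<Psi> y a b = - form_coeff fib_atlas (Omega_W1 k \<A> L M) c' D \<Psi> y b a"
      unfolding c(2) fc[OF *(1,2,3)] fc[OF *(1,3,2)] by (rule canonical2_antisym)
    have "s *\<^sub>R b + b' \<in> P" using * D(3) by (auto intro: subspace_add subspace_scale)
    then show "form_coeff fib_atlas (Omega_W1 k \<A> L M) c' D \<Psi> y a (s *\<^sub>R b + b') =
             s * form_coeff fib_atlas (Omega_W1 k \<A> L M) c' D \<Psi> y a b + form_coeff fib_atlas (Omega_W1 k \<A> L M) c' D \<Psi> y a b'"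
      unfolding c(2) using *
      by (simp add: fc linear_add[OF lin] linear_cmul[OF lin]
          bounded_bilinear.add_right[OF bounded_bilinear_canonical2]
          bounded_bilinear.scaleR_right[OF bounded_bilinear_canonical2])
  next
    fix a b assume ab: "a \<in> P" "b \<in> P"
    show "\<exists>h. smooth_on (\<Psi> ` D) h \<and>
           (\<forall>y\<in>P \<inter> \<Psi> ` D. form_coeff fib_atlas (Omega_W1 k \<A> L M) c' D \<Psi> y a b = h y)"
    proof (intro exI conjI ballI)
      \<comment> \<open>\<open>two_form\<close> asks for a smooth extension off P; the pulled back
        expression makes sense on the whole image of D under \<open>\<Psi>\<close>.\<close>
      show "smooth_on (\<Psi> ` D) (\<lambda>y. canonical2 (frechet_derivative (inv_into D \<Psi>) (at y) a)
          (frechet_derivative (inv_into D \<Psi>) (at y) b))"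
        by (intro smooth_on_bilinear[OF D(1) bounded_bilinear_canonical2] smooth_on_derivative D(2))
    qed (use ab fc in \<open>simp add: c(2)\<close>)
  qed
qed

text \<open>The pullback of the constant form is closed by symmetry of the second derivatives of the
  parametrization.\<close>

lemma closed_form_W1: "closed_form fib_atlas (W1 k \<A> L M) (Omega_W1 k \<A> L M)"
  unfolding closed_form_def
proof (intro ballI allI impI)
  fix c' D \<Psi> P y a1 a2 a3
  assume "c' \<in> fib_atlas" and sl: "slice_in c' (W1 k \<A> L M) D \<Psi> P"
    and y: "y \<in> P \<inter> \<Psi> ` D" and a: "a1 \<in> P" "a2 \<in> P" "a3 \<in> P"
  then obtain c where c: "c \<in> \<A>" "c' = fib_chart c" by (auto simp: fibre_atlas_def)
  note fc = form_coeff_W1[OF c(1) sl[unfolded c(2)]]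
  let ?\<Theta> = "inv_into D \<Psi>"
  have D: "open (\<Psi> ` D)" "smooth_on (\<Psi> ` D) ?\<Theta>" "subspace P"
    using sl by (auto simp: slice_in_def slice_def)
  have yD: "y \<in> \<Psi> ` D" using y by simp
  let ?d = "\<lambda>a. frechet_derivative ?\<Theta> (at y) a"
  let ?d2 = "\<lambda>a b. frechet_derivative (\<lambda>y. frechet_derivative ?\<Theta> (at y) a) (at y) b"
  have der: "deriv (\<lambda>t. form_coeff fib_atlas (Omega_W1 k \<A> L M) c' D \<Psi> (y + t *\<^sub>R a) b b') 0
      = canonical2 (?d2 b a) (?d b') + canonical2 (?d b) (?d2 b' a)" if a: "a \<in> P" "b \<in> P" "b' \<in> P" for a b b'
  proof -
    let ?l = "\<lambda>t::real. y + t *\<^sub>R a"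
    have "open (?l -` (\<Psi> ` D))"
      using D(1) by (intro open_vimage) (auto intro!: continuous_intros)
    moreover have "0 \<in> ?l -` (\<Psi> ` D)" using y by simp
    ultimately obtain e where e: "e > 0" "{-e<..<e} \<subseteq> ?l -` (\<Psi> ` D)"
      by (rule open_interval_subset)
    have l: "(?l has_vector_derivative a) (at 0)" by (auto intro!: derivative_eq_intros)
    have v: "((\<lambda>t. frechet_derivative ?\<Theta> (at (?l t)) b) has_vector_derivative ?d2 b a) (at 0)" for b
    proof -
      have "((\<lambda>y. frechet_derivative ?\<Theta> (at y) b) has_derivative ?d2 b) (at (?l 0) within range ?l)"
        using smooth_on_has_derivative[OF smooth_on_derivative[OF D(2), of b] yD]
        by (simp add: has_derivative_at_withinI)
      from vector_derivative_diff_chain_within[of ?l, OF l this] show ?thesis by (simp add: o_def)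
    qed
    have "((\<lambda>t. canonical2 (frechet_derivative ?\<Theta> (at (?l t)) b) (frechet_derivative ?\<Theta> (at (?l t)) b'))
       has_vector_derivative canonical2 (?d b) (?d2 b' a) + canonical2 (?d2 b a) (?d b')) (at 0)"
      using bounded_bilinear.has_vector_derivative[OF bounded_bilinear_canonical2 v v, of b b'] by simp
    then have "((\<lambda>t. form_coeff fib_atlas (Omega_W1 k \<A> L M) c' D \<Psi> (?l t) b b')
       has_vector_derivative canonical2 (?d b) (?d2 b' a) + canonical2 (?d2 b a) (?d b')) (at 0)"
    proof (rule has_vector_derivative_transform_within_open)
      show "0 \<in> {-e<..<e}" using e by simp
      fix t assume "t \<in> {-e<..<e}"
      then have "?l t \<in> P \<inter> \<Psi> ` D"
        using e(2) y a(1) D(3) by (auto intro: subspace_add subspace_scale)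
      then show "canonical2 (frechet_derivative ?\<Theta> (at (?l t)) b) (frechet_derivative ?\<Theta> (at (?l t)) b')
         = form_coeff fib_atlas (Omega_W1 k \<A> L M) c' D \<Psi> (?l t) b b'"
        using fc a(2,3) by (simp add: c(2))
    qed simp
    then show ?thesis
      by (intro DERIV_imp_deriv) (simp add: has_real_derivative_iff_has_vector_derivative add.commute)
  qed
  have sym: "?d2 a b = ?d2 b a" for a b by (rule second_derivative_symmetric[OF D(1,2) yD])
  show "deriv (\<lambda>t. form_coeff fib_atlas (Omega_W1 k \<A> L M) c' D \<Psi> (y + t *\<^sub>R a1) a2 a3) 0 +
           deriv (\<lambda>t. form_coeff fib_atlas (Omega_W1 k \<A> L M) c' D \<Psi> (y + t *\<^sub>R a2) a3 a1) 0 +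
           deriv (\<lambda>t. form_coeff fib_atlas (Omega_W1 k \<A> L M) c' D \<Psi> (y + t *\<^sub>R a3) a1 a2) 0 = 0"
    unfolding der[OF a] der[OF a(2,3,1)] der[OF a(3,1,2)]
    \<comment> \<open>The product rule yields six terms, which cancel in pairs by antisymmetry of
      the form and symmetry of the second derivatives.\<close>
    using canonical2_antisym[of "?d2 a2 a1" "?d a3"] canonical2_antisym[of "?d2 a3 a1" "?d a2"]
      canonical2_antisym[of "?d2 a3 a2" "?d a1"] sym[of a1 a2] sym[of a1 a3] sym[of a2 a3]
    by simp
qed

text \<open>Form and closedness conditions hold automatically, so only the triviality of the kernels
  is at stake.\<close>

lemma symplectic_W1_iff:
  assumes "submanifold fib_atlas (W1 k \<A> L M)"
  shows "symplectic_manifold fib_atlas (W1 k \<A> L M) (Omega_W1 k \<A> L M) \<longleftrightarrow>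
    (\<forall>x\<in>W1 k \<A> L M. form_kernel fib_atlas (W1 k \<A> L M) (Omega_W1 k \<A> L M) x = {jet fib_atlas 1 (\<lambda>_. x)})"
  using assms two_form_W1 closed_form_W1 by (simp add: symplectic_manifold_def)

end

context constrained_system
begin

section \<open>The two determinants\<close>

lemma top_partial_combination:
  assumes z: "z \<in> Q"
  shows "top_partial i (local_rep (full_chart c) (\<lambda>p. L p - (\<Sum>\<alpha>\<in>UNIV. l $ \<alpha> * \<Phi> p $ \<alpha>))) z
    = top_partial i Lc z - (\<Sum>\<alpha>\<in>UNIV. l $ \<alpha> * top_partial i (Fc \<alpha>) z)"
proof -
  have "local_rep (full_chart c) (\<lambda>p. L p - (\<Sum>\<alpha>\<in>UNIV. l $ \<alpha> * \<Phi> p $ \<alpha>))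
      = (\<lambda>z. Lc z - (\<Sum>\<alpha>\<in>UNIV. l $ \<alpha> * Fc \<alpha> z))"
    by (simp add: fun_eq_iff local_rep_def Lc_def Fc_def)
  moreover have "((\<lambda>z. Lc z - (\<Sum>\<alpha>\<in>UNIV. l $ \<alpha> * Fc \<alpha> z)) has_derivative
      (\<lambda>d. frechet_derivative Lc (at z) d - (\<Sum>\<alpha>\<in>UNIV. l $ \<alpha> * frechet_derivative (Fc \<alpha>) (at z) d))) (at z)"
    by (intro has_derivative_diff has_derivative_sum has_derivative_mult_right
        smooth_on_has_derivative[OF smooth_Lc z] smooth_on_has_derivative[OF smooth_Fc z])
  ultimately show ?thesis
    by (simp add: top_partial_def frechet_derivative_eqI)
qed

text \<open>The vector l is fixed before differentiating, so no derivatives of multipliers arise.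
  This is the source of the equality of the two determinants in the theorem.\<close>

lemma hess_combination:
  assumes z: "z \<in> Q"
  shows "top_partial i (top_partial j (local_rep (full_chart c) (\<lambda>p. L p - (\<Sum>\<alpha>\<in>UNIV. l $ \<alpha> * \<Phi> p $ \<alpha>)))) z
    = hess l z i j"
proof -
  let ?LL = "local_rep (full_chart c) (\<lambda>p. L p - (\<Sum>\<alpha>\<in>UNIV. l $ \<alpha> * \<Phi> p $ \<alpha>))"
  have "((\<lambda>z. top_partial j Lc z - (\<Sum>\<alpha>\<in>UNIV. l $ \<alpha> * top_partial j (Fc \<alpha>) z)) has_derivative
      (\<lambda>d. frechet_derivative (top_partial j Lc) (at z) d
        - (\<Sum>\<alpha>\<in>UNIV. l $ \<alpha> * frechet_derivative (top_partial j (Fc \<alpha>)) (at z) d))) (at z)"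
    by (intro has_derivative_diff has_derivative_sum has_derivative_mult_right
        smooth_on_has_derivative[OF smooth_on_top_partial[OF smooth_Lc] z]
        smooth_on_has_derivative[OF smooth_on_top_partial[OF smooth_Fc] z])
  \<comment> \<open>The first-order formula holds throughout the open set Q and may therefore be
    differentiated again.\<close>
  from has_derivative_transform_within_open[OF this open_Q z, of "top_partial j ?LL"]
  have "(top_partial j ?LL has_derivative
      (\<lambda>d. frechet_derivative (top_partial j Lc) (at z) d
        - (\<Sum>\<alpha>\<in>UNIV. l $ \<alpha> * frechet_derivative (top_partial j (Fc \<alpha>)) (at z) d))) (at z)"
    by (simp add: top_partial_combination)
  from frechet_derivative_eqI[OF this] show ?thesis
    by (simp add: hess_def top_partial_def[of i])
qed

lemma determinant_condition:
  assumes x: "x \<in> W1 k \<A> L M" "x \<in> D"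
  shows "(let d = full_chart c;
             z = snd d (snd x);
             l = multiplier k \<A> L \<Phi> c x;
             LL = (\<lambda>p. L p - (\<Sum>\<alpha>\<in>UNIV. l $ \<alpha> * \<Phi> p $ \<alpha>));
             B = (\<lambda>\<alpha> i. top_partial i (local_rep d (\<lambda>p. \<Phi> p $ \<alpha>)) z);
             D1 = det (bordered_matrix
                    (\<lambda>i j. top_partial i (top_partial j (local_rep d LL)) z) B);
             D2 = det (bordered_matrix
                    (\<lambda>i j. top_partial i (top_partial j (local_rep d L)) z -
                       (\<Sum>\<alpha>\<in>UNIV. l $ \<alpha> *
                          top_partial i (top_partial j (local_rep d (\<lambda>p. \<Phi> p $ \<alpha>))) z)) B)
         in D1 = D2 \<and> D1 \<noteq> 0) \<longleftrightarrow>
    form_kernel fib_atlas (W1 k \<A> L M) (Omega_W1 k \<A> L M) x = {jet fib_atlas 1 (\<lambda>_. x)}"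
proof -
  have W0: "x \<in> W0_set M" using x(1) W1_subset by blast
  obtain l where l: "residual l (\<xi> x) = 0" using W1_iff[OF x(2) W0] x(1) by blast
  have m: "multiplier k \<A> L \<Phi> c x = l" by (rule multiplier_eq[OF x(2) W0 l])
  have z: "snd (full_chart c) (snd x) = base_top (\<xi> x)"
    using fib_chart_parts(4)[OF c D_fib[OF x(2)]] by (simp add: base_top_def)
  have zQ: "base_top (\<xi> x) \<in> Q" using D_G[OF x(2)] by (simp add: G_def)
  have B: "(\<lambda>\<alpha> i. top_partial i (local_rep (full_chart c) (\<lambda>p. \<Phi> p $ \<alpha>)) (base_top (\<xi> x))) = jac (base_top (\<xi> x))"
    by (simp add: fun_eq_iff jac_def Fc_def)
  have H1: "(\<lambda>i j. top_partial i (top_partial j (local_rep (full_chart c) (\<lambda>p. L p - (\<Sum>\<alpha>\<in>UNIV. l $ \<alpha> * \<Phi> p $ \<alpha>)))) (base_top (\<xi> x)))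
      = hess l (base_top (\<xi> x))"
    by (simp add: fun_eq_iff hess_combination[OF zQ])
  have H2: "(\<lambda>i j. top_partial i (top_partial j (local_rep (full_chart c) L)) (base_top (\<xi> x)) -
      (\<Sum>\<alpha>\<in>UNIV. l $ \<alpha> * top_partial i (top_partial j (local_rep (full_chart c) (\<lambda>p. \<Phi> p $ \<alpha>))) (base_top (\<xi> x))))
      = hess l (base_top (\<xi> x))"
    by (simp add: fun_eq_iff hess_def Lc_def Fc_def)
  show ?thesis
    unfolding Let_def m z B H1 H2 nondegenerate_iff[OF x(2,1) l] by simp
qed

end

theorem theorem4p1:
  fixes X :: "'q topology"
    and \<A> :: "('q, real^'n) chart set"
    and k :: "'k::{finite, linorder} itself"
    and L :: "'q jet \<Rightarrow> real"
    and M :: "'q jet set"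
    and F :: "('q jet set \<times> ('q jet \<Rightarrow> real^'m)) set"
  assumes manifold: "smooth_manifold X \<A>"
    and L: "smooth_fun (Tk_atlas \<A> :: ('q jet, ('n, 'k) jet_coords) chart set)
              (jet_space \<A> CARD('k)) L"
    and M: "submanifold (Tk_atlas \<A> :: ('q jet, ('n, 'k) jet_coords) chart set) M"
    and F: "\<And>V \<Phi>. (V, \<Phi>) \<in> F \<Longrightarrow> defining_functions k \<A> M V \<Phi>"
    and F_cover: "M \<subseteq> \<Union> (fst ` F)"
    and W1: "submanifold (fibre_atlas \<A> ::
                 ('q fibre_point, ('n, 'k) fibre_coords) chart set)
               (W1 k \<A> L M)"
  shows "symplectic_manifold (fibre_atlas \<A> ::
             ('q fibre_point, ('n, 'k) fibre_coords) chart set)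
           (W1 k \<A> L M) (Omega_W1 k \<A> L M)
     \<longleftrightarrow>
     (\<forall>c\<in>\<A>. \<forall>(V, \<Phi>)\<in>F. \<forall>x\<in>W1 k \<A> L M. jet_base (snd x) \<in> fst c \<and> snd x \<in> V \<longrightarrow>
        (let d = (Tk_chart \<A> c :: ('q jet, ('n, 'k) jet_coords) chart);
             z = snd d (snd x);
             l = multiplier k \<A> L \<Phi> c x;
             LL = (\<lambda>p. L p - (\<Sum>\<alpha>\<in>UNIV. l $ \<alpha> * \<Phi> p $ \<alpha>));
             B = (\<lambda>\<alpha> i. top_partial i (local_rep d (\<lambda>p. \<Phi> p $ \<alpha>)) z);
             D1 = det (bordered_matrix
                    (\<lambda>i j. top_partial i (top_partial j (local_rep d LL)) z) B);
             D2 = det (bordered_matrix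
                    (\<lambda>i j. top_partial i (top_partial j (local_rep d L)) z -
                       (\<Sum>\<alpha>\<in>UNIV. l $ \<alpha> *
                          top_partial i (top_partial j (local_rep d (\<lambda>p. \<Phi> p $ \<alpha>))) z)) B)
         in D1 = D2 \<and> D1 \<noteq> 0))"
proof -
  interpret jb: jet_bundle \<A> k
    by unfold_locales (rule smooth_manifold_atlas[OF manifold])
  let ?W1 = "W1 k \<A> L M"
  let ?ker = "\<lambda>x. form_kernel jb.fib_atlas ?W1 (Omega_W1 k \<A> L M) x = {jet jb.fib_atlas 1 (\<lambda>_. x)}"
  have cs: "constrained_system \<A> k L M c V \<Phi>" if "c \<in> \<A>" "(V, \<Phi>) \<in> F" for c V \<Phi>
    by unfold_locales (use L M that F[OF that(2)] in auto)
  have dom: "x \<in> constrained_system.D TYPE('k) \<A> c V"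
    if "c \<in> \<A>" "(V, \<Phi>) \<in> F" "x \<in> ?W1" "jet_base (snd x) \<in> fst c \<and> snd x \<in> V" for c V \<Phi> x
  proof -
    have "x \<in> points jb.fib_atlas"
      using that(3) jb.W1_subset by (auto simp: W0_def)
    then show ?thesis
      using that jb.fib_points_chart
      by (simp add: constrained_system.D_def[OF cs[OF that(1,2)]])
  qed
  note cond = constrained_system.determinant_condition[OF cs _ dom]
  show ?thesis (is "?S \<longleftrightarrow> ?R")
  proof
    assume ?S
    then have K: "?ker x" if "x \<in> ?W1" for x
      using that by (simp only: jb.symplectic_W1_iff[OF W1])
    show ?R
      by (intro ballI, clarify) (rule cond[THEN iffD2]; (assumption | rule conjI K))
  next
    assume R: ?R
    have "?ker x" if x: "x \<in> ?W1" for x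
    proof -
      have x0: "x \<in> W0 k \<A> M" using x jb.W1_subset by blast
      \<comment> \<open>\<open>F_cover\<close> supplies defining functions at the top jet of x. One
        pair of chart and functions suffices here, while the other direction yields every pair, so
        the condition is independent of the choice.\<close>
      then obtain V \<Phi> where V: "(V, \<Phi>) \<in> F" "snd x \<in> V"
        using F_cover by (auto simp: W0_def)
      obtain d where "d \<in> jb.fib_atlas" "x \<in> fst d"
        using x0 by (auto simp: W0_def points_def)
      then obtain c where c: "c \<in> \<A>" "jet_base (snd x) \<in> fst c"
        by (auto simp: fibre_atlas_def jb.fib_chart_dom)
      show ?thesis
        by (rule cond[THEN iffD1, OF c(1) V(1) x c(1) V(1) x])
          (use R c V x in \<open>blast+\<close>)
    qed
    then show ?S
      by (simp only: jb.symplectic_W1_iff[OF W1]) blast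
  qed
qed

end
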